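(* Let $\phi$ be a compactly supported distribution on $\mathbb{R}$ whose integer shifts are linearly independent, and let $V_\phi$ be the shift-invariant space generated by $\phi$. (i) If for $\lambda\in\mathbb{C}$ and $d\in\mathbb{N}_0$ the space $V_\phi$ contains a function $g(t)=e^{\lambda t}\sum_{k=0}^d p_k(t)\,\omega_k(t)$, where the functions $\omega_k:\mathbb{R}\to\mathbb{C}$ are $1$-periodic and analytic, $\omega_d\neq 0$ (not identically zero), and the polynomials $p_k$ are of degree $k$, then the sequences $$\Bigl\{\widehat{\phi}^{(k)}\Bigl(-\frac{i\lambda}{2\pi}+\ell\Bigr)\ :\ \ell\in\mathbb{Z}\Bigr\},\qquad k=0,\ldots,d,$$ decay exponentially as $|\ell|$ goes to infinity. (ii) Conversely, if for some $\lambda\in\mathbb{C}$ and $d\in\mathbb{N}_0$ the sequences $\{\widehat{\phi}^{(k)}(-\frac{i\lambda}{2\pi}+\ell):\ell\in\mathbb{Z}\}$, $k=0,\ldots,d$, decay exponentially, then $V_\phi$ contains the $(d+1)$-dimensional subspace of analytic functions $$H_\lambda=\Bigl\{\sum_{\ell\in\mathbb{Z}}e^{\lambda\ell}\,p(\ell)\,\phi(\cdot-\ell)\ :\ p\in\mathcal{P}_d\Bigr\}$$ spanned by $$\sum_{\ell\in\mathbb{Z}}e^{\lambda\ell}\,\ell^k\,\phi(t-\ell)=e^{\lambda t}\sum_{j=0}^k\binom{k}{j}\,t^{k-j}\,(-1)^j\,\omega_j(t),\qquad t\in\mathbb{R},\quad k=0,\ldots,d,$$ where $\omega_k$ are the $1$-periodic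 analytic functions given by $$\omega_k(t)=\Bigl(\frac{-1}{2\pi i}\Bigr)^k\sum_{\ell\in\mathbb{Z}}\widehat{\phi}^{(k)}\Bigl(-\frac{i\lambda}{2\pi}+\ell\Bigr)e^{2\pi i\ell t},\qquad k=0,\ldots,d,\quad t\in\mathbb{R}.$$
   Context: The shift-invariant space generated by $\phi$ is $V_\phi=\{\sum_{\ell\in\mathbb{Z}}c_\ell\,\phi(\cdot-\ell):\ (c_\ell)_{\ell\in\mathbb{Z}}\in\ell(\mathbb{Z})\}$, where $\ell(\mathbb{Z})$ is the space of all complex sequences on $\mathbb{Z}$ (the sums are locally finite since $\phi$ has compact support). An analytic function belongs to $V_\phi$ if it coincides with such a sum (as a distribution). The integer shifts of $\phi$ are linearly independent if $\sum_{\ell\in\mathbb{Z}}c_\ell\,\phi(\cdot-\ell)=0$ with $(c_\ell)\in\ell(\mathbb{Z})$ implies $c_\ell=0$ for all $\ell$. $\widehat{\phi}$ is the Fourier transform $\widehat{\phi}(y)=\int_{\mathbb{R}}\phi(x)e^{-2\pi i xy}\,dx$, extended analytically to $y\in\mathbb{C}$, and $\widehat{\phi}^{(k)}$ is its $k$-th derivative. A sequence $(b_\ell)_{\ell\in\mathbb{Z}}$ decays exponentially if there are $C>0$ and $q\in(0,1)$ with $|b_\ell|\le Cq^{|\ell|}$ for all $\ell\in\mathbb{Z}$. $\mathcal{P}_d$ is the space of polynomials of degree at most $d$. A function on $\mathbb{R}$ is analytic if it is infinitely differentiable on $\mathbb{R}$ and has a power series expansion around each point of $\mathbb{R}$. 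*)

theory Defs
  imports "HOL-Analysis.Analysis" "HOL-Computational_Algebra.Polynomial"
    "HOL-Library.Function_Algebras"
begin

section \<open>Smooth, analytic and test functions on the real line\<close>

definition nth_deriv :: "nat \<Rightarrow> (real \<Rightarrow> complex) \<Rightarrow> real \<Rightarrow> complex" where
  "nth_deriv n f = ((\<lambda>g x. vector_derivative g (at x)) ^^ n) f"

definition smooth :: "(real \<Rightarrow> complex) \<Rightarrow> bool" where
  "smooth f \<longleftrightarrow> (\<forall>n x. nth_deriv n f differentiable (at x))"

definition real_analytic :: "(real \<Rightarrow> complex) \<Rightarrow> bool" where
  "real_analytic f \<longleftrightarrow> smooth f \<and>
     (\<forall>x0. \<exists>a r. r > 0 \<and>
        (\<forall>x. \<bar>x - x0\<bar> < r \<longrightarrow> (\<lambda>n. a n * of_real (x - x0) ^ n) sums f x))"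

definition fun_support :: "(real \<Rightarrow> complex) \<Rightarrow> real set" where
  "fun_support f = closure {x. f x \<noteq> 0}"

definition test_functions :: "(real \<Rightarrow> complex) set" where
  "test_functions = {f. smooth f \<and> compact (fun_support f)}"

section \<open>Distributions\<close>

text \<open>A distribution is a linear functional on the test functions, continuous in the usual
  sense of seminorm estimates on compact sets. As HOL functions are total, we use the
  representatives that are 0 outside the test functions, so that equality of distributions is
  equality in HOL and distributions form a subspace of the space of all functionals.\<close>

type_synonym functional = "(real \<Rightarrow> complex) \<Rightarrow> complex"

definition distribution :: "functional \<Rightarrow> bool" where
  "distribution u \<longleftrightarrow>
     (\<forall>f. f \<notin> test_functions \<longrightarrow> u f = 0) \<and>
     (\<forall>f\<in>test_functions. \<forall>g\<in>test_functions. u (\<lambda>x. f x + g x) = u f + u g) \<and>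
     (\<forall>a. \<forall>f\<in>test_functions. u (\<lambda>x. a * f x) = a * u f) \<and>
     (\<forall>K. compact K \<longrightarrow> (\<exists>C N. \<forall>f\<in>test_functions. fun_support f \<subseteq> K \<longrightarrow>
        cmod (u f) \<le> C * (\<Sum>k\<le>N. SUP x. cmod (nth_deriv k f x))))"

definition dist_support :: "functional \<Rightarrow> real set" where
  "dist_support u = - \<Union>{U. open U \<and> (\<forall>f\<in>test_functions. fun_support f \<subseteq> U \<longrightarrow> u f = 0)}"

definition compactly_supported :: "functional \<Rightarrow> bool" where
  "compactly_supported u \<longleftrightarrow> compact (dist_support u)"

text \<open>The distribution given by a locally integrable (here: continuous) function.\<close>

definition regular_dist :: "(real \<Rightarrow> complex) \<Rightarrow> functional" where
  "regular_dist g f = (if f \<in> test_functions then LINT x|lborel. g x * f x else 0)"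

text \<open>The translate \<open>u(\<cdot> - a)\<close>.\<close>

definition translate :: "functional \<Rightarrow> real \<Rightarrow> functional" where
  "translate u a f = u (\<lambda>x. f (x + a))"

text \<open>Fourier transform of a compactly supported distribution at a complex argument: \<open>u\<close>
  extends to all smooth functions \<open>g\<close> by \<open>u (h * g)\<close>, where the test function \<open>h\<close> is 1 near
  the support of \<open>u\<close>; the value does not depend on the choice of \<open>h\<close>. Applied to
  \<open>g x = exp (-2 \<pi> i x y)\<close>, this is the entire extension of the Fourier transform.\<close>

definition cutoff :: "functional \<Rightarrow> real \<Rightarrow> complex" where
  "cutoff u = (SOME h. h \<in> test_functions \<and>
     (\<exists>U. open U \<and> dist_support u \<subseteq> U \<and> (\<forall>x\<in>U. h x = 1)))"

definition fourier :: "functional \<Rightarrow> complex \<Rightarrow> complex" where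
  "fourier u y = u (\<lambda>x. cutoff u x * exp (- 2 * of_real pi * \<i> * of_real x * y))"

section \<open>Shift-invariant spaces\<close>

text \<open>For compactly supported \<open>\<phi>\<close> only finitely many terms are nonzero at any fixed \<open>f\<close>.\<close>

definition shift_sum :: "functional \<Rightarrow> (int \<Rightarrow> complex) \<Rightarrow> functional" where
  "shift_sum \<phi> c f = (\<Sum>\<^sub>\<infinity>l. c l * translate \<phi> (of_int l) f)"

definition shift_invariant_space :: "functional \<Rightarrow> functional set" where
  "shift_invariant_space \<phi> = range (shift_sum \<phi>)"

definition shifts_independent :: "functional \<Rightarrow> bool" where
  "shifts_independent \<phi> \<longleftrightarrow> (\<forall>c. shift_sum \<phi> c = (\<lambda>f. 0) \<longrightarrow> (\<forall>l. c l = 0))"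

definition exp_decay :: "(int \<Rightarrow> complex) \<Rightarrow> bool" where
  "exp_decay b \<longleftrightarrow> (\<exists>C q. C > 0 \<and> 0 < q \<and> q < 1 \<and> (\<forall>l. cmod (b l) \<le> C * q ^ nat \<bar>l\<bar>))"

definition fourier_deriv_seq :: "functional \<Rightarrow> complex \<Rightarrow> nat \<Rightarrow> int \<Rightarrow> complex" where
  "fourier_deriv_seq \<phi> lam k l =
     (deriv ^^ k) (fourier \<phi>) (- \<i> * lam / (2 * of_real pi) + of_int l)"

definition omega :: "functional \<Rightarrow> complex \<Rightarrow> nat \<Rightarrow> real \<Rightarrow> complex" where
  "omega \<phi> lam k t = (- 1 / (2 * of_real pi * \<i>)) ^ k *
     (\<Sum>\<^sub>\<infinity>l. fourier_deriv_seq \<phi> lam k l * exp (2 * of_real pi * \<i> * of_int l * of_real t))"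

definition H_space :: "functional \<Rightarrow> complex \<Rightarrow> nat \<Rightarrow> functional set" where
  "H_space \<phi> lam d =
     {shift_sum \<phi> (\<lambda>l. exp (lam * of_int l) * poly p (of_int l)) | p. degree p \<le> d}"

text \<open>The complex vector space of functionals, for \<open>subspace\<close>, \<open>span\<close> and \<open>dim\<close>.\<close>

definition scale_functional :: "complex \<Rightarrow> functional \<Rightarrow> functional" where
  "scale_functional a u = (\<lambda>f. a * u f)"

interpretation functional: vector_space scale_functional
  by standard (auto simp: scale_functional_def plus_fun_def algebra_simps)

end

theory Submission
  imports Defs "HOL-Complex_Analysis.Complex_Analysis"
begin

text \<open>Write \<open>S j\<close> for the weighted shift sum \<open>\<Sum> exp (lam m) m^j \<phi>(t - m)\<close> and \<open>W k\<close> for the moment sum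
  \<open>\<Sum> exp (lam m) (t - m)^k \<phi>(t - m)\<close>. The binomial theorem expresses each of these two families by
  the other with polynomial coefficients in \<open>t\<close> (\<open>shift_sum_eq_moment_sums\<close> and
  \<open>moment_sum_eq_shift_sums\<close>). The advantage of \<open>W k\<close> is that \<open>exp (- lam t) W k\<close> is invariant under
  integer translations. Its Fourier coefficients are, up to the factor \<open>(- 2 \<pi> \<i>)^k\<close>, the values of
  the \<open>k\<close>-th derivative of the Fourier transform at the points \<open>- \<i> lam / (2 \<pi>) + l\<close>. The theorem thus
  rests on the equivalence, for periodic objects, between analyticity and exponential decay of the
  Fourier coefficients.

  From decay to analyticity: Poisson summation for test functions gives the Fourier expansion of
  \<open>W k\<close> (\<open>moment_sum_has_sum\<close>). If the coefficients decay exponentially, the series converges to an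
  analytic function, which is \<open>omega\<close> (\<open>moment_sum_eq_integral\<close>). The binomial theorem turns the
  formulas for the \<open>W j\<close> into the asserted ones for the \<open>S k\<close>, and the \<open>S k\<close> span the space in question.
  They are independent because the shifts are.

  From analyticity to decay: let \<open>c\<close> be the coefficient sequence of the given function \<open>g\<close> and put
  \<open>a l = exp (- lam l) c l\<close>. Forward differences with step one do not see functions of period one, so
  the difference of order \<open>d + 1\<close> annihilates \<open>exp (- lam t) g\<close>, and by independence of the shifts it
  annihilates \<open>a\<close>. The condition that \<open>\<omega> d\<close> is not zero shows that the difference of order \<open>d\<close> of \<open>a\<close>
  is a nonzero constant. By Newton's formula \<open>a\<close> is a polynomial of exact degree \<open>d\<close>, and all monomials
  of degree at most \<open>d\<close> are combinations of its differences. Hence each \<open>S j\<close> with \<open>j \<le> d\<close> is an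
  analytic function (\<open>represents_powers\<close>), and so is each \<open>W k\<close> with \<open>k \<le> d\<close>. The coefficients of an
  analytic periodic function decay by the Cauchy estimates and repeated integration by parts
  (\<open>fourier_decay_if_moment_sum_analytic\<close>).

  The analytic tools are developed from the definitions: the calculus of smooth functions, bump
  functions and partitions of unity, the localisation and continuity of distributions, and the
  uniqueness of Fourier coefficients, which is derived from the Stone--Weierstrass theorem.\<close>

section \<open>Calculus of smooth functions\<close>

lemma nth_deriv_0 [simp]: "nth_deriv 0 f = f"
  by (simp add: nth_deriv_def)

lemma nth_deriv_Suc: "nth_deriv (Suc n) f x = vector_derivative (nth_deriv n f) (at x)"
  by (simp add: nth_deriv_def)

lemma has_vector_derivative_nth_deriv:
  "smooth f \<Longrightarrow> (nth_deriv n f has_vector_derivative nth_deriv (Suc n) f x) (at x)"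
  unfolding nth_deriv_Suc by (metis smooth_def vector_derivative_works)

lemma continuous_on_nth_deriv [continuous_intros]: "smooth f \<Longrightarrow> continuous_on S (nth_deriv n f)"
  by (meson continuous_at_imp_continuous_on has_vector_derivative_continuous
      has_vector_derivative_nth_deriv)

lemma smooth_imp_continuous_on: "smooth f \<Longrightarrow> continuous_on S f"
  using continuous_on_nth_deriv[of f S 0] by simp

text \<open>Every rule of the calculus below is obtained by writing down the whole family of higher
  derivatives at once and checking that each member differentiates to the next one.\<close>

lemma nth_deriv_unique:
  assumes "D 0 = f" "\<And>n x. (D n has_vector_derivative D (Suc n) x) (at x)"
  shows "nth_deriv n f = D n"
proof (induction n)
  case (Suc n)
  then show ?case
    by (intro ext) (simp add: nth_deriv_Suc vector_derivative_at[OF assms(2)])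
qed (use assms(1) in auto)

lemma smoothI:
  assumes "D 0 = f" "\<And>n x. (D n has_vector_derivative D (Suc n) x) (at x)"
  shows "smooth f"
  unfolding smooth_def using nth_deriv_unique[OF assms] assms(2)
  by (metis differentiableI_vector)

lemma nth_deriv_nth_deriv: "smooth f \<Longrightarrow> nth_deriv n (nth_deriv m f) = nth_deriv (m + n) f"
  by (rule nth_deriv_unique[where D="\<lambda>n. nth_deriv (m + n) f"])
     (auto intro: has_vector_derivative_nth_deriv)

lemma smooth_nth_deriv: "smooth f \<Longrightarrow> smooth (nth_deriv m f)"
  by (rule smoothI[where D="\<lambda>n. nth_deriv (m + n) f"])
     (auto intro: has_vector_derivative_nth_deriv)

lemma smooth_if_deriv_smooth:
  assumes "\<And>x. (f has_vector_derivative g x) (at x)" "smooth g"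
  shows "smooth f"
proof (rule smoothI[where D="\<lambda>n. case n of 0 \<Rightarrow> f | Suc m \<Rightarrow> nth_deriv m g"])
  show "((case n of 0 \<Rightarrow> f | Suc m \<Rightarrow> nth_deriv m g) has_vector_derivative
         (case Suc n of 0 \<Rightarrow> f | Suc m \<Rightarrow> nth_deriv m g) x) (at x)" for n x
    using assms by (cases n) (auto intro: has_vector_derivative_nth_deriv)
qed auto

lemma
  assumes "smooth f" "smooth g"
  shows smooth_add: "smooth (\<lambda>x. f x + g x)"
    and nth_deriv_add: "nth_deriv n (\<lambda>x. f x + g x) = (\<lambda>x. nth_deriv n f x + nth_deriv n g x)"
  using smoothI[where D="\<lambda>n x. nth_deriv n f x + nth_deriv n g x" and f="\<lambda>x. f x + g x"]
    nth_deriv_unique[where D="\<lambda>n x. nth_deriv n f x + nth_deriv n g x" and f="\<lambda>x. f x + g x"]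
  by (auto intro!: derivative_intros has_vector_derivative_nth_deriv assms)

lemma smooth_const: "smooth (\<lambda>x. c)"
  by (rule smoothI[where D="\<lambda>n x. if n = 0 then c else 0"]) auto

lemma smooth_of_real: "smooth of_real"
  by (rule smooth_if_deriv_smooth[OF _ smooth_const[of 1]]) (auto intro!: derivative_eq_intros)

lemma
  assumes "smooth f"
  shows smooth_affine: "smooth (\<lambda>x. f (a * x + b))"
    and nth_deriv_affine: "nth_deriv n (\<lambda>x. f (a * x + b)) = (\<lambda>x. of_real (a ^ n) * nth_deriv n f (a * x + b))"
proof -
  have d: "((\<lambda>x. of_real (a ^ n) * nth_deriv n f (a * x + b)) has_vector_derivative
     of_real (a ^ Suc n) * nth_deriv (Suc n) f (a * x + b)) (at x)" for n x
  proof -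
    have "((\<lambda>x. a * x + b) has_vector_derivative a) (at x)"
      by (auto intro!: derivative_eq_intros)
    from vector_diff_chain_at[OF this has_vector_derivative_nth_deriv[OF assms]]
    have "((\<lambda>x. nth_deriv n f (a * x + b)) has_vector_derivative a *\<^sub>R nth_deriv (Suc n) f (a * x + b)) (at x)"
      by (simp add: o_def)
    from has_vector_derivative_mult_right[OF this, of "of_real (a ^ n)"]
    show ?thesis by (simp add: scaleR_conv_of_real mult_ac)
  qed
  show "smooth (\<lambda>x. f (a * x + b))"
    by (rule smoothI[where D="\<lambda>n x. of_real (a ^ n) * nth_deriv n f (a * x + b)", OF _ d]) auto
  show "nth_deriv n (\<lambda>x. f (a * x + b)) = (\<lambda>x. of_real (a ^ n) * nth_deriv n f (a * x + b))"
    by (rule nth_deriv_unique[where D="\<lambda>n x. of_real (a ^ n) * nth_deriv n f (a * x + b)", OF _ d]) auto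
qed

lemma
  shows smooth_exp: "smooth (\<lambda>x. exp (c * of_real x))"
    and nth_deriv_exp: "nth_deriv n (\<lambda>x. exp (c * of_real x)) = (\<lambda>x. c ^ n * exp (c * of_real x))"
proof -
  have d: "((\<lambda>x. c ^ n * exp (c * of_real x)) has_vector_derivative c ^ Suc n * exp (c * of_real x)) (at x)"
    for n x
  proof -
    have "((\<lambda>z. c ^ n * exp (c * z)) has_field_derivative c ^ Suc n * exp (c * of_real x)) (at (of_real x))"
      by (auto intro!: derivative_eq_intros)
    from has_vector_derivative_real_field[OF this] show ?thesis .
  qed
  show "smooth (\<lambda>x. exp (c * of_real x))"
    by (rule smoothI[where D="\<lambda>n x. c ^ n * exp (c * of_real x)", OF _ d]) auto
  show "nth_deriv n (\<lambda>x. exp (c * of_real x)) = (\<lambda>x. c ^ n * exp (c * of_real x))"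
    by (rule nth_deriv_unique[where D="\<lambda>n x. c ^ n * exp (c * of_real x)", OF _ d]) auto
qed

text \<open>The inductive step of the Leibniz formula, which is Pascal's rule: \<open>F k\<close> and \<open>G k\<close> stand
  for the \<open>k\<close>-th derivatives of the two factors.\<close>

lemma leibniz_sum_Suc:
  fixes F G :: "nat \<Rightarrow> 'a::comm_semiring_1"
  shows "(\<Sum>k\<le>n. of_nat (n choose k) * (F k * G (Suc (n - k)) + F (Suc k) * G (n - k)))
       = (\<Sum>k\<le>Suc n. of_nat (Suc n choose k) * (F k * G (Suc n - k)))"
proof -
  have "(\<Sum>k\<le>Suc n. of_nat (Suc n choose k) * (F k * G (Suc n - k)))
      = F 0 * G (Suc n) + (\<Sum>k\<le>n. of_nat ((n choose k) + (n choose Suc k)) * (F (Suc k) * G (n - k)))"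
    by (subst sum.atMost_Suc_shift) simp
  also have "\<dots> = (\<Sum>k\<le>n. of_nat (n choose k) * (F (Suc k) * G (n - k)))
      + (F 0 * G (Suc n) + (\<Sum>k\<le>n. of_nat (n choose Suc k) * (F (Suc k) * G (n - k))))"
    by (simp add: sum.distrib algebra_simps)
  also have "F 0 * G (Suc n) + (\<Sum>k\<le>n. of_nat (n choose Suc k) * (F (Suc k) * G (n - k)))
      = (\<Sum>k\<le>Suc n. of_nat (n choose k) * (F k * G (Suc n - k)))"
    by (subst sum.atMost_Suc_shift) simp
  also have "\<dots> = (\<Sum>k\<le>n. of_nat (n choose k) * (F k * G (Suc (n - k))))"
    by (simp add: Suc_diff_le binomial_eq_0)
  finally show ?thesis by (simp add: sum.distrib algebra_simps)
qed

lemma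
  assumes "smooth f" "smooth g"
  shows smooth_mult: "smooth (\<lambda>x. f x * g x)"
    and nth_deriv_mult: "nth_deriv n (\<lambda>x. f x * g x) =
          (\<lambda>x. \<Sum>k\<le>n. of_nat (n choose k) * (nth_deriv k f x * nth_deriv (n - k) g x))"
proof -
  let ?D = "\<lambda>n x. \<Sum>k\<le>n. of_nat (n choose k) * (nth_deriv k f x * nth_deriv (n - k) g x)"
  have d: "(?D n has_vector_derivative ?D (Suc n) x) (at x)" for n x
  proof -
    have "(?D n has_vector_derivative (\<Sum>k\<le>n. of_nat (n choose k) *
       (nth_deriv k f x * nth_deriv (Suc (n - k)) g x + nth_deriv (Suc k) f x * nth_deriv (n - k) g x))) (at x)"
      by (intro has_vector_derivative_sum has_vector_derivative_mult_right has_vector_derivative_mult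
            has_vector_derivative_nth_deriv assms)
    then show ?thesis
      unfolding leibniz_sum_Suc[of n "\<lambda>k. nth_deriv k f x" "\<lambda>k. nth_deriv k g x"] .
  qed
  show "smooth (\<lambda>x. f x * g x)"
    by (rule smoothI[where D="?D", OF _ d]) auto
  show "nth_deriv n (\<lambda>x. f x * g x) = ?D n"
    by (rule nth_deriv_unique[where D="?D", OF _ d]) auto
qed

lemma smooth_cmult: "smooth f \<Longrightarrow> smooth (\<lambda>x. c * f x)"
  by (rule smooth_mult[OF smooth_const])

lemma nth_deriv_cmult: "smooth f \<Longrightarrow> nth_deriv n (\<lambda>x. c * f x) = (\<lambda>x. c * nth_deriv n f x)"
  by (rule nth_deriv_unique[where D="\<lambda>n x. c * nth_deriv n f x"])
     (auto intro!: has_vector_derivative_mult_right has_vector_derivative_nth_deriv)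

lemma smooth_power: "smooth f \<Longrightarrow> smooth (\<lambda>x. f x ^ n)"
  by (induction n) (auto intro: smooth_const smooth_mult)

lemma
  assumes "\<And>i. i \<in> A \<Longrightarrow> smooth (f i)"
  shows smooth_sum: "smooth (\<lambda>x. \<Sum>i\<in>A. f i x)"
    and nth_deriv_sum: "nth_deriv n (\<lambda>x. \<Sum>i\<in>A. f i x) = (\<lambda>x. \<Sum>i\<in>A. nth_deriv n (f i) x)"
proof -
  have d: "((\<lambda>x. \<Sum>i\<in>A. nth_deriv n (f i) x) has_vector_derivative (\<Sum>i\<in>A. nth_deriv (Suc n) (f i) x)) (at x)"
    for n x
    by (intro has_vector_derivative_sum has_vector_derivative_nth_deriv assms)
  show "smooth (\<lambda>x. \<Sum>i\<in>A. f i x)"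
    by (rule smoothI[where D="\<lambda>n x. \<Sum>i\<in>A. nth_deriv n (f i) x", OF _ d]) auto
  show "nth_deriv n (\<lambda>x. \<Sum>i\<in>A. f i x) = (\<lambda>x. \<Sum>i\<in>A. nth_deriv n (f i) x)"
    by (rule nth_deriv_unique[where D="\<lambda>n x. \<Sum>i\<in>A. nth_deriv n (f i) x", OF _ d]) auto
qed

lemma smooth_diff: "smooth f \<Longrightarrow> smooth g \<Longrightarrow> smooth (\<lambda>x. f x - g x)"
  using smooth_add[of f "\<lambda>x. (-1) * g x"] smooth_cmult[of g "-1"] by simp

lemma smooth_translate: "smooth f \<Longrightarrow> smooth (\<lambda>x. f (x + b))"
  using smooth_affine[of f 1 b] by simp

lemma nth_deriv_translate: "smooth f \<Longrightarrow> nth_deriv n (\<lambda>x. f (x + b)) = (\<lambda>x. nth_deriv n f (x + b))"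
  using nth_deriv_affine[of f n 1 b] by simp

section \<open>Test functions\<close>

lemma nonzero_in_fun_support: "f x \<noteq> 0 \<Longrightarrow> x \<in> fun_support f"
  unfolding fun_support_def by (rule closure_subset[THEN subsetD]) simp

lemma zero_outside_fun_support: "x \<notin> fun_support f \<Longrightarrow> f x = 0"
  using nonzero_in_fun_support by blast

lemma closed_fun_support: "closed (fun_support f)"
  by (simp add: fun_support_def)

lemma fun_support_minimal: "closed K \<Longrightarrow> (\<And>x. x \<notin> K \<Longrightarrow> f x = 0) \<Longrightarrow> fun_support f \<subseteq> K"
  unfolding fun_support_def by (intro closure_minimal) auto

lemma test_functionsI:
  assumes "smooth f" "compact K" "\<And>x. x \<notin> K \<Longrightarrow> f x = 0"
  shows "f \<in> test_functions"
proof -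
  have "fun_support f \<subseteq> K"
    using assms by (intro fun_support_minimal compact_imp_closed)
  then have "compact (fun_support f)"
    using compact_Int_closed[OF assms(2) closed_fun_support[of f]] by (simp add: Int_absorb1)
  with assms(1) show ?thesis by (simp add: test_functions_def)
qed

lemma test_function_smooth: "f \<in> test_functions \<Longrightarrow> smooth f"
  and test_function_compact: "f \<in> test_functions \<Longrightarrow> compact (fun_support f)"
  by (auto simp: test_functions_def)

lemma test_function_bounded_support:
  assumes "f \<in> test_functions"
  obtains M :: nat where "\<And>x. \<bar>x\<bar> \<ge> real M \<Longrightarrow> f x = 0"
proof -
  obtain B where B: "\<And>x. x \<in> fun_support f \<Longrightarrow> \<bar>x\<bar> \<le> B"
    using compact_imp_bounded[OF test_function_compact[OF assms]] by (auto simp: bounded_iff)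
  obtain M where M: "B < real M" using reals_Archimedean2 by blast
  show thesis
    by (rule that[of M]) (meson B M le_less_trans less_le_not_le nonzero_in_fun_support)
qed

lemma test_function_mult_smooth:
  assumes "f \<in> test_functions" "smooth g"
  shows "(\<lambda>x. f x * g x) \<in> test_functions" "(\<lambda>x. g x * f x) \<in> test_functions"
  by (rule test_functionsI[OF smooth_mult test_function_compact[OF assms(1)]],
      simp_all add: assms test_function_smooth zero_outside_fun_support)+

lemma test_function_cmult: "f \<in> test_functions \<Longrightarrow> (\<lambda>x. c * f x) \<in> test_functions"
  by (rule test_function_mult_smooth(2)[OF _ smooth_const])

lemma test_function_add:
  assumes "f \<in> test_functions" "g \<in> test_functions"
  shows "(\<lambda>x. f x + g x) \<in> test_functions"
  by (rule test_functionsI[OF smooth_add compact_Un[OF test_function_compact[OF assms(1)]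
        test_function_compact[OF assms(2)]]])
     (simp_all add: assms test_function_smooth zero_outside_fun_support)

lemma test_function_zero: "(\<lambda>x. 0) \<in> test_functions"
  by (rule test_functionsI[where K="{}"]) (auto intro: smooth_const)

lemma test_function_sum:
  "(\<And>i. i \<in> A \<Longrightarrow> f i \<in> test_functions) \<Longrightarrow> (\<lambda>x. \<Sum>i\<in>A. f i x) \<in> test_functions"
proof (induction A rule: infinite_finite_induct)
  case (insert i A)
  then show ?case using test_function_add[of "f i" "\<lambda>x. \<Sum>i\<in>A. f i x"] by simp
qed (simp_all add: test_function_zero)

lemma test_function_affine:
  assumes "f \<in> test_functions" "a \<noteq> 0"
  shows "(\<lambda>x. f (a * x + b)) \<in> test_functions"
proof (rule test_functionsI)
  show "compact ((\<lambda>y. (1/a) * y + (- b / a)) ` fun_support f)"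
    by (intro compact_continuous_image test_function_compact assms continuous_intros)
  fix x assume "x \<notin> (\<lambda>y. (1/a) * y + (- b / a)) ` fun_support f"
  moreover have "x = (1/a) * (a * x + b) + (- b / a)" using assms(2) by (simp add: field_simps)
  ultimately show "f (a * x + b) = 0" by (metis image_eqI zero_outside_fun_support)
qed (intro smooth_affine test_function_smooth assms)

lemma test_function_translate: "f \<in> test_functions \<Longrightarrow> (\<lambda>x. f (x + b)) \<in> test_functions"
  using test_function_affine[of f 1 b] by simp

lemma test_function_translate_iff: "(\<lambda>x. f (x + b)) \<in> test_functions \<longleftrightarrow> f \<in> test_functions"
  using test_function_translate[of f b] test_function_translate[of "\<lambda>x. f (x + b)" "- b"] by auto

lemma test_function_nth_deriv:
  assumes "f \<in> test_functions"
  shows "nth_deriv n f \<in> test_functions" "x \<notin> fun_support f \<Longrightarrow> nth_deriv n f x = 0"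
proof -
  have z: "nth_deriv n f x = 0" if "x \<notin> fun_support f" for x
    using that
  proof (induction n arbitrary: x)
    case (Suc n)
    have "((\<lambda>x. 0) has_vector_derivative nth_deriv (Suc n) f x) (at x)"
      by (rule has_vector_derivative_transform_within_open[OF
            has_vector_derivative_nth_deriv[OF test_function_smooth[OF assms]]
             open_Compl[OF closed_fun_support]]) (use Suc in auto)
    then show ?case
      by (metis has_vector_derivative_const vector_derivative_at)
  qed (simp add: zero_outside_fun_support)
  then show "x \<notin> fun_support f \<Longrightarrow> nth_deriv n f x = 0" by simp
  show "nth_deriv n f \<in> test_functions"
    by (rule test_functionsI[OF smooth_nth_deriv[OF test_function_smooth[OF assms]]
          test_function_compact[OF assms] z])
qed

lemma test_function_bounded:
  assumes "f \<in> test_functions"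
  obtains B where "B > 0" "\<And>x. cmod (f x) \<le> B"
proof -
  have "bounded (f ` fun_support f)"
    by (intro compact_imp_bounded compact_continuous_image smooth_imp_continuous_on
       test_function_smooth test_function_compact assms)
  then obtain B where B: "B > 0" "\<And>x. x \<in> fun_support f \<Longrightarrow> cmod (f x) \<le> B"
    unfolding bounded_pos by auto
  have "cmod (f x) \<le> B" for x
    by (cases "x \<in> fun_support f") (use B in \<open>auto simp: zero_outside_fun_support\<close>)
  with B(1) show thesis using that by blast
qed

section \<open>Bump functions and partitions of unity\<close>

lemma
  fixes F :: "real \<Rightarrow> complex"
  assumes "continuous_on UNIV F" "\<And>x. x \<notin> {a..b} \<Longrightarrow> F x = 0"
  shows integrable_compact_support: "integrable lborel F"
    and lint_eq_integral: "(LINT x|lborel. F x) = integral {a..b} F"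
proof -
  have F: "F = (\<lambda>x. indicator {a..b} x *\<^sub>R F x)"
    using assms(2) by (force simp: indicator_def)
  have i: "integrable lborel (\<lambda>x. indicator {a..b} x *\<^sub>R F x)"
    using continuous_on_subset[OF assms(1)] by (intro borel_integrable_compact) auto
  then show "integrable lborel F" using F by simp
  have "(LINT x|lborel. F x) = (LINT x:{a..b}|lborel. F x)"
    unfolding set_lebesgue_integral_def using F by simp
  also have "\<dots> = integral {a..b} F"
    by (rule set_borel_integral_eq_integral(2)) (use i in \<open>simp add: set_integrable_def\<close>)
  finally show "(LINT x|lborel. F x) = integral {a..b} F" .
qed

text \<open>For \<open>p = 1\<close> this is the classical function that vanishes to infinite order
  at \<open>0\<close>. The polynomial factor is there to make the family closed under differentiation.\<close>

definition flat_exp :: "real poly \<Rightarrow> real \<Rightarrow> real" where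
  "flat_exp p x = (if x > 0 then poly p (1 / x) * exp (- (1 / x)) else 0)"

lemma poly_times_exp_minus_tendsto_0: "((\<lambda>u. poly p u * exp (- u)) \<longlongrightarrow> (0::real)) at_top"
proof -
  have "((\<lambda>u. \<Sum>i\<le>degree p. coeff p i * (u ^ i / exp u)) \<longlongrightarrow> (\<Sum>i\<le>degree p. coeff p i * 0)) at_top"
    by (intro tendsto_intros tendsto_power_div_exp_0)
  then show ?thesis
    by (simp add: poly_altdef sum_distrib_right sum_divide_distrib exp_minus divide_inverse mult.assoc)
qed

text \<open>Away from \<open>0\<close> this is the chain rule. At \<open>0\<close> the difference quotient from the right is,
  in terms of \<open>v = 1 / y\<close>, a polynomial in \<open>v\<close> times \<open>exp (- v)\<close>, and it tends to \<open>0\<close>.\<close>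

lemma has_real_derivative_flat_exp:
  "(flat_exp p has_real_derivative flat_exp ([:0, 0, 1:] * (p - pderiv p)) x) (at x)"
proof -
  consider "x < 0" | "x > 0" | "x = 0" by linarith
  then show ?thesis
  proof cases
    case 1
    then have "(flat_exp p has_real_derivative 0) (at x)"
      by (intro DERIV_cong[OF has_field_derivative_transform_within_open[OF DERIV_const, where S="{..<0}"]])
         (auto simp: flat_exp_def)
    with 1 show ?thesis by (simp add: flat_exp_def)
  next
    case 2
    have "((\<lambda>x. poly p (1 / x) * exp (- (1 / x))) has_real_derivative
            flat_exp ([:0, 0, 1:] * (p - pderiv p)) x) (at x)"
      using 2 by (auto intro!: derivative_eq_intros DERIV_chain'[OF _ poly_DERIV]
           simp: flat_exp_def field_simps power2_eq_square)
    then show ?thesis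
      by (rule has_field_derivative_transform_within_open[where S="{0<..}"])
         (use 2 in \<open>auto simp: flat_exp_def\<close>)
  next
    case 3
    have "((\<lambda>y. (flat_exp p y - flat_exp p 0) / (y - 0)) \<longlongrightarrow> 0) (at 0)"
    proof (rule filterlim_split_at)
      show "((\<lambda>y. (flat_exp p y - flat_exp p 0) / (y - 0)) \<longlongrightarrow> 0) (at_left 0)"
        by (rule tendsto_eventually) (auto simp: eventually_at_left_field flat_exp_def intro!: exI[of _ "-1"])
      show "((\<lambda>y. (flat_exp p y - flat_exp p 0) / (y - 0)) \<longlongrightarrow> 0) (at_right 0)"
        unfolding filterlim_at_right_to_top
      proof (rule Lim_transform_eventually[OF poly_times_exp_minus_tendsto_0[of "[:0, 1:] * p"]])
        show "\<forall>\<^sub>F u in at_top. poly ([:0, 1:] * p) u * exp (- u) =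
             (flat_exp p (inverse u) - flat_exp p 0) / (inverse u - 0)"
          using eventually_gt_at_top[of 0]
          by eventually_elim (auto simp: flat_exp_def field_simps)
      qed
    qed
    then show ?thesis
      unfolding 3 has_field_derivative_iff by (simp add: flat_exp_def)
  qed
qed

lemma smooth_flat_exp: "smooth (\<lambda>x. of_real (flat_exp p x))"
proof (rule smoothI)
  let ?D = "\<lambda>n. ((\<lambda>p. [:0, 0, 1:] * (p - pderiv p)) ^^ n) p"
  show "((\<lambda>x. complex_of_real (flat_exp (?D n) x)) has_vector_derivative
          complex_of_real (flat_exp (?D (Suc n)) x)) (at x)" for n x
    using has_vector_derivative_of_real[OF has_real_derivative_flat_exp[of "?D n" x]] by simp
qed simp

definition bump :: "real \<Rightarrow> real" where
  "bump x = flat_exp 1 x * flat_exp 1 (1 - x)"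

lemma bump_pos: "0 < x \<Longrightarrow> x < 1 \<Longrightarrow> bump x > 0"
  and bump_nonneg: "bump x \<ge> 0"
  and bump_zero: "x \<le> 0 \<or> x \<ge> 1 \<Longrightarrow> bump x = 0"
  by (auto simp: bump_def flat_exp_def)

lemma smooth_bump: "smooth (\<lambda>x. of_real (bump x))"
  using smooth_mult[OF smooth_flat_exp[of 1] smooth_affine[OF smooth_flat_exp[of 1], of "-1" 1]]
  by (simp add: bump_def)

lemma continuous_on_bump: "continuous_on S bump"
proof -
  have "continuous_on S (\<lambda>x. Re (of_real (bump x)))"
    by (intro continuous_on_Re smooth_imp_continuous_on smooth_bump)
  then show ?thesis by simp
qed

text \<open>The normalised primitive of the bump function.\<close>

lemma smooth_step_exists:
  obtains \<sigma> :: "real \<Rightarrow> complex"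
  where "smooth \<sigma>" "\<And>x. x \<le> 0 \<Longrightarrow> \<sigma> x = 0" "\<And>x. x \<ge> 1 \<Longrightarrow> \<sigma> x = 1"
proof -
  \<comment> \<open>Starting at \<open>- 1\<close> makes every point of the support of the bump an interior point of the domain.\<close>
  define I where "I x = integral {-1..x} bump" for x
  have I0: "I x = 0" if "x \<le> 0" for x
  proof -
    have "I x = integral {-1..x} (\<lambda>x. 0)"
      unfolding I_def by (rule integral_cong) (use that in \<open>auto intro: bump_zero\<close>)
    then show ?thesis by simp
  qed
  have I1: "I x = I 1" if "x \<ge> 1" for x
  proof -
    have "integral {-1..1} bump + integral {1..x} bump = integral {-1..x} bump"
      using that by (intro Henstock_Kurzweil_Integration.integral_combine integrable_continuous_real
        continuous_on_bump) auto
    moreover have "integral {1..x} bump = integral {1..x} (\<lambda>x. 0)"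
      by (rule integral_cong) (auto intro: bump_zero)
    ultimately show ?thesis by (simp add: I_def)
  qed
  have Ipos: "I 1 \<noteq> 0"
  proof
    assume "I 1 = 0"
    then have "\<forall>x\<in>{-1..1}. bump x = 0"
      unfolding I_def using integral_eq_0_iff[of "-1" 1 bump] continuous_on_bump bump_nonneg by simp
    then show False using bump_pos[of "1/2"] by auto
  qed
  have d: "(I has_real_derivative bump x) (at x)" for x
  proof (cases "x < 0")
    case True
    have "(I has_real_derivative 0) (at x)"
      by (rule has_field_derivative_transform_within_open[OF DERIV_const, where S="{..<0}"])
         (use True I0 in auto)
    with True show ?thesis by (simp add: bump_zero)
  next
    case False
    have "((\<lambda>x. integral {-1..x} bump) has_real_derivative bump x) (at x within {-1..x+1})"
      by (rule integral_has_real_derivative) (use False continuous_on_bump in auto)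
    moreover have "at x within {-1..x+1} = at x"
      by (rule at_within_interior) (use False in auto)
    ultimately show ?thesis by (simp add: I_def[abs_def])
  qed
  show thesis
  proof (rule that)
    have "((\<lambda>x. complex_of_real (1 / I 1) * complex_of_real (I x)) has_vector_derivative
       complex_of_real (1 / I 1) * complex_of_real (bump x)) (at x)" for x
      by (intro has_vector_derivative_mult_right has_vector_derivative_of_real d)
    then show "smooth (\<lambda>x. complex_of_real (1 / I 1) * complex_of_real (I x))"
      by (rule smooth_if_deriv_smooth) (intro smooth_cmult smooth_bump)
    show "complex_of_real (1 / I 1) * complex_of_real (I x) = 0" if "x \<le> 0" for x
      using I0[OF that] by simp
    show "complex_of_real (1 / I 1) * complex_of_real (I x) = 1" if "x \<ge> 1" for x
      using Ipos by (subst I1[OF that]) (simp flip: of_real_mult)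
  qed
qed

text \<open>With a smooth step function \<open>\<sigma>\<close>, the function \<open>\<sigma> x - \<sigma> (x - 1)\<close> is a test function whose
  integer translates add up to \<open>1\<close>, because the sum telescopes. The bound relating \<open>x\<close> and \<open>N\<close>
  says how many translates are needed.\<close>

lemma partition_of_unity_exists:
  obtains \<eta> :: "real \<Rightarrow> complex"
  where "\<eta> \<in> test_functions" "\<And>x. x \<notin> {0..2} \<Longrightarrow> \<eta> x = 0"
    "\<And>N x. \<bar>x\<bar> + 1 \<le> real N \<Longrightarrow> (\<Sum>l\<in>{- int N..int N}. \<eta> (x + of_int l)) = 1"
proof -
  obtain \<sigma> where \<sigma>: "smooth \<sigma>" "\<And>x. x \<le> 0 \<Longrightarrow> \<sigma> x = 0" "\<And>x. x \<ge> 1 \<Longrightarrow> \<sigma> x = 1"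
    using smooth_step_exists by blast
  define \<eta> where "\<eta> x = \<sigma> x - \<sigma> (x - 1)" for x
  have z: "\<eta> x = 0" if "x \<notin> {0..2}" for x
  proof -
    from that consider "x \<le> 0" | "x - 1 \<ge> 1" by fastforce
    then show ?thesis by cases (simp_all add: \<eta>_def \<sigma>(2,3))
  qed
  have "smooth \<eta>"
    using smooth_diff[OF \<sigma>(1) smooth_translate[OF \<sigma>(1), of "-1"]] by (simp add: \<eta>_def[abs_def])
  then have "\<eta> \<in> test_functions"
    using z by (intro test_functionsI[where K="{0..2}"]) auto
  moreover have "(\<Sum>l\<in>{- int N..int N}. \<eta> (x + of_int l)) = \<sigma> (x + real N) - \<sigma> (x - real N - 1)" for N x
  proof (induction N)
    case (Suc N)
    have "{- int (Suc N)..int (Suc N)} = insert (- int (Suc N)) (insert (int (Suc N)) {- int N..int N})"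
      by auto
    then show ?case using Suc by (simp add: \<eta>_def algebra_simps)
  qed (simp add: \<eta>_def)
  ultimately show thesis
    using z \<sigma>(2,3) by (intro that[of \<eta>]) auto
qed

text \<open>The fundamental lemma of the calculus of variations. If \<open>g x0 \<noteq> 0\<close>, then \<open>g\<close>, rotated by
  \<open>cnj (g x0)\<close>, has positive real part near \<open>x0\<close>, and testing against a bump function there gives
  a positive value.\<close>

lemma regular_dist_eq_0_imp:
  assumes g: "continuous_on UNIV g" and z: "\<And>f. f \<in> test_functions \<Longrightarrow> (LINT x|lborel. g x * f x) = 0"
  shows "g x0 = 0"
proof (rule ccontr)
  assume nz: "g x0 \<noteq> 0"
  define r where "r x = Re (cnj (g x0) * g x)" for x
  have r: "continuous_on UNIV r"
    unfolding r_def by (intro continuous_intros g)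
  have r0: "r x0 > 0"
    using nz by (auto simp: r_def complex_eq_iff sum_squares_gt_zero_iff)
  have "open (r -` {0<..})"
    using r by (simp add: continuous_on_open_vimage[OF open_UNIV] open_vimage)
  then obtain e where e: "e > 0" "\<And>x. \<bar>x - x0\<bar> < e \<Longrightarrow> r x > 0"
    using r0 unfolding open_dist by (force simp: dist_real_def)
  define a where "a = 1 / e"
  \<comment> \<open>The bump function, rescaled to be positive exactly at the points closer than \<open>e / 2\<close> to \<open>x0\<close>.\<close>
  define b where "b x = bump (a * x + (1/2 - a * x0))" for x
  have b_nz: "\<bar>x - x0\<bar> < e / 2" if "b x \<noteq> 0" for x
  proof -
    have "\<not> (a * x + (1/2 - a * x0) \<le> 0 \<or> a * x + (1/2 - a * x0) \<ge> 1)"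
      using that bump_zero unfolding b_def by blast
    then show ?thesis using e(1) by (auto simp: a_def field_simps abs_if)
  qed
  have bn: "b x \<ge> 0" for x by (simp add: b_def bump_nonneg)
  have bc: "continuous_on UNIV b"
    unfolding b_def by (rule continuous_on_compose2[OF continuous_on_bump[of UNIV]]) (auto intro!: continuous_intros)
  define f where "f x = cnj (g x0) * complex_of_real (b x)" for x
  have f: "f \<in> test_functions"
  proof (rule test_functionsI)
    show "smooth f" unfolding f_def[abs_def] b_def
      by (intro smooth_cmult smooth_affine[OF smooth_bump])
    show "f x = 0" if "x \<notin> cball x0 (e/2)" for x
      using b_nz[of x] that by (auto simp: f_def dist_real_def abs_minus_commute)
  qed simp
  have cont: "continuous_on UNIV (\<lambda>x. g x * f x)"
    unfolding f_def by (intro continuous_intros g bc)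
  have "0 = (LINT x|lborel. g x * f x)" using z[OF f] by simp
  also have "\<dots> = integral {x0 - e..x0 + e} (\<lambda>x. g x * f x)"
  proof (rule lint_eq_integral[OF cont])
    show "g x * f x = 0" if "x \<notin> {x0 - e..x0 + e}" for x
      using that b_nz[of x] e(1) by (auto simp: f_def abs_if split: if_splits)
  qed
  finally have "0 = Re (integral {x0 - e..x0 + e} (\<lambda>x. g x * f x))" by (metis zero_complex.sel(1))
  also have "\<dots> = integral {x0 - e..x0 + e} (\<lambda>x. Re (g x * f x))"
    using integral_linear[OF integrable_continuous_real[OF continuous_on_subset[OF cont subset_UNIV]]
      bounded_linear_Re] by (simp add: o_def)
  also have "\<dots> = integral {x0 - e..x0 + e} (\<lambda>x. r x * b x)"
    by (rule arg_cong[of _ _ "integral _"]) (auto simp: r_def f_def fun_eq_iff algebra_simps)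
  finally have "\<forall>x\<in>{x0 - e..x0 + e}. r x * b x = 0"
  proof (subst (asm) eq_commute, subst (asm) integral_eq_0_iff)
    show "continuous_on {x0 - e..x0 + e} (\<lambda>x. r x * b x)"
      by (rule continuous_on_subset[of UNIV]) (auto intro!: continuous_intros r bc)
    show "0 \<le> r x * b x" for x
      using e(2)[of x] b_nz[of x] bn[of x] e(1) by (cases "b x = 0") auto
  qed (use e in auto)
  moreover have "b x0 > 0" unfolding b_def by (rule bump_pos) auto
  moreover have "x0 \<in> {x0 - e..x0 + e}" using e(1) by simp
  ultimately have "r x0 * b x0 = 0" by blast
  with \<open>b x0 > 0\<close> r0 show False by simp
qed

section \<open>Localisation of distributions\<close>

lemma distribution_outside: "distribution u \<Longrightarrow> f \<notin> test_functions \<Longrightarrow> u f = 0"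
  and distribution_add:
    "distribution u \<Longrightarrow> f \<in> test_functions \<Longrightarrow> g \<in> test_functions \<Longrightarrow> u (\<lambda>x. f x + g x) = u f + u g"
  and distribution_cmult:
    "distribution u \<Longrightarrow> f \<in> test_functions \<Longrightarrow> u (\<lambda>x. a * f x) = a * u f"
  by (simp_all add: distribution_def)

lemma distribution_zero: "distribution u \<Longrightarrow> u (\<lambda>x. 0) = 0"
  using distribution_cmult[of u "\<lambda>x. 0" 0] test_function_zero by simp

lemma distribution_sum:
  assumes "distribution u" "\<And>i. i \<in> A \<Longrightarrow> f i \<in> test_functions"
  shows "u (\<lambda>x. \<Sum>i\<in>A. f i x) = (\<Sum>i\<in>A. u (f i))"
  using assms(2)
proof (induction A rule: infinite_finite_induct)
  case (insert i A)
  then show ?case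
    using distribution_add[OF assms(1), of "f i" "\<lambda>x. \<Sum>i\<in>A. f i x"] by (simp add: test_function_sum)
qed (simp_all add: distribution_zero assms(1))

lemma distribution_diff:
  assumes "distribution u" "f \<in> test_functions" "g \<in> test_functions"
  shows "u (\<lambda>x. f x - g x) = u f - u g"
  using distribution_add[OF assms(1,2) test_function_cmult[OF assms(3), of "-1"]]
    distribution_cmult[OF assms(1,3), of "-1"] by simp

text \<open>The support is defined by the vanishing of the distribution on single open sets, so a test
  function that lives off the support has to be cut into pieces each of which lives in one such
  set. A Lebesgue number \<open>e\<close> of the cover gives the scale, and a partition of unity rescaled to
  pieces of length \<open>2 * e / 3\<close> does the cutting.\<close>

lemma distribution_vanishes_off_support:
  assumes u: "distribution u" and f: "f \<in> test_functions"
    and disj: "fun_support f \<inter> dist_support u = {}"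
  shows "u f = 0"
proof -
  let ?G = "{U. open U \<and> (\<forall>f\<in>test_functions. fun_support f \<subseteq> U \<longrightarrow> u f = 0)}"
  have "fun_support f \<subseteq> \<Union>?G" using disj unfolding dist_support_def by blast
  then obtain e where e: "e > 0" "\<And>x. x \<in> fun_support f \<Longrightarrow> \<exists>U\<in>?G. ball x e \<subseteq> U"
    using Heine_Borel_lemma[OF test_function_compact[OF f], of ?G] by blast
  obtain \<eta> where \<eta>: "\<eta> \<in> test_functions" "\<And>x. x \<notin> {0..2} \<Longrightarrow> \<eta> x = 0"
    "\<And>N x. \<bar>x\<bar> + 1 \<le> real N \<Longrightarrow> (\<Sum>l\<in>{- int N..int N}. \<eta> (x + of_int l)) = 1"
    using partition_of_unity_exists by blast
  obtain M where M: "\<And>x. \<bar>x\<bar> \<ge> real M \<Longrightarrow> f x = 0"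
    using test_function_bounded_support[OF f] by blast
  define a where "a = 3 / e"
  have a: "a > 0" using e by (simp add: a_def)
  obtain N where N: "a * real M + 1 \<le> real N" using real_arch_simple by blast
  have eq: "f x = (\<Sum>l\<in>{- int N..int N}. f x * \<eta> (a * x + of_int l))" for x
  proof (cases "f x = 0")
    case False
    then have "\<bar>x\<bar> < real M" using M by (meson not_le)
    then have "\<bar>a * x\<bar> \<le> a * real M" using a by (simp add: abs_mult)
    then show ?thesis using \<eta>(3)[of "a * x" N] N by (simp flip: sum_distrib_left)
  qed simp
  have t: "(\<lambda>x. f x * \<eta> (a * x + of_int l)) \<in> test_functions" for l
    by (intro test_function_mult_smooth(1) f smooth_affine test_function_smooth \<eta>)
  have z: "u (\<lambda>x. f x * \<eta> (a * x + of_int l)) = 0" for l :: int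
  proof (cases "\<exists>y. f y * \<eta> (a * y + of_int l) \<noteq> 0")
    case True
    then obtain y where y: "f y \<noteq> 0" "\<eta> (a * y + of_int l) \<noteq> 0" by auto
    obtain U where U: "U \<in> ?G" "ball y e \<subseteq> U"
      using e(2)[of y] nonzero_in_fun_support[of f y, OF y(1)] by blast
    have "fun_support (\<lambda>x. f x * \<eta> (a * x + of_int l)) \<subseteq> cball y (2 * e / 3)"
    proof (rule fun_support_minimal)
      fix x assume x: "x \<notin> cball y (2 * e / 3)"
      have "a * y + of_int l \<in> {0..2}" using y(2) \<eta>(2) by blast
      moreover have "\<bar>a * x - a * y\<bar> > 2"
      proof -
        have "\<bar>x - y\<bar> > 2 * e / 3" using x by (simp add: dist_real_def abs_minus_commute)
        then have "a * \<bar>x - y\<bar> > a * (2 * e / 3)" using a by simp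
        also have "a * (2 * e / 3) = 2" using e(1) by (simp add: a_def)
        also have "a * \<bar>x - y\<bar> = \<bar>a * x - a * y\<bar>" using a by (simp add: abs_mult flip: right_diff_distrib)
        finally show ?thesis .
      qed
      ultimately have "a * x + of_int l \<notin> {0..2}" by auto
      then show "f x * \<eta> (a * x + of_int l) = 0" using \<eta>(2) by simp
    qed simp
    also have "\<dots> \<subseteq> ball y e" using e(1) by auto
    finally show ?thesis using U t by blast
  next
    case False
    then have "(\<lambda>x. f x * \<eta> (a * x + of_int l)) = (\<lambda>x. 0)" by blast
    then show ?thesis using distribution_zero[OF u] by simp
  qed
  have "u f = u (\<lambda>x. \<Sum>l\<in>{- int N..int N}. f x * \<eta> (a * x + of_int l))"
    using eq by (intro arg_cong[of _ _ u] ext)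
  also have "\<dots> = 0" using distribution_sum[OF u t] z by simp
  finally show ?thesis .
qed

definition is_cutoff :: "functional \<Rightarrow> (real \<Rightarrow> complex) \<Rightarrow> bool" where
  "is_cutoff u h \<longleftrightarrow> h \<in> test_functions \<and>
     (\<exists>U. open U \<and> dist_support u \<subseteq> U \<and> (\<forall>x\<in>U. h x = 1))"

lemma is_cutoff_test: "is_cutoff u h \<Longrightarrow> h \<in> test_functions"
  by (simp add: is_cutoff_def)

lemma dist_support_bounded:
  assumes "compactly_supported u"
  obtains R :: nat where "dist_support u \<subseteq> {- real R<..<real R}"
proof -
  obtain B where B: "\<And>x. x \<in> dist_support u \<Longrightarrow> \<bar>x\<bar> \<le> B"
    using compact_imp_bounded[OF assms[unfolded compactly_supported_def]] by (auto simp: bounded_iff)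
  obtain R where "B < real R" using reals_Archimedean2 by blast
  with B show thesis by (intro that[of R]) force
qed

lemma is_cutoff_partition_sum:
  assumes supp: "dist_support u \<subseteq> {- real R<..<real R}" and \<eta>: "\<eta> \<in> test_functions"
    "\<And>N x. \<bar>x\<bar> + 1 \<le> real N \<Longrightarrow> (\<Sum>l\<in>{- int N..int N}. \<eta> (x + of_int l)) = 1"
    and N: "N \<ge> R + 1"
  shows "is_cutoff u (\<lambda>x. \<Sum>l\<in>{- int N..int N}. \<eta> (x + of_int l))"
  unfolding is_cutoff_def
  using \<eta> supp N
  by (auto intro!: test_function_sum test_function_translate exI[of _ "{- real R<..<real R}"] \<eta>(2))

lemma is_cutoff_cutoff:
  assumes "compactly_supported u"
  shows "is_cutoff u (cutoff u)"
proof -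
  obtain R where "dist_support u \<subseteq> {- real R<..<real R}"
    using dist_support_bounded[OF assms] by blast
  then have "\<exists>h. is_cutoff u h"
    by (metis partition_of_unity_exists is_cutoff_partition_sum order_refl)
  then show ?thesis unfolding is_cutoff_def cutoff_def by (rule someI_ex)
qed

lemma fun_support_subset_Compl:
  assumes "open U" "\<And>x. x \<in> U \<Longrightarrow> f x = 0"
  shows "fun_support f \<subseteq> - U"
  by (rule fun_support_minimal) (use assms in auto)

text \<open>The two products differ by a test function that vanishes on a neighbourhood of the
  support. This lets a distribution of compact support act on all smooth functions.\<close>

lemma cutoff_independent:
  assumes u: "distribution u" and h: "is_cutoff u h1" "is_cutoff u h2" and g: "smooth g"
  shows "u (\<lambda>x. h1 x * g x) = u (\<lambda>x. h2 x * g x)"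
proof -
  obtain U1 where U1: "open U1" "dist_support u \<subseteq> U1" "\<forall>x\<in>U1. h1 x = 1"
    using h(1) unfolding is_cutoff_def by auto
  obtain U2 where U2: "open U2" "dist_support u \<subseteq> U2" "\<forall>x\<in>U2. h2 x = 1"
    using h(2) unfolding is_cutoff_def by auto
  note t = test_function_mult_smooth(1)[OF is_cutoff_test[OF h(1)] g]
    test_function_mult_smooth(1)[OF is_cutoff_test[OF h(2)] g]
  have "fun_support (\<lambda>x. h1 x * g x - h2 x * g x) \<subseteq> - (U1 \<inter> U2)"
    by (rule fun_support_subset_Compl) (simp_all add: U1 U2 open_Int)
  then have "u (\<lambda>x. h1 x * g x - h2 x * g x) = 0"
    using U1(2) U2(2) test_function_add[OF t(1) test_function_cmult[OF t(2), of "-1"]]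
    by (intro distribution_vanishes_off_support[OF u]) auto
  then show ?thesis using distribution_diff[OF u t] by simp
qed

lemma cutoff_mult_test:
  assumes u: "distribution u" and h: "is_cutoff u h" and f: "f \<in> test_functions"
  shows "u (\<lambda>x. h x * f x) = u f"
proof -
  obtain U where U: "open U" "dist_support u \<subseteq> U" "\<forall>x\<in>U. h x = 1"
    using h unfolding is_cutoff_def by auto
  have t: "(\<lambda>x. h x * f x) \<in> test_functions"
    by (rule test_function_mult_smooth(2)[OF f test_function_smooth[OF is_cutoff_test[OF h]]])
  have "fun_support (\<lambda>x. h x * f x - f x) \<subseteq> - U"
    by (rule fun_support_subset_Compl) (simp_all add: U)
  then have "u (\<lambda>x. h x * f x - f x) = 0"
    using U(2) test_function_add[OF t test_function_cmult[OF f, of "-1"]]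
    by (intro distribution_vanishes_off_support[OF u]) auto
  then show ?thesis using distribution_diff[OF u t f] by simp
qed

text \<open>Only finitely many translates of a test function meet the compact support. The factor \<open>g\<close>
  is arbitrary and the bound does not depend on it, so one truncation serves all the weighted
  sums of translates below.\<close>

lemma shifts_eventually_off_support:
  assumes u: "distribution u" "compactly_supported u" and f: "f \<in> test_functions"
  obtains N0 :: nat where
    "\<And>(l::int) g. \<bar>l\<bar> > int N0 \<Longrightarrow> smooth g \<Longrightarrow> u (\<lambda>x. g x * f (x + of_int l)) = 0"
proof -
  obtain R where R: "dist_support u \<subseteq> {- real R<..<real R}"
    using dist_support_bounded[OF u(2)] by blast
  obtain M where M: "\<And>x. \<bar>x\<bar> \<ge> real M \<Longrightarrow> f x = 0"
    using test_function_bounded_support[OF f] by blast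
  show thesis
  proof (rule that[of "M + R"])
    fix l :: int and g assume l: "\<bar>l\<bar> > int (M + R)" and g: "smooth g"
    have l': "\<bar>real_of_int l\<bar> > real M + real R" using l by linarith
    have "fun_support (\<lambda>x. g x * f (x + of_int l)) \<subseteq> - {- real R<..<real R}"
    proof (rule fun_support_subset_Compl)
      fix x assume "x \<in> {- real R<..<real R}"
      then have "\<bar>x + of_int l\<bar> \<ge> real M" using l' by auto
      then show "g x * f (x + of_int l) = 0" using M by simp
    qed simp
    then show "u (\<lambda>x. g x * f (x + of_int l)) = 0"
      using R g f by (intro distribution_vanishes_off_support[OF u(1)] test_function_mult_smooth
         test_function_translate) auto
  qed
qed

lemma infsum_int_finite:
  fixes F :: "int \<Rightarrow> 'a::{comm_monoid_add, t2_space}"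
  assumes "\<And>l. \<bar>l\<bar> > int N \<Longrightarrow> F l = 0"
  shows "(\<Sum>\<^sub>\<infinity>l. F l) = (\<Sum>l\<in>{- int N..int N}. F l)"
proof -
  have "(\<Sum>\<^sub>\<infinity>l. F l) = (\<Sum>\<^sub>\<infinity>l\<in>{- int N..int N}. F l)"
    by (rule infsum_cong_neutral) (use assms in auto)
  then show ?thesis by simp
qed

lemma shift_sum_outside:
  assumes "distribution u" "f \<notin> test_functions" shows "shift_sum u c f = 0"
  unfolding shift_sum_def translate_def
  using assms by (simp add: distribution_outside test_function_translate_iff)

lemma shift_sum_finite:
  assumes u: "distribution u" "compactly_supported u" and f: "f \<in> test_functions"
  obtains N0 :: nat where
    "\<And>c N. N \<ge> N0 \<Longrightarrow> shift_sum u c f = (\<Sum>l\<in>{- int N..int N}. c l * u (\<lambda>x. f (x + of_int l)))"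
proof -
  obtain N0 :: nat where N0:
    "\<And>(l::int) g. \<bar>l\<bar> > int N0 \<Longrightarrow> smooth g \<Longrightarrow> u (\<lambda>x. g x * f (x + of_int l)) = 0"
    using shifts_eventually_off_support[OF assms] by blast
  show thesis
    by (rule that[of N0], unfold shift_sum_def translate_def, rule infsum_int_finite)
       (use N0[OF _ smooth_const[of 1]] in auto)
qed

section \<open>Continuity of distributions\<close>

text \<open>Continuity of the distribution combined with the Leibniz formula: the functional
  \<open>b \<mapsto> u (a b)\<close> is continuous on the space of all smooth functions.\<close>

lemma distribution_mult_bound:
  assumes u: "distribution u" and a: "a \<in> test_functions"
  shows "\<exists>C\<ge>0. \<exists>N. \<forall>b M. smooth b \<longrightarrow>
    (\<forall>j x. j \<le> N \<longrightarrow> x \<in> fun_support a \<longrightarrow> cmod (nth_deriv j b x) \<le> M) \<longrightarrow> M \<ge> 0 \<longrightarrow>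
    cmod (u (\<lambda>x. a x * b x)) \<le> C * M"
proof -
  let ?K = "fun_support a"
  obtain C N where CN: "\<And>f. f \<in> test_functions \<Longrightarrow> fun_support f \<subseteq> ?K \<Longrightarrow>
        cmod (u f) \<le> C * (\<Sum>k\<le>N. SUP x. cmod (nth_deriv k f x))"
    using u test_function_compact[OF a] unfolding distribution_def by meson
  have "\<exists>B. B > 0 \<and> (\<forall>x. cmod (nth_deriv i a x) \<le> B)" for i
    using test_function_bounded[OF test_function_nth_deriv(1)[OF a]] by metis
  then obtain B where B: "\<And>i. B i > 0" "\<And>i x. cmod (nth_deriv i a x) \<le> B i" by metis
  define D where "D = (\<Sum>k\<le>N. \<Sum>i\<le>k. real (k choose i) * B i)"
  have D: "D \<ge> 0" unfolding D_def using B(1) by (intro sum_nonneg mult_nonneg_nonneg) (auto intro: less_imp_le)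
  show ?thesis
  proof (rule exI[of _ "\<bar>C\<bar> * D"], intro conjI exI[of _ N] allI impI)
    fix b :: "real \<Rightarrow> complex" and M :: real
    assume b: "smooth b" and M: "M \<ge> 0"
      and "\<forall>j x. j \<le> N \<longrightarrow> x \<in> ?K \<longrightarrow> cmod (nth_deriv j b x) \<le> M"
    then have bM: "\<And>j x. j \<le> N \<Longrightarrow> x \<in> ?K \<Longrightarrow> cmod (nth_deriv j b x) \<le> M" by simp
    let ?f = "\<lambda>x. a x * b x"
    have f: "?f \<in> test_functions" by (rule test_function_mult_smooth(1)[OF a b])
    have sf: "fun_support ?f \<subseteq> ?K"
      by (rule fun_support_minimal) (auto simp: closed_fun_support zero_outside_fun_support)
    have pt: "cmod (nth_deriv k ?f x) \<le> (\<Sum>i\<le>k. real (k choose i) * B i) * M" if "k \<le> N" for k x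
    proof (cases "x \<in> ?K")
      case True
      have "cmod (nth_deriv k ?f x) \<le>
          (\<Sum>i\<le>k. cmod (of_nat (k choose i) * (nth_deriv i a x * nth_deriv (k - i) b x)))"
        unfolding nth_deriv_mult[OF test_function_smooth[OF a] b] by (rule norm_sum)
      also have "\<dots> \<le> (\<Sum>i\<le>k. real (k choose i) * (B i * M))"
        unfolding norm_mult norm_of_nat
        by (intro sum_mono mult_left_mono mult_mono B bM less_imp_le[OF B(1)]) (use True that in auto)
      finally show ?thesis by (simp add: sum_distrib_right mult.assoc)
    next
      case False
      have "nth_deriv k ?f x = 0"
        by (rule test_function_nth_deriv(2)[OF f]) (use False sf in auto)
      moreover have "0 \<le> (\<Sum>i\<le>k. real (k choose i) * B i) * M"
        by (intro mult_nonneg_nonneg sum_nonneg M) (auto intro: less_imp_le[OF B(1)])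
      ultimately show ?thesis by simp
    qed
    have "(\<Sum>k\<le>N. SUP x. cmod (nth_deriv k ?f x)) \<le> (\<Sum>k\<le>N. (\<Sum>i\<le>k. real (k choose i) * B i) * M)"
      by (intro sum_mono cSUP_least) (auto intro: pt)
    also have "\<dots> = D * M" by (simp add: D_def sum_distrib_right)
    finally have S: "(\<Sum>k\<le>N. SUP x. cmod (nth_deriv k ?f x)) \<le> D * M" .
    have S0: "0 \<le> (\<Sum>k\<le>N. SUP x. cmod (nth_deriv k ?f x))"
    proof (intro sum_nonneg)
      fix k assume "k \<in> {..N}"
      then show "0 \<le> (SUP x. cmod (nth_deriv k ?f x))"
        using pt by (intro cSUP_upper2[of _ _ 0]) (auto intro!: bdd_aboveI2)
    qed
    have "cmod (u ?f) \<le> C * (\<Sum>k\<le>N. SUP x. cmod (nth_deriv k ?f x))" by (rule CN[OF f sf])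
    also have "\<dots> \<le> \<bar>C\<bar> * (D * M)"
      using S S0 by (intro mult_mono) auto
    finally show "cmod (u ?f) \<le> \<bar>C\<bar> * D * M" by (simp add: mult.assoc)
  qed (use D in auto)
qed

text \<open>Unconditional convergence from a bound of all remainders by the tails of one convergent
  series. It is the common reason why distributions and integrals may be applied to series term
  by term.\<close>

lemma has_sum_if_dominated:
  fixes y :: "'i \<Rightarrow> 'a::real_normed_vector" and M :: "'i \<Rightarrow> real"
  assumes M: "M summable_on UNIV" and C: "C \<ge> 0"
    and bd: "\<And>A. finite A \<Longrightarrow> norm (x - sum y A) \<le> C * (\<Sum>\<^sub>\<infinity>l\<in>- A. M l)"
  shows "(y has_sum x) UNIV"
proof -
  have "((\<lambda>A. C * (infsum M UNIV - sum M A)) \<longlongrightarrow> C * (infsum M UNIV - infsum M UNIV)) (finite_subsets_at_top UNIV)"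
    using has_sum_infsum[OF M] unfolding has_sum_def by (intro tendsto_intros)
  then have lim: "((\<lambda>A. C * (infsum M UNIV - sum M A)) \<longlongrightarrow> 0) (finite_subsets_at_top UNIV)" by simp
  have "((\<lambda>A. sum y A - x) \<longlongrightarrow> 0) (finite_subsets_at_top UNIV)"
  proof (rule Lim_null_comparison[OF _ lim])
    have "norm (sum y A - x) \<le> C * (infsum M UNIV - sum M A)" if "finite A" for A
    proof -
      have "infsum M (UNIV - A) = infsum M UNIV - infsum M A"
        using that M by (intro infsum_Diff) (auto intro: summable_on_finite)
      then show ?thesis using bd[OF that] that by (simp add: norm_minus_commute Compl_eq_Diff_UNIV)
    qed
    then show "\<forall>\<^sub>F A in finite_subsets_at_top UNIV. norm (sum y A - x) \<le> C * (infsum M UNIV - sum M A)"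
      by (intro eventually_finite_subsets_at_top_weakI) auto
  qed
  then show ?thesis unfolding has_sum_def by (simp add: LIM_zero_cancel)
qed

lemma norm_has_sum_remainder_le:
  fixes y :: "'i \<Rightarrow> 'a::banach"
  assumes y: "(y has_sum x) UNIV" and M: "M summable_on UNIV" and le: "\<And>l. norm (y l) \<le> M l"
    and A: "finite A"
  shows "norm (x - sum y A) \<le> (\<Sum>\<^sub>\<infinity>l\<in>- A. M l)"
proof -
  have ys: "y summable_on - A" "M summable_on - A"
    by (rule summable_on_subset_banach[OF has_sum_imp_summable[OF y]], simp,
        rule summable_on_subset_banach[OF M], simp)
  have A': "- A = UNIV - A" by auto
  have "infsum y (UNIV - A) = infsum y UNIV - infsum y A"
    by (rule infsum_Diff[OF has_sum_imp_summable[OF y] summable_on_finite[OF A]]) simp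
  then have "x - sum y A = infsum y (- A)"
    using infsumI[OF y] A by (simp add: A')
  also have "norm \<dots> \<le> infsum M (- A)"
    by (rule norm_infsum_le[OF has_sum_infsum[OF ys(1)] has_sum_infsum[OF ys(2)] le])
  finally show ?thesis .
qed

text \<open>A distribution of the form \<open>b \<mapsto> u (a b)\<close> commutes with a series of smooth functions all of
  whose derived series converge absolutely and uniformly on the support of \<open>a\<close>. It is applied to
  the exponential series, to differentiate the Fourier transform, and to the Fourier series
  produced by Poisson summation.\<close>

lemma distribution_has_sum:
  fixes b :: "'i \<Rightarrow> real \<Rightarrow> complex"
  assumes u: "distribution u" and a: "a \<in> test_functions"
    and b: "smooth B" "\<And>l. smooth (b l)"
    and M: "\<And>j. M j summable_on UNIV"
      "\<And>j l x. x \<in> fun_support a \<Longrightarrow> cmod (nth_deriv j (b l) x) \<le> M j l"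
    and s: "\<And>j x. x \<in> fun_support a \<Longrightarrow> ((\<lambda>l. nth_deriv j (b l) x) has_sum nth_deriv j B x) UNIV"
  shows "((\<lambda>l. u (\<lambda>x. a x * b l x)) has_sum u (\<lambda>x. a x * B x)) UNIV"
proof -
  from distribution_mult_bound[OF u a] obtain C N where C: "C \<ge> 0" and CN: "\<forall>b M. smooth b \<longrightarrow>
    (\<forall>j x. j \<le> N \<longrightarrow> x \<in> fun_support a \<longrightarrow> cmod (nth_deriv j b x) \<le> M) \<longrightarrow> M \<ge> 0 \<longrightarrow>
    cmod (u (\<lambda>x. a x * b x)) \<le> C * M"
    by (elim exE conjE)
  define M' where "M' l = (\<Sum>j\<le>N. \<bar>M j l\<bar>)" for l
  have M': "M' summable_on UNIV"
  proof -
    have "(\<lambda>l. \<Sum>j\<le>n. \<bar>M j l\<bar>) summable_on UNIV" for n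
      using M(1)[THEN summable_on_iff_abs_summable_on_real[THEN iffD1]]
      by (induction n) (simp_all add: summable_on_add)
    then show ?thesis by (simp add: M'_def[abs_def])
  qed
  have M'0: "M' l \<ge> 0" for l by (auto simp: M'_def intro: sum_nonneg)
  show ?thesis
  proof (rule has_sum_if_dominated[OF M' C])
    fix A :: "'i set" assume A: "finite A"
    have sm: "smooth (\<lambda>x. \<Sum>l\<in>A. b l x)" by (intro smooth_sum b)
    have ta: "(\<lambda>x. a x * g x) \<in> test_functions" if "smooth g" for g
      by (rule test_function_mult_smooth(1)[OF a that])
    have "u (\<lambda>x. a x * B x) - (\<Sum>l\<in>A. u (\<lambda>x. a x * b l x))
        = u (\<lambda>x. a x * B x) - u (\<lambda>x. \<Sum>l\<in>A. a x * b l x)"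
      using distribution_sum[OF u, of A "\<lambda>l x. a x * b l x"] ta[OF b(2)] by simp
    also have "\<dots> = u (\<lambda>x. a x * B x - a x * (\<Sum>l\<in>A. b l x))"
      using distribution_diff[OF u ta[OF b(1)] ta[OF sm]] by (simp add: sum_distrib_left)
    also have "\<dots> = u (\<lambda>x. a x * (B x - (\<Sum>l\<in>A. b l x)))"
      by (simp add: right_diff_distrib)
    also have "cmod \<dots> \<le> C * (\<Sum>\<^sub>\<infinity>l\<in>- A. M' l)"
    proof (rule CN[rule_format])
      show "smooth (\<lambda>x. B x - (\<Sum>l\<in>A. b l x))" by (intro smooth_diff b sm)
      show "0 \<le> (\<Sum>\<^sub>\<infinity>l\<in>- A. M' l)" by (intro infsum_nonneg M'0)
      fix j x assume j: "j \<le> N" and x: "x \<in> fun_support a"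
      have "nth_deriv j (\<lambda>x. B x - (\<Sum>l\<in>A. b l x)) x = nth_deriv j (\<lambda>x. B x + (-1) * (\<Sum>l\<in>A. b l x)) x"
        by simp
      also have "\<dots> = nth_deriv j B x - (\<Sum>l\<in>A. nth_deriv j (b l) x)"
        by (subst nth_deriv_add[OF b(1) smooth_cmult[OF sm]], subst nth_deriv_cmult[OF sm],
            subst nth_deriv_sum) (auto intro: b)
      also have "cmod \<dots> \<le> (\<Sum>\<^sub>\<infinity>l\<in>- A. M' l)"
      proof (rule norm_has_sum_remainder_le[OF s[OF x] M' _ A])
        fix l
        have "cmod (nth_deriv j (b l) x) \<le> \<bar>M j l\<bar>" using M(2)[OF x, of j l] by linarith
        also have "\<dots> \<le> M' l" unfolding M'_def by (rule member_le_sum) (use j in auto)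
        finally show "cmod (nth_deriv j (b l) x) \<le> M' l" .
      qed
      finally show "cmod (nth_deriv j (\<lambda>x. B x - (\<Sum>l\<in>A. b l x)) x) \<le> (\<Sum>\<^sub>\<infinity>l\<in>- A. M' l)" .
    qed
    finally show "cmod (u (\<lambda>x. a x * B x) - (\<Sum>l\<in>A. u (\<lambda>x. a x * b l x))) \<le> C * (\<Sum>\<^sub>\<infinity>l\<in>- A. M' l)" .
  qed
qed

section \<open>The Fourier transform and its derivatives\<close>

lemma has_sum_shift_nat:
  fixes G :: "nat \<Rightarrow> 'a::{comm_monoid_add, topological_space}"
  assumes "(G has_sum S) UNIV"
  shows "((\<lambda>n. if j \<le> n then G (n - j) else 0) has_sum S) UNIV"
proof -
  have "((\<lambda>n. G (n - j)) has_sum S) (range (\<lambda>m. m + j))"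
    using assms by (subst has_sum_reindex) (auto simp: o_def inj_on_def)
  moreover have "range (\<lambda>m. m + j) = {j..}"
    by (auto simp: image_iff) (metis le_add_diff_inverse2)
  ultimately have "((\<lambda>n. G (n - j)) has_sum S) {j..}" by simp
  then show ?thesis
    by (subst has_sum_cong_neutral[where T="{j..}" and g="\<lambda>n. G (n - j)"]) auto
qed

lemma exp_series_has_sum: "((\<lambda>n. z ^ n / fact n) has_sum exp z) UNIV" for z :: "'a::{real_normed_field,banach}"
proof (rule norm_summable_imp_has_sum)
  show "summable (\<lambda>n. norm (z ^ n / fact n))"
    using summable_norm_exp[of z] by (simp add: norm_divide norm_power divide_inverse mult.commute norm_mult norm_inverse)
  show "(\<lambda>n. z ^ n / fact n) sums exp z"
    using exp_converges[of z] by (simp add: scaleR_conv_of_real field_simps)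
qed

lemma
  shows smooth_exp_term: "smooth (\<lambda>x. (\<alpha> * of_real x) ^ n / fact n)"
    and nth_deriv_exp_term: "nth_deriv j (\<lambda>x. (\<alpha> * of_real x) ^ n / fact n) =
       (\<lambda>x. if j \<le> n then \<alpha> ^ j * ((\<alpha> * of_real x) ^ (n - j) / fact (n - j)) else 0)"
proof -
  let ?D = "\<lambda>j x. if j \<le> n then \<alpha> ^ j * ((\<alpha> * complex_of_real x) ^ (n - j) / fact (n - j)) else 0"
  have d: "(?D j has_vector_derivative ?D (Suc j) x) (at x)" for j x
  proof (cases "Suc j \<le> n")
    case True
    then obtain m where m: "n - j = Suc m" by (metis Suc_diff_Suc Suc_le_eq)
    have "((\<lambda>z. \<alpha> ^ j * ((\<alpha> * z) ^ Suc m / fact (Suc m))) has_field_derivative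
        \<alpha> ^ j * (of_nat (Suc m) * (\<alpha> * of_real x) ^ m * \<alpha> / fact (Suc m))) (at (of_real x))"
      by (auto intro!: derivative_eq_intros simp del: power_Suc fact_Suc)
    from has_vector_derivative_real_field[OF this]
    have "((\<lambda>x. \<alpha> ^ j * ((\<alpha> * of_real x) ^ Suc m / fact (Suc m))) has_vector_derivative
        \<alpha> ^ j * (of_nat (Suc m) * (\<alpha> * of_real x) ^ m * \<alpha> / fact (Suc m))) (at x)" .
    moreover have "\<alpha> ^ j * (of_nat (Suc m) * (\<alpha> * of_real x) ^ m * \<alpha> / fact (Suc m))
        = \<alpha> ^ Suc j * ((\<alpha> * of_real x) ^ m / fact m)"
      by (simp add: divide_simps del: of_nat_Suc)
    moreover have "n - Suc j = m" using m by simp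
    ultimately show ?thesis using True m by simp
  next
    case False
    then have "?D j = (\<lambda>x. if j = n then \<alpha> ^ j else 0)" by auto
    with False show ?thesis by simp
  qed
  show "smooth (\<lambda>x. (\<alpha> * of_real x) ^ n / fact n)"
    by (rule smoothI[where D="?D", OF _ d]) simp
  show "nth_deriv j (\<lambda>x. (\<alpha> * of_real x) ^ n / fact n) = ?D j"
    by (rule nth_deriv_unique[where D="?D", OF _ d]) simp
qed

lemma distribution_exp_has_sum:
  assumes u: "distribution u" and a: "a \<in> test_functions"
  shows "((\<lambda>n. u (\<lambda>x. a x * ((\<alpha> * of_real x) ^ n / fact n))) has_sum u (\<lambda>x. a x * exp (\<alpha> * of_real x))) UNIV"
proof -
  obtain K :: nat where K: "\<And>x. \<bar>x\<bar> \<ge> real K \<Longrightarrow> a x = 0"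
    using test_function_bounded_support[OF a] by blast
  have "fun_support a \<subseteq> {- real K..real K}"
    by (rule fun_support_minimal) (use K in auto)
  then have K': "\<bar>x\<bar> \<le> real K" if "x \<in> fun_support a" for x
    using subsetD[OF \<open>fun_support a \<subseteq> _\<close> that] by auto
  define M where "M j n = (if j \<le> n then cmod \<alpha> ^ j * ((cmod \<alpha> * real K) ^ (n - j) / fact (n - j)) else 0)"
    for j n :: nat
  show ?thesis
  proof (rule distribution_has_sum[OF u a, where M=M])
    show "smooth (\<lambda>x. exp (\<alpha> * of_real x))" by (rule smooth_exp)
    show "smooth (\<lambda>x. (\<alpha> * of_real x) ^ l / fact l)" for l by (rule smooth_exp_term)
    show "M j summable_on UNIV" for j
      unfolding M_def using has_sum_shift_nat[OF has_sum_cmult_right[OF exp_series_has_sum]]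
      by (intro has_sum_imp_summable)
    fix j l x assume x: "x \<in> fun_support a"
    show "cmod (nth_deriv j (\<lambda>x. (\<alpha> * of_real x) ^ l / fact l) x) \<le> M j l"
      unfolding nth_deriv_exp_term M_def
      using K'[OF x] by (auto simp: norm_mult norm_power norm_divide norm_fact
          intro!: mult_left_mono divide_right_mono power_mono)
  next
    fix j x
    show "((\<lambda>l. nth_deriv j (\<lambda>x. (\<alpha> * of_real x) ^ l / fact l) x) has_sum
        nth_deriv j (\<lambda>x. exp (\<alpha> * of_real x)) x) UNIV"
      unfolding nth_deriv_exp_term nth_deriv_exp
      by (rule has_sum_shift_nat[OF has_sum_cmult_right[OF exp_series_has_sum]])
  qed
qed

text \<open>Expanding the exponential under the distribution shows that \<open>\<alpha> \<mapsto> u (h x^k exp (\<alpha> x))\<close> is the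
  entire function with Taylor coefficients \<open>c (k + n) / n!\<close>, where \<open>c\<close> is the sequence of moments
  of \<open>h u\<close>. Differentiating the power series shifts the moments by one.\<close>

lemma distribution_exp_has_field_derivative:
  assumes u: "distribution u" and h: "h \<in> test_functions"
  shows "((\<lambda>\<alpha>. u (\<lambda>x. h x * (of_real x ^ k * exp (\<alpha> * of_real x)))) has_field_derivative
           u (\<lambda>x. h x * (of_real x ^ Suc k * exp (\<alpha> * of_real x)))) (at \<alpha>)"
proof -
  define c where "c n = u (\<lambda>x. h x * of_real x ^ n)" for n
  have t: "(\<lambda>x. h x * of_real x ^ n) \<in> test_functions" for n
    by (intro test_function_mult_smooth(1)[OF h] smooth_power smooth_of_real)
  have s: "(\<lambda>n. c (k + n) / fact n * \<alpha> ^ n) sums u (\<lambda>x. h x * (of_real x ^ k * exp (\<alpha> * of_real x)))" for \<alpha> k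
  proof -
    have "u (\<lambda>x. h x * of_real x ^ k * ((\<alpha> * of_real x) ^ n / fact n)) = c (k + n) / fact n * \<alpha> ^ n" for n
    proof -
      have "u (\<lambda>x. h x * of_real x ^ k * ((\<alpha> * of_real x) ^ n / fact n))
          = u (\<lambda>x. (\<alpha> ^ n / fact n) * (h x * of_real x ^ (k + n)))"
        by (intro arg_cong[of _ _ u] ext) (simp add: power_add power_mult_distrib)
      also have "\<dots> = \<alpha> ^ n / fact n * c (k + n)"
        unfolding c_def by (rule distribution_cmult[OF u t])
      finally show ?thesis by simp
    qed
    with distribution_exp_has_sum[OF u t, of k \<alpha>] show ?thesis
      by (simp add: has_sum_imp_sums mult.assoc)
  qed
  have "((\<lambda>\<alpha>. \<Sum>n. c (k + n) / fact n * \<alpha> ^ n) has_field_derivative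
      (\<Sum>n. diffs (\<lambda>n. c (k + n) / fact n) n * \<alpha> ^ n)) (at \<alpha>)"
    by (rule termdiffs_strong_converges_everywhere) (use s in \<open>auto simp: sums_iff\<close>)
  moreover have "diffs (\<lambda>n. c (k + n) / fact n) n = c (Suc k + n) / fact n" for n
    by (simp add: diffs_def divide_simps del: of_nat_Suc)
  ultimately show ?thesis
    by (simp only: s[THEN sums_unique, symmetric])
qed

lemma higher_deriv_fourier:
  assumes u: "distribution u" "compactly_supported u"
  shows "(deriv ^^ k) (fourier u) y = (- 2 * of_real pi * \<i>) ^ k *
     u (\<lambda>x. cutoff u x * (of_real x ^ k * exp ((- 2 * of_real pi * \<i> * y) * of_real x)))"
proof (induction k arbitrary: y)
  case 0
  show ?case by (simp add: fourier_def mult_ac)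
next
  case (Suc k)
  let ?E = "\<lambda>k \<alpha>. u (\<lambda>x. cutoff u x * (of_real x ^ k * exp (\<alpha> * of_real x)))"
  let ?c = "- 2 * of_real pi * \<i>"
  note h = is_cutoff_test[OF is_cutoff_cutoff[OF u(2)]]
  have "((\<lambda>y. ?E k (?c * y)) has_field_derivative ?E (Suc k) (?c * y) * ?c) (at y)"
    by (rule DERIV_chain2[OF distribution_exp_has_field_derivative[OF u(1) h]])
       (auto intro!: derivative_eq_intros)
  then have "((\<lambda>y. ?c ^ k * ?E k (?c * y)) has_field_derivative ?c ^ k * (?E (Suc k) (?c * y) * ?c)) (at y)"
    by (rule DERIV_cmult)
  moreover have "(deriv ^^ k) (fourier u) = (\<lambda>y. ?c ^ k * ?E k (?c * y))"
    using Suc by (intro ext)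
  ultimately have "deriv ((deriv ^^ k) (fourier u)) y = ?c ^ k * (?E (Suc k) (?c * y) * ?c)"
    by (simp add: DERIV_imp_deriv)
  then show ?case by (simp add: mult_ac)
qed

lemma fourier_deriv_seq_eq:
  assumes u: "distribution u" "compactly_supported u" and h: "is_cutoff u h"
  shows "fourier_deriv_seq u lam k l = (- 2 * of_real pi * \<i>) ^ k *
     u (\<lambda>x. h x * (of_real x ^ k * exp ((- lam - 2 * of_real pi * \<i> * of_int l) * of_real x)))"
proof -
  have e: "- 2 * of_real pi * \<i> * (- \<i> * lam / (2 * of_real pi) + of_int l) = - lam - 2 * of_real pi * \<i> * of_int l"
    by (simp add: field_simps)
  have "u (\<lambda>x. cutoff u x * (of_real x ^ k * exp (\<alpha> * of_real x))) =
        u (\<lambda>x. h x * (of_real x ^ k * exp (\<alpha> * of_real x)))" for \<alpha>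
    by (rule cutoff_independent[OF u(1) is_cutoff_cutoff[OF u(2)] h])
       (intro smooth_mult smooth_power smooth_of_real smooth_exp)
  then show ?thesis unfolding fourier_deriv_seq_def higher_deriv_fourier[OF u] e by simp
qed

section \<open>Complex exponentials of period one\<close>

abbreviation osc :: "int \<Rightarrow> real \<Rightarrow> complex" where
  "osc n t \<equiv> exp (2 * of_real pi * \<i> * of_int n * of_real t)"

lemma osc_add: "osc (m + n) t = osc m t * osc n t"
  unfolding exp_add[symmetric] by (simp add: algebra_simps)

lemma osc_int: "osc n (of_int m) = 1"
proof -
  have "2 * of_real pi * \<i> * of_int n * of_real (of_int m) = of_real (2 * of_int (n * m) * pi) * \<i>"
    by simp
  then show ?thesis using exp_integer_2pi[of "of_int (n * m)", OF Ints_of_int] by (simp only:)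
qed

lemma osc_periodic: "osc n (t + of_int m) = osc n t"
proof -
  have "osc n (t + of_int m) = osc n t * osc n (of_int m)" by (simp add: distrib_left exp_add)
  then show ?thesis unfolding osc_int by simp
qed

lemma summable_on_int_nat_abs:
  fixes f :: "nat \<Rightarrow> real"
  assumes "summable f" "\<And>n. f n \<ge> 0"
  shows "(\<lambda>l::int. f (nat \<bar>l\<bar>)) summable_on UNIV"
proof -
  have s: "f summable_on A" for A
    using norm_summable_imp_summable_on[of f] assms summable_on_subset_banach[of f UNIV A] by auto
  have 1: "(\<lambda>l::int. f (nat \<bar>l\<bar>)) summable_on (range int)"
    using s by (subst summable_on_reindex) (auto simp: o_def)
  have 2: "(\<lambda>l::int. f (nat \<bar>l\<bar>)) summable_on ((\<lambda>n. - int n) ` {1..})"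
    using s by (subst summable_on_reindex) (auto simp: o_def inj_on_def)
  have "(UNIV :: int set) = range int \<union> (\<lambda>n. - int n) ` {1..}"
  proof -
    have "l \<in> range int \<union> (\<lambda>n. - int n) ` {1..}" for l :: int
      by (cases l rule: int_cases) (auto intro: image_eqI[of _ _ "Suc _"])
    then show ?thesis by blast
  qed
  then show ?thesis using summable_on_Un_disjoint[OF 1 2] by force
qed

section \<open>Uniqueness of Fourier coefficients\<close>

text \<open>A real linear functional on the plane is a combination of the real and the imaginary part,
  hence on the unit circle a combination of the exponentials of frequency \<open>1\<close> and \<open>- 1\<close>.\<close>

lemma complex_linear_functional:
  assumes "bounded_linear (f :: complex \<Rightarrow> real)"
  shows "f z = Re z * f 1 + Im z * f \<i>"
proof -
  interpret bounded_linear f by fact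
  have "f z = f (Re z *\<^sub>R 1 + Im z *\<^sub>R \<i>)"
    by (rule arg_cong[of _ _ f]) (simp add: complex_eq_iff)
  then show ?thesis by (simp add: add scaleR)
qed

lemma continuous_on_real_polynomial_function:
  "real_polynomial_function f \<Longrightarrow> continuous_on S f"
  by (simp add: continuous_at_imp_continuous_on continuous_real_polymonial_function)

text \<open>If all Fourier coefficients of \<open>v\<close> vanish, then those of \<open>v\<close> times a polynomial on the circle
  vanish as well. The statement is quantified over \<open>v\<close> so that products of polynomials are handled
  by using the induction hypothesis twice, the second time with \<open>v f\<close> in place of \<open>v\<close>.\<close>

lemma annihilator_real_polynomial:
  fixes f :: "complex \<Rightarrow> real" and v :: "real \<Rightarrow> complex"
  assumes "real_polynomial_function f" "continuous_on {0..1} v"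
    "\<And>n. integral {0..1} (\<lambda>t. v t * osc n t) = 0"
  shows "integral {0..1} (\<lambda>t. v t * of_real (f (osc 1 t)) * osc n t) = 0"
  using assms
proof (induction f arbitrary: v n rule: real_polynomial_function.induct)
  case (linear f)
  define a b where "a = (of_real (f 1) - \<i> * of_real (f \<i>)) / 2"
    and "b = (of_real (f 1) + \<i> * of_real (f \<i>)) / 2"
  have f: "of_real (f (osc 1 t)) = a * osc 1 t + b * osc (- 1) t" for t
  proof -
    have 1: "osc 1 t = cis (2 * pi * t)" "osc (- 1) t = cis (- (2 * pi * t))"
      by (simp_all add: cis_conv_exp mult_ac)
    show ?thesis
      unfolding complex_linear_functional[OF linear(1), of "osc 1 t"] unfolding 1
      by (simp add: complex_eq_iff a_def b_def field_simps)
  qed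
  have eq: "v t * of_real (f (osc 1 t)) * osc n t = a * (v t * osc (n + 1) t) + b * (v t * osc (n - 1) t)" for t
    unfolding f by (simp only: diff_conv_add_uminus osc_add) (simp only: algebra_simps)
  have c: "continuous_on {0..1} (\<lambda>t. v t * osc m t)" for m
    by (intro continuous_intros linear)
  have "integral {0..1} (\<lambda>t. v t * of_real (f (osc 1 t)) * osc n t)
      = integral {0..1} (\<lambda>t. a * (v t * osc (n + 1) t) + b * (v t * osc (n - 1) t))"
    unfolding eq ..
  also have "\<dots> = integral {0..1} (\<lambda>t. a * (v t * osc (n + 1) t)) + integral {0..1} (\<lambda>t. b * (v t * osc (n - 1) t))"
    by (intro integral_add integrable_continuous_real continuous_on_mult continuous_on_const c)
  finally show ?case unfolding integral_mult_right linear(3) by simp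
next
  case (const c)
  have "(\<lambda>t. v t * of_real c * osc n t) = (\<lambda>t. of_real c * (v t * osc n t))" by (auto simp: fun_eq_iff mult_ac)
  then show ?case using const by (simp only: integral_mult_right) simp
next
  case (add f g)
  have cf: "continuous_on {0..1} (\<lambda>t. v t * of_real (h (osc 1 t)) * osc n t)" if "real_polynomial_function h" for h
    by (intro continuous_intros add.prems continuous_on_compose2[OF continuous_on_real_polynomial_function[OF that, of UNIV]] subset_UNIV)
  have "integral {0..1} (\<lambda>t. v t * of_real (f (osc 1 t) + g (osc 1 t)) * osc n t)
      = integral {0..1} (\<lambda>t. v t * of_real (f (osc 1 t)) * osc n t) + integral {0..1} (\<lambda>t. v t * of_real (g (osc 1 t)) * osc n t)"
    unfolding of_real_add distrib_left distrib_right
    by (intro integral_add integrable_continuous_real cf add.hyps)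
  then show ?case using add.IH(1)[OF add.prems] add.IH(2)[OF add.prems] by simp
next
  case (mult f g)
  have cf: "continuous_on {0..1} (\<lambda>t. v t * of_real (f (osc 1 t)))"
    by (intro continuous_intros mult.prems continuous_on_compose2[OF continuous_on_real_polynomial_function[OF mult.hyps(1), of UNIV]] subset_UNIV)
  show ?case using mult.IH(2)[OF cf mult.IH(1)[OF mult.prems], of n] by (simp add: mult_ac)
qed

text \<open>As \<open>D 0 = D 1\<close>, the function \<open>D\<close> lives on the unit circle, and its conjugate is a uniform
  limit of polynomials there (Stone--Weierstrass). These are orthogonal to \<open>D\<close>, so the integral
  of the squared modulus of \<open>D\<close> is arbitrarily small.\<close>

lemma fourier_coefficients_unique:
  assumes D: "continuous_on {0..1} D" "D 0 = D 1"
    and z: "\<And>n. integral {0..1} (\<lambda>t. D t * osc n t) = 0" and t: "t \<in> {0..1}"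
  shows "D t = 0"
proof -
  let ?g = "\<lambda>z. cnj (D (Arg2pi z / (2 * pi)))"
  \<comment> \<open>A loop is homotopic to itself, and this entails that \<open>D\<close> is continuous when read on the circle.\<close>
  have "homotopic_loops UNIV D D"
    unfolding homotopic_loops_refl using D by (simp add: path_def pathfinish_def pathstart_def)
  then have "continuous_on (sphere 0 1) (D \<circ> (\<lambda>z. (Arg2pi z / (2 * pi))))"
    by (blast dest: homotopic_loops_imp_homotopic_circlemaps homotopic_with_imp_continuous)
  then have gc: "continuous_on (sphere 0 1) ?g" by (simp add: o_def continuous_on_cnj)
  have osc1: "osc 1 t = exp (\<i> * of_real (2 * pi * t))" for t by (simp add: mult_ac)
  have g: "?g (osc 1 t) = cnj (D t)" if "t \<in> {0..1}" for t
  proof (cases "t = 1")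
    case True
    have "Arg2pi (osc 1 t) = 0" by (rule Arg2pi_unique[of 1]) (use True osc_int[of 1 1] in auto)
    then show ?thesis using D(2) True by simp
  next
    case False
    have "Arg2pi (osc 1 t) = 2 * pi * t"
      by (rule Arg2pi_unique[of 1]) (use that False osc1[of t] in auto)
    then show ?thesis by simp
  qed
  obtain B where B: "B > 0" "\<And>t. t \<in> {0..1} \<Longrightarrow> cmod (D t) \<le> B"
    using compact_imp_bounded[OF compact_continuous_image[OF D(1) compact_Icc]] unfolding bounded_pos by auto
  let ?I = "integral {0..1} (\<lambda>t. D t * cnj (D t))"
  have small: "cmod ?I \<le> B * \<epsilon>" if \<epsilon>: "\<epsilon> > 0" for \<epsilon>
  proof -
    obtain p where p: "polynomial_function p" "\<And>z. z \<in> sphere 0 1 \<Longrightarrow> cmod (?g z - p z) < \<epsilon>"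
      using Stone_Weierstrass_polynomial_function[OF _ gc \<epsilon>] by (metis compact_sphere)
    have rp: "real_polynomial_function (\<lambda>z. Re (p z))" "real_polynomial_function (\<lambda>z. Im (p z))"
      using p(1) bounded_linear_Re bounded_linear_Im unfolding polynomial_function_def o_def by blast+
    have pc: "continuous_on {0..1} (\<lambda>t. p (osc 1 t))"
      by (rule continuous_on_compose2[OF continuous_on_polymonial_function[OF p(1), of UNIV]])
         (intro continuous_intros subset_UNIV)+
    have cr: "continuous_on {0..1} (\<lambda>t. D t * of_real (Re (p (osc 1 t))))"
      "continuous_on {0..1} (\<lambda>t. D t * of_real (Im (p (osc 1 t))))"
      by (intro continuous_intros D pc)+
    have 0: "integral {0..1} (\<lambda>t. D t * of_real (Re (p (osc 1 t)))) = 0"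
      "integral {0..1} (\<lambda>t. D t * of_real (Im (p (osc 1 t)))) = 0"
      using annihilator_real_polynomial[OF rp(1) D(1) z, of 0] annihilator_real_polynomial[OF rp(2) D(1) z, of 0]
      by simp_all
    have "integral {0..1} (\<lambda>t. D t * p (osc 1 t))
        = integral {0..1} (\<lambda>t. D t * of_real (Re (p (osc 1 t))) + \<i> * (D t * of_real (Im (p (osc 1 t)))))"
      by (rule arg_cong[of _ _ "integral _"]) (auto simp: fun_eq_iff complex_eq_iff algebra_simps)
    also have "\<dots> = integral {0..1} (\<lambda>t. D t * of_real (Re (p (osc 1 t)))) +
        integral {0..1} (\<lambda>t. \<i> * (D t * of_real (Im (p (osc 1 t)))))"
      by (intro integral_add integrable_continuous_real continuous_on_mult[OF continuous_on_const] cr)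
    also have "\<dots> = 0" unfolding integral_mult_right 0 by simp
    finally have "?I = ?I - integral {0..1} (\<lambda>t. D t * p (osc 1 t))" by simp
    also have "\<dots> = integral {0..1} (\<lambda>t. D t * cnj (D t) - D t * p (osc 1 t))"
      by (intro integral_diff[symmetric] integrable_continuous_real continuous_intros D pc)
    also have "cmod \<dots> \<le> B * \<epsilon> * (1 - 0)"
    proof (rule integral_bound)
      fix t :: real assume t: "t \<in> {0..1}"
      have "cmod (D t * cnj (D t) - D t * p (osc 1 t)) = cmod (D t) * cmod (?g (osc 1 t) - p (osc 1 t))"
        unfolding g[OF t] by (simp add: norm_mult flip: right_diff_distrib)
      also have "\<dots> \<le> B * \<epsilon>"
        by (intro mult_mono B(2) t less_imp_le[OF p(2)]) (use B in \<open>auto simp: osc1\<close>)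
      finally show "cmod (D t * cnj (D t) - D t * p (osc 1 t)) \<le> B * \<epsilon>" .
    qed (simp, intro continuous_intros D pc)
    finally show ?thesis by simp
  qed
  have "cmod ?I \<le> 0"
  proof (rule field_le_epsilon)
    fix e :: real assume "e > 0"
    then show "cmod ?I \<le> 0 + e" using small[of "e / B"] B(1) by simp
  qed
  then have "0 = Re ?I" by simp
  also have "\<dots> = integral {0..1} (\<lambda>t. Re (D t * cnj (D t)))"
    using integral_linear[OF integrable_continuous_real bounded_linear_Re, of 0 1 "\<lambda>t. D t * cnj (D t)"]
    by (simp add: o_def continuous_intros D)
  finally have I0: "integral {0..1} (\<lambda>t. (cmod (D t))\<^sup>2) = 0"
    by (simp add: complex_norm_square[symmetric] cmod_power2 power2_eq_square)
  have "\<forall>t\<in>{0..1}. (cmod (D t))\<^sup>2 = 0"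
    using integral_eq_0_iff[of 0 1 "\<lambda>t. (cmod (D t))\<^sup>2"] I0 by (simp add: continuous_intros D)
  then show ?thesis using t by simp
qed

section \<open>Poisson summation for test functions\<close>

text \<open>The interval is cut at the integers. For a function supported in it, this folds the integral
  over the real line onto the unit interval.\<close>

lemma integral_fold_unit_interval:
  fixes F :: "real \<Rightarrow> complex"
  assumes F: "continuous_on UNIV F"
  shows "integral {- real N..real N + 1} F = integral {0..1} (\<lambda>t. \<Sum>m\<in>{- int N..int N}. F (t + of_int m))"
proof -
  have c: "continuous_on S F" for S by (rule continuous_on_subset[OF F]) simp
  have i: "F integrable_on {a..b}" for a b by (intro integrable_continuous_real c)
  have sh: "integral {0..1} (\<lambda>t. F (t + r)) = integral {r..r + 1} F" for r
  proof -
    have "((F \<circ> (+) r) has_integral integral {r..r + 1} F) (cbox 0 1)"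
      unfolding has_integral_shift_cbox_iff using integrable_integral[OF i[of r "r + 1"]] by (simp add: add.commute)
    then show ?thesis by (intro integral_unique) (simp add: o_def add.commute)
  qed
  have "integral {- real N..real N + 1} F = (\<Sum>m\<in>{- int N..int N}. integral {of_int m..of_int m + 1} F)"
  proof (induction N)
    case (Suc N)
    have "{- int (Suc N)..int (Suc N)} = insert (- int (Suc N)) (insert (int (Suc N)) {- int N..int N})"
      by auto
    then have "(\<Sum>m\<in>{- int (Suc N)..int (Suc N)}. integral {of_int m..of_int m + 1} F)
       = integral {- real (Suc N)..- real N} F + (integral {real (Suc N)..real (Suc N) + 1} F + integral {- real N..real (Suc N)} F)"
      using Suc by (simp add: algebra_simps)
    also have "integral {real (Suc N)..real (Suc N) + 1} F + integral {- real N..real (Suc N)} F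
       = integral {- real N..real (Suc N) + 1} F"
      by (subst add.commute, rule Henstock_Kurzweil_Integration.integral_combine) (auto intro: i)
    also have "integral {- real (Suc N)..- real N} F + integral {- real N..real (Suc N) + 1} F
       = integral {- real (Suc N)..real (Suc N) + 1} F"
      by (rule Henstock_Kurzweil_Integration.integral_combine) (auto intro: i)
    finally show ?case ..
  qed simp
  also have "\<dots> = (\<Sum>m\<in>{- int N..int N}. integral {0..1} (\<lambda>t. F (t + of_int m)))"
    by (simp add: sh)
  also have "\<dots> = integral {0..1} (\<lambda>t. \<Sum>m\<in>{- int N..int N}. F (t + of_int m))"
    by (rule integral_sum[symmetric])
       (auto intro!: integrable_continuous_real continuous_on_compose2[OF F] continuous_intros)
  finally show ?thesis .
qed

lemma integral_osc: "integral {0..1} (osc n) = (if n = 0 then 1 else 0)"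
proof (cases "n = 0")
  case False
  let ?c = "2 * of_real pi * \<i> * of_int n :: complex"
  have c: "?c \<noteq> 0" using False by simp
  have d: "((\<lambda>t. osc n t / ?c) has_vector_derivative osc n t) (at t)" for t
    using has_vector_derivative_divide[OF has_vector_derivative_nth_deriv[OF smooth_exp[of ?c], of 0 t], of ?c]
      nth_deriv_exp[of "Suc 0" ?c] c by simp
  have "(osc n has_integral osc n 1 / ?c - osc n 0 / ?c) {0..1}"
    by (intro fundamental_theorem_of_calculus has_vector_derivative_at_within[OF d]) simp
  then show ?thesis using False osc_int[of n 1] by (auto dest: integral_unique)
qed simp

lemma lint_deriv_test_function_eq_0:
  assumes "f \<in> test_functions"
  shows "(LINT t|lborel. nth_deriv (Suc 0) f t) = 0"
proof -
  obtain M where M: "\<And>x. \<bar>x\<bar> \<ge> real M \<Longrightarrow> f x = 0"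
    using test_function_bounded_support[OF assms] by blast
  have sub: "fun_support f \<subseteq> {- real M..real M}"
    by (rule fun_support_minimal) (use M in auto)
  have z: "nth_deriv (Suc 0) f x = 0" if "x \<notin> {- real M..real M}" for x
    by (rule test_function_nth_deriv(2)[OF assms contra_subsetD[OF sub that]])
  note sm = test_function_smooth[OF assms]
  have "(nth_deriv (Suc 0) f has_integral nth_deriv 0 f (real M) - nth_deriv 0 f (- real M)) {- real M..real M}"
    by (intro fundamental_theorem_of_calculus
         has_vector_derivative_at_within[OF has_vector_derivative_nth_deriv[OF sm]]) simp
  then have "integral {- real M..real M} (nth_deriv (Suc 0) f) = 0"
    using M by (simp add: integral_unique)
  then show ?thesis using lint_eq_integral[OF continuous_on_nth_deriv[OF sm] z] by simp
qed

text \<open>The Fourier transform of \<open>F\<close> at \<open>- l\<close>. This sign is chosen because the numbers pair test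
  functions with the Fourier series of a distribution.\<close>

definition fcoeff :: "(real \<Rightarrow> complex) \<Rightarrow> int \<Rightarrow> complex" where
  "fcoeff F l = (LINT t|lborel. F t * osc l t)"

lemma test_function_osc: "F \<in> test_functions \<Longrightarrow> (\<lambda>t. F t * osc l t) \<in> test_functions"
  by (intro test_function_mult_smooth(1) smooth_exp)

lemma integrable_test_function: "F \<in> test_functions \<Longrightarrow> integrable lborel F"
  by (metis test_function_bounded_support integrable_compact_support smooth_imp_continuous_on
     test_function_smooth atLeastAtMost_iff abs_le_iff linear minus_le_iff)

lemma fcoeff_deriv:
  assumes F: "F \<in> test_functions"
  shows "fcoeff (nth_deriv (Suc 0) F) l = - (2 * of_real pi * \<i> * of_int l) * fcoeff F l"
proof -
  let ?c = "2 * of_real pi * \<i> * of_int l :: complex"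
  have "nth_deriv (Suc 0) (\<lambda>t. F t * osc l t) t = nth_deriv (Suc 0) F t * osc l t + ?c * (F t * osc l t)" for t
    unfolding nth_deriv_mult[OF test_function_smooth[OF F] smooth_exp] nth_deriv_exp
    by (simp add: algebra_simps)
  then have "0 = (LINT t|lborel. nth_deriv (Suc 0) F t * osc l t + ?c * (F t * osc l t))"
    using lint_deriv_test_function_eq_0[OF test_function_osc[OF F], of l] by simp
  also have "\<dots> = fcoeff (nth_deriv (Suc 0) F) l + ?c * fcoeff F l"
    unfolding fcoeff_def integral_mult_right_zero[symmetric]
    by (intro Bochner_Integration.integral_add integrable_mult_right[OF integrable_test_function]
        integrable_test_function[OF test_function_osc] test_function_osc test_function_nth_deriv F)
  finally show ?thesis by (simp add: add_eq_0_iff2)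
qed

lemma fcoeff_nth_deriv:
  assumes F: "F \<in> test_functions"
  shows "fcoeff (nth_deriv j F) l = (- (2 * of_real pi * \<i> * of_int l)) ^ j * fcoeff F l"
proof (induction j)
  case (Suc j)
  have "nth_deriv (Suc j) F = nth_deriv (Suc 0) (nth_deriv j F)"
    using nth_deriv_nth_deriv[OF test_function_smooth[OF F], of "Suc 0" j] by simp
  then show ?case
    using fcoeff_deriv[OF test_function_nth_deriv(1)[OF F], of j l] Suc by simp
qed simp

text \<open>Two integrations by parts give quadratic decay, enough for absolute convergence.\<close>

lemma fcoeff_bound:
  assumes F: "F \<in> test_functions"
  obtains B where "B \<ge> 0" "\<And>l. cmod (fcoeff F l) \<le> B * inverse ((1 + real (nat \<bar>l\<bar>))\<^sup>2)"
proof -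
  have b: "\<exists>B\<ge>0. \<forall>l. cmod (fcoeff G l) \<le> B" if G: "G \<in> test_functions" for G
  proof (intro exI[of _ "LINT t|lborel. cmod (G t)"] conjI allI)
    fix l
    have "cmod (fcoeff G l) \<le> (LINT t|lborel. cmod (G t * osc l t))"
      unfolding fcoeff_def by (rule integral_norm_bound)
    then show "cmod (fcoeff G l) \<le> (LINT t|lborel. cmod (G t))" by (simp add: norm_mult)
  qed simp
  obtain B0 where B0: "B0 \<ge> 0" "\<And>l. cmod (fcoeff F l) \<le> B0" using b[OF F] by blast
  obtain B2 where B2: "B2 \<ge> 0" "\<And>l. cmod (fcoeff (nth_deriv 2 F) l) \<le> B2"
    using b[OF test_function_nth_deriv(1)[OF F]] by blast
  show thesis
  \<comment> \<open>\<open>(1 + L)^2 \<le> 2 (1 + L^2)\<close>; here \<open>B0\<close> bounds the coefficient itself, and \<open>B2\<close> bounds it times \<open>L^2\<close>.\<close>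
  proof (rule that[of "2 * (B0 + B2)"])
    fix l
    let ?L = "real (nat \<bar>l\<bar>)"
    have "cmod (fcoeff (nth_deriv 2 F) l) = (2 * pi * ?L)\<^sup>2 * cmod (fcoeff F l)"
      unfolding fcoeff_nth_deriv[OF F] by (simp add: norm_mult norm_power power2_eq_square)
    moreover have "?L\<^sup>2 * cmod (fcoeff F l) \<le> (2 * pi * ?L)\<^sup>2 * cmod (fcoeff F l)"
      using pi_ge_two by (intro mult_right_mono power_mono) (auto simp: mult_le_cancel_right1)
    ultimately have "?L\<^sup>2 * cmod (fcoeff F l) \<le> B2" using B2(2)[of l] by simp
    moreover have "(1 + ?L)\<^sup>2 \<le> 2 * (1 + ?L\<^sup>2)"
      using zero_le_power2[of "1 - ?L"] by (simp add: power2_eq_square algebra_simps)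
    then have "(1 + ?L)\<^sup>2 * cmod (fcoeff F l) \<le> 2 * (1 + ?L\<^sup>2) * cmod (fcoeff F l)"
      by (rule mult_right_mono) simp
    ultimately have "(1 + ?L)\<^sup>2 * cmod (fcoeff F l) \<le> 2 * (B0 + B2)"
      using B0(2)[of l] by (simp add: algebra_simps)
    then show "cmod (fcoeff F l) \<le> 2 * (B0 + B2) * inverse ((1 + ?L)\<^sup>2)"
      by (simp add: field_simps)
  qed (use B0 B2 in auto)
qed

lemma fcoeff_summable:
  assumes F: "F \<in> test_functions"
  shows "(\<lambda>l. cmod (fcoeff F l)) summable_on UNIV"
proof -
  obtain B where B: "\<And>l. cmod (fcoeff F l) \<le> B * inverse ((1 + real (nat \<bar>l\<bar>))\<^sup>2)"
    using fcoeff_bound[OF F] by blast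
  have "summable (\<lambda>n. inverse ((real (Suc n))\<^sup>2))"
    using inverse_power_summable[of 2, where 'a=real] by (subst summable_Suc_iff) auto
  then have "(\<lambda>l::int. B * inverse ((1 + real (nat \<bar>l\<bar>))\<^sup>2)) summable_on UNIV"
    using summable_on_int_nat_abs[of "\<lambda>n. inverse ((1 + real n)\<^sup>2)"]
    by (intro summable_on_cmult_right) simp
  from summable_on_comparison_test[OF this B] show ?thesis by simp
qed

text \<open>The periodisation of \<open>F\<close> and the sum of the series are continuous and periodic, and they have
  the same Fourier coefficients: for the first one this is the folding of the real line onto the
  unit interval, for the second one orthogonality of the exponentials.\<close>

lemma poisson_summation:
  assumes F: "F \<in> test_functions"
  shows "((\<lambda>l. fcoeff F l * osc (- l) x) has_sum (\<Sum>\<^sub>\<infinity>m. F (x + of_int m))) UNIV"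
proof -
  obtain M where M: "\<And>x. \<bar>x\<bar> \<ge> real M \<Longrightarrow> F x = 0"
    using test_function_bounded_support[OF F] by blast
  define Q where "Q x = (\<Sum>\<^sub>\<infinity>m. F (x + of_int m))" for x
  define S where "S x = (\<Sum>\<^sub>\<infinity>l. fcoeff F l * osc (- l) x)" for x
  have Fc: "continuous_on UNIV F" by (rule smooth_imp_continuous_on[OF test_function_smooth[OF F]])
  note sf = fcoeff_summable[OF F]
  have ul: "uniform_limit UNIV (\<lambda>A x. \<Sum>l\<in>A. fcoeff F l * osc (- l) x) S (finite_subsets_at_top UNIV)"
    unfolding S_def by (rule Weierstrass_m_test_general[OF _ sf]) (simp add: norm_mult)
  have Ssum: "((\<lambda>l. fcoeff F l * osc (- l) x) has_sum S x) UNIV" for x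
    unfolding has_sum_def by (rule tendsto_uniform_limitI[OF ul]) simp
  have Sc: "continuous_on UNIV S"
    by (rule uniform_limit_theorem[OF _ ul]) (auto intro!: always_eventually continuous_intros)
  have per: "Q (x + of_int k) = Q x" "S (x + of_int k) = S x" for x k
  proof -
    have "Q (x + of_int k) = (\<Sum>\<^sub>\<infinity>m. F (x + of_int (k + m)))" by (simp add: Q_def add.assoc)
    also have "\<dots> = Q x"
      unfolding Q_def by (rule infsum_reindex_bij_betw[of "\<lambda>m. k + m" UNIV UNIV "\<lambda>m. F (x + of_int m)"])
        (rule bij_betwI[where g="\<lambda>m. m - k"], auto)
    finally show "Q (x + of_int k) = Q x" .
    show "S (x + of_int k) = S x" unfolding S_def osc_periodic ..
  qed
  have Qfin: "Q t = (\<Sum>m\<in>{- int (M + 1)..int (M + 1)}. F (t + of_int m))" if "t \<in> {0..1}" for t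
    unfolding Q_def
  proof (rule infsum_int_finite)
    fix l assume "\<bar>l\<bar> > int (M + 1)"
    then have "\<bar>real_of_int l\<bar> > real M + 1" by linarith
    then show "F (t + of_int l) = 0" using that by (intro M) auto
  qed
  have QFc: "continuous_on {0..1} (\<lambda>t. \<Sum>m\<in>{- int (M + 1)..int (M + 1)}. F (t + of_int m))"
    by (intro continuous_intros continuous_on_compose2[OF Fc]) auto
  have Qc: "continuous_on {0..1} Q"
    using QFc by (rule continuous_on_cong[THEN iffD1, rotated 2]) (use Qfin in auto)
  have Scc: "continuous_on {0..1} S" by (rule continuous_on_subset[OF Sc]) simp
  have Qco: "integral {0..1} (\<lambda>t. Q t * osc n t) = fcoeff F n" for n
  proof -
    have "integral {0..1} (\<lambda>t. Q t * osc n t) =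
      integral {0..1} (\<lambda>t. \<Sum>m\<in>{- int (M + 1)..int (M + 1)}. F (t + of_int m) * osc n (t + of_int m))"
    proof (rule integral_cong)
      fix t :: real assume t: "t \<in> {0..1}"
      show "Q t * osc n t = (\<Sum>m\<in>{- int (M + 1)..int (M + 1)}. F (t + of_int m) * osc n (t + of_int m))"
        by (simp only: Qfin[OF t] sum_distrib_right osc_periodic)
    qed
    also have "\<dots> = integral {- real (M + 1)..real (M + 1) + 1} (\<lambda>t. F t * osc n t)"
      by (rule integral_fold_unit_interval[symmetric]) (intro continuous_intros Fc)
    also have "\<dots> = fcoeff F n"
      unfolding fcoeff_def
      by (rule lint_eq_integral[symmetric]) (auto intro!: continuous_intros Fc M)
    finally show ?thesis .
  qed
  have Sco: "integral {0..1} (\<lambda>t. S t * osc n t) = fcoeff F n" for n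
  proof -
    have "uniform_limit {0..1} (\<lambda>A t. \<Sum>l\<in>A. fcoeff F l * osc (- l) t * osc n t) (\<lambda>t. S t * osc n t) (finite_subsets_at_top UNIV)"
      by (rule Weierstrass_m_test_general'[OF _ _ sf])
         (simp add: norm_mult, rule has_sum_cmult_left[OF Ssum])
    then obtain I J where IJ: "\<And>A. ((\<lambda>t. \<Sum>l\<in>A. fcoeff F l * osc (- l) t * osc n t) has_integral I A) {0..1}"
      "((\<lambda>t. S t * osc n t) has_integral J) {0..1}" "(I \<longlongrightarrow> J) (finite_subsets_at_top UNIV)"
      by (rule uniform_limit_integral) (auto intro!: continuous_intros)
    have I: "I A = (\<Sum>l\<in>A. if l = n then fcoeff F n else 0)" for A
    proof -
      have "((\<lambda>t. \<Sum>l\<in>A. fcoeff F l * osc (- l) t * osc n t) has_integral (\<Sum>l\<in>A. fcoeff F l * (if - l + n = 0 then 1 else 0))) {0..1}"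
      proof (cases "finite A")
        case True
        have "((\<lambda>t. fcoeff F l * osc (- l) t * osc n t) has_integral fcoeff F l * (if - l + n = 0 then 1 else 0)) {0..1}" for l
        proof -
          have "(osc (- l + n) has_integral (if - l + n = 0 then 1 else 0)) {0..1}"
            unfolding integral_osc[symmetric] by (intro integrable_integral integrable_continuous_real continuous_intros)
          from has_integral_mult_right[OF this, of "fcoeff F l"] show ?thesis
            unfolding osc_add by (simp add: mult.assoc)
        qed
        then show ?thesis by (intro has_integral_sum True)
      qed simp
      then have "I A = (\<Sum>l\<in>A. fcoeff F l * (if - l + n = 0 then 1 else 0))"
        using IJ(1) has_integral_unique by blast
      also have "\<dots> = (\<Sum>l\<in>A. if l = n then fcoeff F n else 0)"
        by (intro sum.cong) auto
      finally show ?thesis .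
    qed
    have "eventually (\<lambda>A. I A = fcoeff F n) (finite_subsets_at_top UNIV)"
      unfolding eventually_finite_subsets_at_top
      by (intro exI[of _ "{n}"]) (auto simp: I)
    then have "(I \<longlongrightarrow> fcoeff F n) (finite_subsets_at_top UNIV)" by (rule tendsto_eventually)
    then have "J = fcoeff F n" using IJ(3) tendsto_unique finite_subsets_at_top_neq_bot by blast
    then show ?thesis using IJ(2) by (simp add: integral_unique)
  qed
  have 01: "Q t - S t = 0" if "t \<in> {0..1}" for t
  proof (rule fourier_coefficients_unique[OF _ _ _ that])
    show "continuous_on {0..1} (\<lambda>t. Q t - S t)" by (intro continuous_intros Qc Scc)
    show "Q 0 - S 0 = Q 1 - S 1" using per(1)[of 0 1] per(2)[of 0 1] by simp
    fix n
    have "integral {0..1} (\<lambda>t. (Q t - S t) * osc n t)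
      = integral {0..1} (\<lambda>t. Q t * osc n t) - integral {0..1} (\<lambda>t. S t * osc n t)"
      by (subst integral_diff[symmetric])
         (auto intro!: integrable_continuous_real continuous_intros Qc Scc simp: left_diff_distrib)
    then show "integral {0..1} (\<lambda>t. (Q t - S t) * osc n t) = 0" unfolding Qco Sco by simp
  qed
  have "Q x = Q (frac x)" "S x = S (frac x)"
    using per[of "frac x" "\<lfloor>x\<rfloor>"] by (simp_all add: frac_def)
  moreover have "frac x \<in> {0..1}" using frac_lt_1[of x] by (simp add: less_imp_le)
  ultimately have "Q x = S x" using 01[of "frac x"] by simp
  then show ?thesis using Ssum[of x] by (simp add: Q_def)
qed

section \<open>Real analytic functions\<close>

lemma nth_deriv_holomorphic:
  assumes F: "F holomorphic_on ball (of_real x0) r" and eq: "\<And>x. \<bar>x - x0\<bar> < r \<Longrightarrow> f x = F (of_real x)"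
    and x: "\<bar>x - x0\<bar> < r"
  shows "nth_deriv n f x = (deriv ^^ n) F (of_real x)"
    and "(nth_deriv n f has_vector_derivative (deriv ^^ Suc n) F (of_real x)) (at x)"
proof -
  let ?B = "ball (complex_of_real x0) r"
  have inB: "of_real x \<in> ?B \<longleftrightarrow> \<bar>x - x0\<bar> < r" for x
    by (simp add: dist_norm abs_minus_commute flip: of_real_diff)
  have d: "((\<lambda>x. (deriv ^^ n) F (of_real x)) has_vector_derivative (deriv ^^ Suc n) F (of_real x)) (at x)"
    if "\<bar>x - x0\<bar> < r" for n x
    using holomorphic_derivI[OF holomorphic_higher_deriv[OF F open_ball, of n] open_ball, of "of_real x"] that inB
    by (intro has_vector_derivative_real_field) simp
  have V: "open (ball x0 r)" "\<bar>x - x0\<bar> < r \<longleftrightarrow> x \<in> ball x0 r" for x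
    by (auto simp: dist_real_def abs_minus_commute)
  have d': "(nth_deriv n f has_vector_derivative (deriv ^^ Suc n) F (of_real x)) (at x)"
    if "\<And>x. \<bar>x - x0\<bar> < r \<Longrightarrow> nth_deriv n f x = (deriv ^^ n) F (of_real x)" "\<bar>x - x0\<bar> < r" for n x
    by (rule has_vector_derivative_transform_within_open[OF d[OF that(2)] V(1)])
       (use that V(2) in auto)
  have e: "nth_deriv n f x = (deriv ^^ n) F (of_real x)" if "\<bar>x - x0\<bar> < r" for n x
    using that
  proof (induction n arbitrary: x)
    case (Suc n)
    show ?case
      unfolding nth_deriv_Suc by (rule vector_derivative_at[OF d'[OF Suc.IH Suc.prems]])
  qed (simp add: eq)
  show "nth_deriv n f x = (deriv ^^ n) F (of_real x)" by (rule e[OF x])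
  show "(nth_deriv n f has_vector_derivative (deriv ^^ Suc n) F (of_real x)) (at x)"
    by (rule d'[OF e x])
qed

text \<open>Working with local holomorphic extensions makes the closure properties of real analytic
  functions immediate and gives access to the Cauchy estimates.\<close>

lemma real_analytic_iff_holomorphic:
  "real_analytic f \<longleftrightarrow> (\<forall>x0. \<exists>r>0. \<exists>F. F holomorphic_on ball (of_real x0) r \<and>
      (\<forall>x. \<bar>x - x0\<bar> < r \<longrightarrow> f x = F (of_real x)))" (is "?L \<longleftrightarrow> ?R")
proof
  assume L: ?L
  show ?R
  proof
    fix x0 :: real
    from L obtain a r where r: "r > 0" and
      s: "\<And>x. \<bar>x - x0\<bar> < r \<Longrightarrow> (\<lambda>n. a n * of_real (x - x0) ^ n) sums f x"
      unfolding real_analytic_def by (elim conjE allE[of _ x0]) auto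
    define F where "F z = (\<Sum>n. a n * (z - of_real x0) ^ n)" for z
    have "F holomorphic_on ball (of_real x0) r"
    proof (rule power_series_holomorphic)
      fix w assume w: "w \<in> ball (complex_of_real x0) r"
      \<comment> \<open>A real point at the distance \<open>\<rho>\<close> lies farther out than \<open>w\<close>, and the series converges there.\<close>
      define \<rho> where "\<rho> = (cmod (w - of_real x0) + r) / 2"
      have \<rho>: "cmod (w - of_real x0) < \<rho>" "\<rho> < r" "\<rho> \<ge> 0"
        using w r by (auto simp: \<rho>_def dist_norm norm_minus_commute)
      have "summable (\<lambda>n. a n * of_real \<rho> ^ n)"
        using s[of "x0 + \<rho>"] \<rho> by (auto simp: sums_iff)
      then have "summable (\<lambda>n. a n * (w - of_real x0) ^ n)"
        by (rule powser_inside) (use \<rho> in auto)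
      then show "(\<lambda>n. a n * (w - of_real x0) ^ n) sums F w"
        unfolding F_def by (rule summable_sums)
    qed
    moreover have "f x = F (of_real x)" if "\<bar>x - x0\<bar> < r" for x
      using s[OF that] by (simp add: F_def sums_iff)
    ultimately show "\<exists>r>0. \<exists>F. F holomorphic_on ball (of_real x0) r \<and>
      (\<forall>x. \<bar>x - x0\<bar> < r \<longrightarrow> f x = F (of_real x))" using r by (intro exI[of _ r] exI[of _ F] conjI allI impI)
  qed
next
  assume R: ?R
  have "smooth f"
    unfolding smooth_def
  proof (intro allI)
    fix n x
    obtain r F where "r > 0" "F holomorphic_on ball (of_real x) r" "\<And>y. \<bar>y - x\<bar> < r \<Longrightarrow> f y = F (of_real y)"
      using R by metis
    from nth_deriv_holomorphic(2)[OF this(2,3), of x n] this(1)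
    show "nth_deriv n f differentiable at x" by (auto intro: differentiableI_vector)
  qed
  moreover have "\<exists>a r. r > 0 \<and> (\<forall>x. \<bar>x - x0\<bar> < r \<longrightarrow> (\<lambda>n. a n * of_real (x - x0) ^ n) sums f x)" for x0
  proof -
    obtain r F where r: "r > 0" and F: "F holomorphic_on ball (of_real x0) r" "\<And>y. \<bar>y - x0\<bar> < r \<Longrightarrow> f y = F (of_real y)"
      using R by metis
    have "(\<lambda>n. (deriv ^^ n) F (of_real x0) / fact n * of_real (x - x0) ^ n) sums f x" if "\<bar>x - x0\<bar> < r" for x
    proof -
      have "of_real x \<in> ball (complex_of_real x0) r"
        using that by (simp add: dist_norm abs_minus_commute flip: of_real_diff)
      from holomorphic_power_series[OF F(1) this] show ?thesis using F(2)[OF that] by simp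
    qed
    then show ?thesis
      using r by (intro exI[of _ "\<lambda>n. (deriv ^^ n) F (of_real x0) / fact n"] exI[of _ r]) simp
  qed
  ultimately show ?L unfolding real_analytic_def by (intro conjI allI)
qed

lemma real_analytic_holomorphicE:
  assumes "real_analytic f"
  obtains r F where "r > 0" "F holomorphic_on ball (of_real x0) r" "\<And>x. \<bar>x - x0\<bar> < r \<Longrightarrow> f x = F (of_real x)"
  using assms unfolding real_analytic_iff_holomorphic by metis

lemma real_analytic_smooth: "real_analytic f \<Longrightarrow> smooth f"
  by (simp add: real_analytic_def)

lemma real_analytic_holomorphic:
  assumes "F holomorphic_on UNIV" shows "real_analytic (\<lambda>x. F (of_real x))"
  unfolding real_analytic_iff_holomorphic
proof
  fix x0 :: real
  have "F holomorphic_on ball (of_real x0) 1" by (rule holomorphic_on_subset[OF assms]) simp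
  then show "\<exists>r>0. \<exists>G. G holomorphic_on ball (of_real x0) r \<and>
      (\<forall>x. \<bar>x - x0\<bar> < r \<longrightarrow> F (of_real x) = G (of_real x))" by (intro exI[of _ 1]) auto
qed

text \<open>The operation \<open>H\<close> is addition or multiplication in what follows.\<close>

lemma real_analytic_combine:
  assumes f: "real_analytic f" and g: "real_analytic g"
    and H: "\<And>F G S. F holomorphic_on S \<Longrightarrow> G holomorphic_on S \<Longrightarrow> (\<lambda>z. H (F z) (G z)) holomorphic_on S"
  shows "real_analytic (\<lambda>x. H (f x) (g x))"
  unfolding real_analytic_iff_holomorphic
proof
  fix x0 :: real
  obtain r F where F: "r > 0" "F holomorphic_on ball (of_real x0) r" "\<And>x. \<bar>x - x0\<bar> < r \<Longrightarrow> f x = F (of_real x)"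
    using real_analytic_holomorphicE[OF f] by metis
  obtain s G where G: "s > 0" "G holomorphic_on ball (of_real x0) s" "\<And>x. \<bar>x - x0\<bar> < s \<Longrightarrow> g x = G (of_real x)"
    using real_analytic_holomorphicE[OF g] by metis
  have "(\<lambda>z. H (F z) (G z)) holomorphic_on ball (of_real x0) (min r s)"
    by (intro H holomorphic_on_subset[OF F(2)] holomorphic_on_subset[OF G(2)]) auto
  then show "\<exists>r>0. \<exists>K. K holomorphic_on ball (of_real x0) r \<and>
      (\<forall>x. \<bar>x - x0\<bar> < r \<longrightarrow> H (f x) (g x) = K (of_real x))"
    using F(1,3) G(1,3) by (intro exI[of _ "min r s"] conjI exI[of _ "\<lambda>z. H (F z) (G z)"]) auto
qed

lemma real_analytic_add: "real_analytic f \<Longrightarrow> real_analytic g \<Longrightarrow> real_analytic (\<lambda>x. f x + g x)"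
  by (rule real_analytic_combine) (auto intro: holomorphic_intros)

lemma real_analytic_mult: "real_analytic f \<Longrightarrow> real_analytic g \<Longrightarrow> real_analytic (\<lambda>x. f x * g x)"
  by (rule real_analytic_combine) (auto intro: holomorphic_intros)

lemma real_analytic_const: "real_analytic (\<lambda>x. c)"
  by (rule real_analytic_holomorphic[of "\<lambda>z. c"]) auto

lemma real_analytic_sum: "(\<And>i. i \<in> A \<Longrightarrow> real_analytic (f i)) \<Longrightarrow> real_analytic (\<lambda>x. \<Sum>i\<in>A. f i x)"
  by (induction A rule: infinite_finite_induct) (simp_all add: real_analytic_const real_analytic_add)

lemma real_analytic_translate:
  assumes "real_analytic f" shows "real_analytic (\<lambda>x. f (x + b))"
  unfolding real_analytic_iff_holomorphic
proof
  fix x0 :: real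
  obtain r F where F: "r > 0" "F holomorphic_on ball (of_real (x0 + b)) r"
    "\<And>x. \<bar>x - (x0 + b)\<bar> < r \<Longrightarrow> f x = F (of_real x)"
    using real_analytic_holomorphicE[OF assms] by metis
  have "(F \<circ> (\<lambda>z. z + of_real b)) holomorphic_on ball (of_real x0) r"
    by (rule holomorphic_on_compose_gen[OF _ F(2)]) (auto intro!: holomorphic_intros simp: dist_norm algebra_simps)
  then show "\<exists>r>0. \<exists>K. K holomorphic_on ball (of_real x0) r \<and>
      (\<forall>x. \<bar>x - x0\<bar> < r \<longrightarrow> f (x + b) = K (of_real x))"
    using F(1,3) by (intro exI[of _ r] conjI exI[of _ "F \<circ> (\<lambda>z. z + of_real b)"]) auto
qed

section \<open>Analytic periodic functions and exponentially decaying Fourier coefficients\<close>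

text \<open>Locally these are the Cauchy estimates for a holomorphic extension. Two such estimates on
  adjacent intervals combine into one on their union, so compactness of the unit interval gives
  uniform constants.\<close>

lemma real_analytic_deriv_bounds:
  assumes f: "real_analytic f"
  obtains B \<rho> where "B > 0" "\<rho> > 0" "\<And>n t. t \<in> {0..1} \<Longrightarrow> cmod (nth_deriv n f t) \<le> B * fact n / \<rho> ^ n"
proof -
  let ?P = "\<lambda>a b. \<exists>B \<rho>. B > 0 \<and> \<rho> > 0 \<and> (\<forall>n. \<forall>t\<in>{a..b}. cmod (nth_deriv n f t) \<le> B * fact n / \<rho> ^ n)"
  have "?P 0 1"
  proof (rule Bolzano[where P="?P"])
    fix a b c :: real
    assume "?P a b" "?P b c"
    then obtain B1 r1 B2 r2 where
      1: "B1 > 0" "r1 > 0" "\<And>n t. t \<in> {a..b} \<Longrightarrow> cmod (nth_deriv n f t) \<le> B1 * fact n / r1 ^ n" and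
      2: "B2 > 0" "r2 > 0" "\<And>n t. t \<in> {b..c} \<Longrightarrow> cmod (nth_deriv n f t) \<le> B2 * fact n / r2 ^ n"
      by metis
    show "?P a c"
    proof (rule exI[of _ "B1 + B2"], rule exI[of _ "min r1 r2"], intro conjI allI ballI)
      fix n t assume t: "t \<in> {a..c}"
      have "B1 * fact n / r1 ^ n \<le> (B1 + B2) * fact n / min r1 r2 ^ n"
        using 1 2 by (intro frac_le mult_right_mono power_mono) auto
      moreover have "B2 * fact n / r2 ^ n \<le> (B1 + B2) * fact n / min r1 r2 ^ n"
        using 1 2 by (intro frac_le mult_right_mono power_mono) auto
      moreover have "t \<in> {a..b} \<or> t \<in> {b..c}" using t by auto
      ultimately show "cmod (nth_deriv n f t) \<le> (B1 + B2) * fact n / min r1 r2 ^ n"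
        using 1(3)[of t n] 2(3)[of t n] by linarith
    qed (use 1 2 in auto)
  next
    fix x0 :: real
    obtain r F where F: "r > 0" "F holomorphic_on ball (of_real x0) r" "\<And>x. \<bar>x - x0\<bar> < r \<Longrightarrow> f x = F (of_real x)"
      using real_analytic_holomorphicE[OF f] by metis
    have "continuous_on (cball (of_real x0) (r/2)) F"
      by (rule holomorphic_on_imp_continuous_on, rule holomorphic_on_subset[OF F(2)]) (use F(1) in auto)
    then have "bounded (F ` cball (of_real x0) (r/2))"
      by (intro compact_imp_bounded compact_continuous_image) auto
    then obtain B where B: "B > 0" "\<And>z. z \<in> cball (of_real x0) (r/2) \<Longrightarrow> cmod (F z) \<le> B"
      unfolding bounded_pos by auto
    have bd: "cmod (nth_deriv n f t) \<le> B * fact n / (r/4) ^ n" if t: "\<bar>t - x0\<bar> < r / 4" for n t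
    proof -
      have dt: "dist (complex_of_real x0) (of_real t) < r / 4"
        using t by (simp add: dist_norm abs_minus_commute flip: of_real_diff)
      have sub: "cball (of_real t) (r/4) \<subseteq> cball (complex_of_real x0) (r/2)"
        using dt by (simp add: cball_subset_cball_iff dist_commute)
      have sub': "cball (complex_of_real x0) (r/2) \<subseteq> ball (of_real x0) r" using F(1) by auto
      have "cmod ((deriv ^^ n) F (of_real t)) \<le> fact n * B / (r/4) ^ n"
      proof (rule Cauchy_inequality)
        show "F holomorphic_on ball (of_real t) (r/4)"
          by (rule holomorphic_on_subset[OF F(2)]) (use sub sub' ball_subset_cball in blast)
        show "continuous_on (cball (of_real t) (r/4)) F"
          by (rule holomorphic_on_imp_continuous_on, rule holomorphic_on_subset[OF F(2)]) (use sub sub' in blast)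
        fix z assume "cmod (of_real t - z) = r / 4"
        then have "z \<in> cball (of_real t) (r/4)" by (simp add: dist_norm)
        then show "cmod (F z) \<le> B" using B(2) sub by blast
      qed (use F(1) in auto)
      moreover have "nth_deriv n f t = (deriv ^^ n) F (of_real t)"
        by (rule nth_deriv_holomorphic(1)[OF F(2,3)]) (use t F(1) in auto)
      ultimately show ?thesis by (simp add: mult.commute)
    qed
    show "\<exists>d>0. \<forall>a b. a \<le> x0 \<and> x0 \<le> b \<and> b - a < d \<longrightarrow> ?P a b"
    proof (rule exI[of _ "r/4"], intro conjI allI impI)
      fix a b :: real assume ab: "a \<le> x0 \<and> x0 \<le> b \<and> b - a < r / 4"
      show "?P a b"
      proof (rule exI[of _ B], rule exI[of _ "r/4"], intro conjI allI ballI)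
        fix n t assume "t \<in> {a..b}"
        then have "\<bar>t - x0\<bar> < r / 4" using ab unfolding abs_less_iff by auto
        then show "cmod (nth_deriv n f t) \<le> B * fact n / (r/4) ^ n" by (rule bd)
      qed (use F(1) B(1) in auto)
    qed (use F(1) in auto)
  qed simp
  then show thesis using that by blast
qed

text \<open>Integration by parts; the boundary terms cancel by periodicity.\<close>

lemma periodic_fourier_coefficient_deriv:
  assumes f: "smooth f" and per: "\<And>t. f (t + 1) = f t"
  shows "integral {0..1} (\<lambda>t. nth_deriv n f t * exp (- (2 * of_real pi * \<i> * of_int l) * of_real t)) =
     (2 * of_real pi * \<i> * of_int l) ^ n * integral {0..1} (\<lambda>t. f t * exp (- (2 * of_real pi * \<i> * of_int l) * of_real t))"
proof (induction n)
  case (Suc n)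
  let ?c = "2 * of_real pi * \<i> * of_int l :: complex"
  let ?e = "\<lambda>t. exp (- ?c * of_real t)"
  let ?g = "\<lambda>t. nth_deriv n f t * ?e t"
  have e: "smooth ?e" by (rule smooth_exp)
  have d: "(?g has_vector_derivative nth_deriv n f t * (- ?c * ?e t) + nth_deriv (Suc n) f t * ?e t) (at t)" for t
    using has_vector_derivative_mult[OF has_vector_derivative_nth_deriv[OF f, of n t]
        has_vector_derivative_nth_deriv[OF e, of 0 t]] nth_deriv_exp[of "Suc 0" "- ?c"] by simp
  have "((\<lambda>t. nth_deriv n f t * (- ?c * ?e t) + nth_deriv (Suc n) f t * ?e t) has_integral ?g 1 - ?g 0) {0..1}"
    by (intro fundamental_theorem_of_calculus has_vector_derivative_at_within[OF d]) simp
  moreover have "nth_deriv n f 1 = nth_deriv n f 0"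
    using nth_deriv_translate[OF f, of n 1] per by (simp add: fun_eq_iff) (metis add_0)
  moreover have "exp (- ?c) = 1" using osc_int[of "- l" 1] by simp
  ultimately have "integral {0..1} (\<lambda>t. nth_deriv n f t * (- ?c * ?e t) + nth_deriv (Suc n) f t * ?e t) = 0"
    by (intro integral_unique) simp
  moreover have "integral {0..1} (\<lambda>t. nth_deriv n f t * (- ?c * ?e t) + nth_deriv (Suc n) f t * ?e t)
    = integral {0..1} (\<lambda>t. (- ?c) * ?g t) + integral {0..1} (\<lambda>t. nth_deriv (Suc n) f t * ?e t)"
    by (subst integral_add[symmetric])
       (auto intro!: integrable_continuous_real continuous_intros f simp: mult_ac)
  ultimately have "integral {0..1} (\<lambda>t. nth_deriv (Suc n) f t * ?e t) = ?c * integral {0..1} ?g"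
    by (simp add: integral_mult_right)
  then show ?case using Suc by simp
qed simp

text \<open>Integrating by parts \<open>n\<close> times bounds the \<open>l\<close>-th coefficient by \<open>B n! / (s \<bar>l\<bar>)^n\<close> for every \<open>n\<close>,
  where \<open>s = 2 \<pi> \<rho>\<close> and \<open>\<rho>\<close> comes from the Cauchy estimates.
  With \<open>n\<close> about \<open>s \<bar>l\<bar> / 2\<close> and \<open>n! \<le> n^n\<close> this is at most a constant times \<open>2 powr (- s \<bar>l\<bar> / 2)\<close>.\<close>

lemma analytic_periodic_fourier_decay:
  assumes f: "real_analytic f" and per: "\<And>t. f (t + 1) = f t"
  shows "exp_decay (\<lambda>l. integral {0..1} (\<lambda>t. f t * exp (- (2 * of_real pi * \<i> * of_int l) * of_real t)))"
proof -
  note sm = real_analytic_smooth[OF f]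
  obtain B \<rho> where B: "B > 0" and \<rho>: "\<rho> > 0" and
    bd: "\<And>n t. t \<in> {0..1} \<Longrightarrow> cmod (nth_deriv n f t) \<le> B * fact n / \<rho> ^ n"
    using real_analytic_deriv_bounds[OF f] by metis
  let ?c = "\<lambda>l. integral {0..1} (\<lambda>t. f t * exp (- (2 * of_real pi * \<i> * of_int l) * of_real t))"
  define s where "s = 2 * pi * \<rho>"
  have s: "s > 0" using \<rho> by (simp add: s_def)
  define q where "q = 2 powr (- (s / 2))"
  have q: "0 < q" "q < 1" using s by (auto simp: q_def powr_less_one)
  have est: "cmod (?c l) * (2 * pi * real_of_int \<bar>l\<bar>) ^ n \<le> B * fact n / \<rho> ^ n" for l n
  proof -
    have "cmod (?c l) * (2 * pi * real_of_int \<bar>l\<bar>) ^ n = cmod ((2 * of_real pi * \<i> * of_int l) ^ n * ?c l)"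
      by (simp add: norm_mult norm_power)
    also have "\<dots> = cmod (integral {0..1} (\<lambda>t. nth_deriv n f t * exp (- (2 * of_real pi * \<i> * of_int l) * of_real t)))"
      unfolding periodic_fourier_coefficient_deriv[OF sm per] ..
    also have "\<dots> \<le> B * fact n / \<rho> ^ n * (1 - 0)"
    proof (rule integral_bound)
      fix t :: real assume "t \<in> {0..1}"
      then show "cmod (nth_deriv n f t * exp (- (2 * of_real pi * \<i> * of_int l) * of_real t)) \<le> B * fact n / \<rho> ^ n"
        using bd[of t n] by (simp add: norm_mult)
    qed (auto intro!: continuous_intros sm)
    finally show ?thesis by simp
  qed
  have "cmod (?c l) \<le> (2 * B) * q ^ nat \<bar>l\<bar>" for l
  proof (cases "l = 0")
    case True
    then show ?thesis using est[of 0 0] B by simp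
  next
    case False
    define L where "L = real_of_int \<bar>l\<bar>"
    have L: "L > 0" using False by (simp add: L_def)
    define n where "n = nat \<lfloor>s * L / 2\<rfloor>"
    have n: "real n \<le> s * L / 2" "s * L / 2 - 1 < real n"
      using s L by (auto simp: n_def) linarith
    have "cmod (?c l) * (s * L) ^ n = cmod (?c l) * (2 * pi * L) ^ n * \<rho> ^ n"
      by (simp add: s_def power_mult_distrib mult_ac)
    also have "\<dots> \<le> B * fact n"
      using est[of l n] \<rho> by (simp add: L_def field_simps)
    also have "\<dots> \<le> B * real n ^ n"
      using B fact_le_power[of n, where 'a=real] by (intro mult_left_mono) auto
    also have "\<dots> \<le> B * (s * L / 2) ^ n"
      using B n(1) by (intro mult_left_mono power_mono) auto
    also have "\<dots> = B * (1/2) ^ n * (s * L) ^ n"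
      by (simp add: power_divide)
    finally have 1: "cmod (?c l) \<le> B * (1/2) ^ n"
      using s L by (simp add: mult_le_cancel_right)
    have Ln: "L = real (nat \<bar>l\<bar>)" by (simp add: L_def)
    have "(1/2) ^ n = 2 powr (- real n)"
      by (simp add: powr_minus powr_realpow power_one_over inverse_eq_divide)
    also have "\<dots> \<le> 2 powr (1 - s * L / 2)"
      using n(2) by (intro powr_mono) auto
    also have "1 - s * L / 2 = 1 + - (s / 2) * L" by simp
    also have "2 powr (1 + - (s / 2) * L) = 2 * 2 powr (- (s / 2) * L)"
      by (simp only: powr_add) simp
    also have "2 powr (- (s / 2) * L) = q powr L" by (simp only: q_def powr_powr)
    also have "q powr L = q ^ nat \<bar>l\<bar>" unfolding Ln by (rule powr_realpow[OF q(1)])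
    finally have "B * (1/2) ^ n \<le> B * (2 * q ^ nat \<bar>l\<bar>)" using B by (intro mult_left_mono) auto
    with 1 show ?thesis by simp
  qed
  then show ?thesis unfolding exp_decay_def using B q
    by (intro exI[of _ "2 * B"] exI[of _ q]) auto
qed

text \<open>Exponentially decaying coefficients make the series converge uniformly, with holomorphic
  terms, on a horizontal strip around the real line.\<close>

lemma exp_decay_fourier_series:
  assumes c: "exp_decay c"
  shows "(\<lambda>l. c l * exp (2 * of_real pi * \<i> * of_int l * of_real t)) summable_on UNIV"
    and "real_analytic (\<lambda>t. \<Sum>\<^sub>\<infinity>l. c l * exp (2 * of_real pi * \<i> * of_int l * of_real t))"
    and "(\<lambda>l. cmod (c l)) summable_on UNIV"
proof -
  obtain C q where q: "C > 0" "0 < q" "q < 1" "\<And>l. cmod (c l) \<le> C * q ^ nat \<bar>l\<bar>"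
    using c unfolding exp_decay_def by blast
  \<comment> \<open>On the strip of this half-width the \<open>l\<close>-th exponential grows at most like \<open>q\<close> to the power \<open>- \<bar>l\<bar> / 2\<close>.\<close>
  define \<delta> where "\<delta> = - ln q / (4 * pi)"
  have "ln q < 0" using q by simp
  then have \<delta>: "\<delta> > 0" by (simp add: \<delta>_def divide_neg_pos)
  \<comment> \<open>The square root of \<open>q\<close> is the rate of decay that is left on the strip.\<close>
  define q' where "q' = exp (ln q / 2)"
  have q': "0 < q'" "q' < 1" using q by (auto simp: q'_def)
  define M where "M l = C * q' ^ nat \<bar>l\<bar>" for l :: int
  have M: "M summable_on UNIV"
    unfolding M_def using q' by (intro summable_on_cmult_right summable_on_int_nat_abs summable_geometric) auto
  have le: "cmod (c l * exp (2 * of_real pi * \<i> * of_int l * z)) \<le> M l" if "\<bar>Im z\<bar> \<le> \<delta>" for l z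
  proof -
    have "- (2 * pi * of_int l * Im z) \<le> \<bar>2 * pi * of_int l * Im z\<bar>" by linarith
    also have "\<dots> = 2 * pi * real_of_int \<bar>l\<bar> * \<bar>Im z\<bar>" by (simp add: abs_mult)
    also have "\<dots> \<le> 2 * pi * real_of_int \<bar>l\<bar> * \<delta>" using that by (intro mult_left_mono) auto
    also have "\<dots> = real (nat \<bar>l\<bar>) * (- ln q / 2)" by (simp add: \<delta>_def)
    finally have "cmod (exp (2 * of_real pi * \<i> * of_int l * z)) \<le> exp (real (nat \<bar>l\<bar>) * (- ln q / 2))"
      by (simp add: norm_exp_eq_Re)
    then have "cmod (c l * exp (2 * of_real pi * \<i> * of_int l * z)) \<le> C * q ^ nat \<bar>l\<bar> * exp (real (nat \<bar>l\<bar>) * (- ln q / 2))"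
      unfolding norm_mult using q by (intro mult_mono) auto
    also have "\<dots> = C * (q * exp (- ln q / 2)) ^ nat \<bar>l\<bar>"
      by (simp only: exp_of_nat_mult power_mult_distrib mult.assoc)
    also have "q * exp (- ln q / 2) = exp (ln q) * exp (- ln q / 2)" using q by simp
    also have "\<dots> = q'" unfolding q'_def by (simp only: exp_add[symmetric]) simp
    finally show ?thesis by (simp add: M_def)
  qed
  have le0: "cmod (c l) \<le> M l" for l using le[of 0 l] \<delta> by simp
  show "(\<lambda>l. cmod (c l)) summable_on UNIV"
    by (rule summable_on_comparison_test[OF M le0]) auto
  show "(\<lambda>l. c l * exp (2 * of_real pi * \<i> * of_int l * of_real t)) summable_on UNIV"
  proof (rule abs_summable_summable, rule summable_on_comparison_test[OF M])
    show "cmod (c l * exp (2 * of_real pi * \<i> * of_int l * of_real t)) \<le> M l" for l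
      by (rule le) (use \<delta> in simp)
  qed simp
  let ?F = "\<lambda>z. \<Sum>\<^sub>\<infinity>l. c l * exp (2 * of_real pi * \<i> * of_int l * z)"
  show "real_analytic (\<lambda>t. ?F (of_real t))"
    unfolding real_analytic_iff_holomorphic
  proof
    fix x0 :: real
    have "uniform_limit (cball (of_real x0) \<delta>) (\<lambda>A z. \<Sum>l\<in>A. c l * exp (2 * of_real pi * \<i> * of_int l * z)) ?F
        (finite_subsets_at_top UNIV)"
    proof (rule Weierstrass_m_test_general[OF _ M])
      fix l z assume "z \<in> cball (complex_of_real x0) \<delta>"
      then have "\<bar>Im (z - of_real x0)\<bar> \<le> \<delta>"
        using abs_Im_le_cmod[of "z - of_real x0"] by (auto simp: dist_norm norm_minus_commute)
      then show "cmod (c l * exp (2 * of_real pi * \<i> * of_int l * z)) \<le> M l" by (intro le) simp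
    qed
    then have "?F holomorphic_on ball (of_real x0) \<delta>"
      by (rule holomorphic_uniform_limit[rotated])
         (auto intro!: always_eventually continuous_intros holomorphic_intros)
    with \<delta> show "\<exists>r>0. \<exists>F. F holomorphic_on ball (of_real x0) r \<and>
      (\<forall>x. \<bar>x - x0\<bar> < r \<longrightarrow> ?F (of_real x) = F (of_real x))" by blast
  qed
qed

section \<open>Moments of exponentially weighted shift sums\<close>

lemma integrable_regular:
  assumes "continuous_on UNIV g" "f \<in> test_functions"
  shows "integrable lborel (\<lambda>x. g x * f x)"
proof -
  obtain M where M: "\<And>x. \<bar>x\<bar> \<ge> real M \<Longrightarrow> f x = 0"
    using test_function_bounded_support[OF assms(2)] by blast
  show ?thesis
  proof (rule integrable_compact_support[where a="- real M" and b="real M"])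
    show "continuous_on UNIV (\<lambda>x. g x * f x)"
      by (intro continuous_on_mult assms(1) smooth_imp_continuous_on test_function_smooth assms(2))
    show "g x * f x = 0" if "x \<notin> {- real M..real M}" for x
      using M[of x] that by auto
  qed
qed

text \<open>The distribution \<open>\<Sum> exp (lam m) ((t - m)^k u(t - m))\<close>. Unlike the weighted shift sums with the
  weights \<open>exp (lam m) m^k\<close>, it is \<open>exp (lam t)\<close> times a distribution of period one, and so it has a
  Fourier series.\<close>

definition moment_sum :: "functional \<Rightarrow> complex \<Rightarrow> nat \<Rightarrow> functional" where
  "moment_sum u lam k f =
     (\<Sum>\<^sub>\<infinity>m. exp (lam * of_int m) * u (\<lambda>x. of_real x ^ k * f (x + of_int m)))"

lemma test_function_moment:
  assumes "f \<in> test_functions"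
  shows "(\<lambda>x. of_real x ^ k * f x) \<in> test_functions"
    and "(\<lambda>x. of_real x ^ k * f (x + b)) \<in> test_functions"
  by (intro test_function_mult_smooth(2) test_function_translate assms smooth_power smooth_of_real)+

lemma moment_and_shift_sums_finite:
  assumes u: "distribution u" "compactly_supported u" and f: "f \<in> test_functions"
  obtains N0 :: nat where
    "\<And>N lam k i. N \<ge> N0 \<Longrightarrow> moment_sum u lam k (\<lambda>t. of_real t ^ i * f t) = (\<Sum>m\<in>{- int N..int N}.
        exp (lam * of_int m) * u (\<lambda>x. of_real x ^ k * (of_real (x + of_int m) ^ i * f (x + of_int m))))"
    "\<And>N c i. N \<ge> N0 \<Longrightarrow> shift_sum u c (\<lambda>t. of_real t ^ i * f t) = (\<Sum>m\<in>{- int N..int N}.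
        c m * u (\<lambda>x. of_real (x + of_int m) ^ i * f (x + of_int m)))"
proof -
  obtain N0 :: nat where N0:
    "\<And>(l::int) g. \<bar>l\<bar> > int N0 \<Longrightarrow> smooth g \<Longrightarrow> u (\<lambda>x. g x * f (x + of_int l)) = 0"
    using shifts_eventually_off_support[OF assms] by blast
  have sm: "smooth (\<lambda>x. of_real x ^ k * of_real (x + b) ^ i)" for k i b
    by (rule smooth_mult[OF smooth_power[OF smooth_of_real] smooth_power[OF smooth_translate[OF smooth_of_real]]])
  have z: "u (\<lambda>x. of_real x ^ k * (of_real (x + of_int m) ^ i * f (x + of_int m))) = 0"
    if "\<bar>m\<bar> > int N" "N \<ge> N0" for k i m N
    using N0[OF _ sm[of k "of_int m" i], of m] that by (simp add: mult.assoc)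
  show thesis
  proof (rule that[of N0])
    fix N lam k i assume N: "N \<ge> N0"
    show "moment_sum u lam k (\<lambda>t. of_real t ^ i * f t) = (\<Sum>m\<in>{- int N..int N}.
        exp (lam * of_int m) * u (\<lambda>x. of_real x ^ k * (of_real (x + of_int m) ^ i * f (x + of_int m))))"
      unfolding moment_sum_def by (rule infsum_int_finite) (simp only: z[OF _ N] mult_zero_right)
  next
    fix N c i assume N: "N \<ge> N0"
    have z0: "u (\<lambda>x. of_real (x + of_int m) ^ i * f (x + of_int m)) = 0" if "\<bar>m\<bar> > int N" for m
      using z[OF that N, of 0 i] by simp
    show "shift_sum u c (\<lambda>t. of_real t ^ i * f t) = (\<Sum>m\<in>{- int N..int N}.
        c m * u (\<lambda>x. of_real (x + of_int m) ^ i * f (x + of_int m)))"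
      unfolding shift_sum_def translate_def by (rule infsum_int_finite) (simp only: z0 mult_zero_right)
  qed
qed

text \<open>The binomial theorem under a distribution. Used with \<open>m = (x + m) - x\<close> and with
  \<open>x = (x + m) - m\<close>, it expresses weighted shift sums by moment sums and conversely.\<close>

lemma distribution_binomial:
  assumes u: "distribution u" and f: "f \<in> test_functions" and B: "smooth B" and C: "smooth C"
  shows "u (\<lambda>x. (B x + C x) ^ k * f x) =
    (\<Sum>j\<le>k. of_nat (k choose j) * u (\<lambda>x. B x ^ j * (C x ^ (k - j) * f x)))"
proof -
  have t: "(\<lambda>x. B x ^ j * (C x ^ i * f x)) \<in> test_functions" for i j
    by (intro test_function_mult_smooth(2) smooth_power B C f)
  have "(\<lambda>x. (B x + C x) ^ k * f x) =
      (\<lambda>x. \<Sum>j\<le>k. of_nat (k choose j) * (B x ^ j * (C x ^ (k - j) * f x)))"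
    unfolding binomial_ring sum_distrib_right by (simp only: mult.assoc)
  then show ?thesis
    by (simp only: distribution_sum[OF u test_function_cmult[OF t]] distribution_cmult[OF u t])
qed

lemma smooth_uminus_of_real: "smooth (\<lambda>x. - of_real x)"
  using smooth_cmult[OF smooth_of_real, of "- 1"] by simp

lemma smooth_of_real_translate: "smooth (\<lambda>x. of_real (x + b))"
  by (rule smooth_translate[OF smooth_of_real])

lemma shift_sum_eq_moment_sums:
  assumes u: "distribution u" "compactly_supported u" and f: "f \<in> test_functions"
  shows "shift_sum u (\<lambda>l. exp (lam * of_int l) * of_int l ^ k) f =
    (\<Sum>j\<le>k. of_nat (k choose j) * (- 1) ^ j * moment_sum u lam j (\<lambda>t. of_real t ^ (k - j) * f t))"
proof -
  obtain N where N: "\<And>lam k i. moment_sum u lam k (\<lambda>t. of_real t ^ i * f t) = (\<Sum>m\<in>{- int N..int N}.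
        exp (lam * of_int m) * u (\<lambda>x. of_real x ^ k * (of_real (x + of_int m) ^ i * f (x + of_int m))))"
    "\<And>c i. shift_sum u c (\<lambda>t. of_real t ^ i * f t) = (\<Sum>m\<in>{- int N..int N}.
        c m * u (\<lambda>x. of_real (x + of_int m) ^ i * f (x + of_int m)))"
    by (rule moment_and_shift_sums_finite[OF assms]) (meson order_refl)
  have t: "(\<lambda>x. of_real x ^ j * (of_real (x + of_int m) ^ i * f (x + of_int m))) \<in> test_functions" for i j and m :: int
    by (intro test_function_moment(2)[OF test_function_moment(1)[OF f]] test_function_mult_smooth(2)
        smooth_power smooth_of_real smooth_translate test_function_translate f)
  have trm: "of_int m ^ k * u (\<lambda>x. f (x + of_int m)) =
    (\<Sum>j\<le>k. of_nat (k choose j) * (- 1) ^ j * u (\<lambda>x. of_real x ^ j * (of_real (x + of_int m) ^ (k - j) * f (x + of_int m))))" for m :: int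
  proof -
    note tr = test_function_translate[OF f, of "of_int m"]
    have "of_int m ^ k * u (\<lambda>x. f (x + of_int m)) =
        u (\<lambda>x. (- of_real x + of_real (x + of_int m)) ^ k * f (x + of_int m))"
      by (simp add: distribution_cmult[OF u(1) tr])
    also have "\<dots> = (\<Sum>j\<le>k. of_nat (k choose j) *
        u (\<lambda>x. (- of_real x) ^ j * (of_real (x + of_int m) ^ (k - j) * f (x + of_int m))))"
      by (rule distribution_binomial[OF u(1) tr smooth_uminus_of_real smooth_of_real_translate])
    finally show ?thesis
      unfolding power_minus[of "of_real _"] mult.assoc distribution_cmult[OF u(1) t] .
  qed
  have "shift_sum u (\<lambda>l. exp (lam * of_int l) * of_int l ^ k) f
      = (\<Sum>m\<in>{- int N..int N}. exp (lam * of_int m) * (of_int m ^ k * u (\<lambda>x. f (x + of_int m))))"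
    using N(2)[of _ 0] by (simp add: mult.assoc)
  also have "\<dots> = (\<Sum>m\<in>{- int N..int N}. \<Sum>j\<le>k. of_nat (k choose j) * (- 1) ^ j * (exp (lam * of_int m) *
      u (\<lambda>x. of_real x ^ j * (of_real (x + of_int m) ^ (k - j) * f (x + of_int m)))))"
    unfolding trm sum_distrib_left by (intro sum.cong refl) (simp only: mult_ac)
  also have "\<dots> = (\<Sum>j\<le>k. of_nat (k choose j) * (- 1) ^ j * moment_sum u lam j (\<lambda>t. of_real t ^ (k - j) * f t))"
    unfolding N(1) sum_distrib_left by (rule sum.swap)
  finally show ?thesis .
qed

lemma moment_sum_eq_shift_sums:
  assumes u: "distribution u" "compactly_supported u" and f: "f \<in> test_functions"
  shows "moment_sum u lam k f = (\<Sum>j\<le>k. of_nat (k choose j) * (- 1) ^ j *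
    shift_sum u (\<lambda>l. exp (lam * of_int l) * of_int l ^ j) (\<lambda>t. of_real t ^ (k - j) * f t))"
proof -
  obtain N where N: "\<And>lam k i. moment_sum u lam k (\<lambda>t. of_real t ^ i * f t) = (\<Sum>m\<in>{- int N..int N}.
        exp (lam * of_int m) * u (\<lambda>x. of_real x ^ k * (of_real (x + of_int m) ^ i * f (x + of_int m))))"
    "\<And>c i. shift_sum u c (\<lambda>t. of_real t ^ i * f t) = (\<Sum>m\<in>{- int N..int N}.
        c m * u (\<lambda>x. of_real (x + of_int m) ^ i * f (x + of_int m)))"
    by (rule moment_and_shift_sums_finite[OF assms]) (meson order_refl)
  have t: "(\<lambda>x. of_real (x + of_int m) ^ i * f (x + of_int m)) \<in> test_functions" for i and m :: int
    by (rule test_function_translate[OF test_function_moment(1)[OF f]])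
  have trm: "u (\<lambda>x. of_real x ^ k * f (x + of_int m)) =
    (\<Sum>j\<le>k. of_nat (k choose j) * (- 1) ^ j * (of_int m ^ j * u (\<lambda>x. of_real (x + of_int m) ^ (k - j) * f (x + of_int m))))" for m :: int
  proof -
    note tr = test_function_translate[OF f, of "of_int m"]
    have "u (\<lambda>x. of_real x ^ k * f (x + of_int m)) =
        u (\<lambda>x. (- of_int m + of_real (x + of_int m)) ^ k * f (x + of_int m))" by simp
    also have "\<dots> = (\<Sum>j\<le>k. of_nat (k choose j) *
        u (\<lambda>x. (- of_int m) ^ j * (of_real (x + of_int m) ^ (k - j) * f (x + of_int m))))"
      by (rule distribution_binomial[OF u(1) tr smooth_const smooth_of_real_translate])
    finally show ?thesis
      unfolding distribution_cmult[OF u(1) t] unfolding power_minus[of "of_int _"] mult.assoc .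
  qed
  have "moment_sum u lam k f = (\<Sum>m\<in>{- int N..int N}. exp (lam * of_int m) * u (\<lambda>x. of_real x ^ k * f (x + of_int m)))"
    using N(1)[of lam k 0] by simp
  also have "\<dots> = (\<Sum>m\<in>{- int N..int N}. \<Sum>j\<le>k. of_nat (k choose j) * (- 1) ^ j * (exp (lam * of_int m) * of_int m ^ j *
      u (\<lambda>x. of_real (x + of_int m) ^ (k - j) * f (x + of_int m))))"
    unfolding trm sum_distrib_left by (intro sum.cong refl) (simp only: mult_ac)
  also have "\<dots> = (\<Sum>j\<le>k. of_nat (k choose j) * (- 1) ^ j *
    shift_sum u (\<lambda>l. exp (lam * of_int l) * of_int l ^ j) (\<lambda>t. of_real t ^ (k - j) * f t))"
    unfolding N(2) sum_distrib_left by (rule sum.swap)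
  finally show ?thesis .
qed

lemma moment_sum_finite:
  assumes "distribution u" "compactly_supported u" "f \<in> test_functions"
  shows "\<exists>N0. \<forall>N\<ge>N0. moment_sum u lam k f =
      (\<Sum>m\<in>{- int N..int N}. exp (lam * of_int m) * u (\<lambda>x. of_real x ^ k * f (x + of_int m)))"
proof (rule moment_and_shift_sums_finite[OF assms])
  fix N0 assume A: "\<And>N lam k i. N \<ge> N0 \<Longrightarrow> moment_sum u lam k (\<lambda>t. of_real t ^ i * f t) = (\<Sum>m\<in>{- int N..int N}.
        exp (lam * of_int m) * u (\<lambda>x. of_real x ^ k * (of_real (x + of_int m) ^ i * f (x + of_int m))))"
  show ?thesis
  proof (intro exI allI impI)
    fix N assume "N \<ge> N0"
    from A[OF this, of lam k 0] show "moment_sum u lam k f =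
      (\<Sum>m\<in>{- int N..int N}. exp (lam * of_int m) * u (\<lambda>x. of_real x ^ k * f (x + of_int m)))" by simp
  qed
qed

text \<open>The Fourier expansion of a moment sum. With \<open>F t = exp (lam t) f t\<close> the sum over the
  translates of \<open>f\<close> becomes \<open>exp (- lam x)\<close> times the periodisation of \<open>F\<close>. Poisson summation replaces
  the periodisation, together with all its derivatives, by a Fourier series, through which the
  distribution may be taken.\<close>

lemma moment_sum_has_sum:
  assumes u: "distribution u" "compactly_supported u" and h: "is_cutoff u h" and f: "f \<in> test_functions"
  shows "((\<lambda>l. fcoeff (\<lambda>t. exp (lam * of_real t) * f t) l *
      u (\<lambda>x. h x * (of_real x ^ k * exp ((- lam - 2 * of_real pi * \<i> * of_int l) * of_real x))))
    has_sum moment_sum u lam k f) UNIV"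
proof -
  define F where "F t = exp (lam * of_real t) * f t" for t
  have F: "F \<in> test_functions"
    unfolding F_def by (intro test_function_mult_smooth(2) f smooth_exp)
  note ht = is_cutoff_test[OF h]
  define a where "a x = h x * (of_real x ^ k * exp (- lam * of_real x))" for x
  have a: "a \<in> test_functions"
    unfolding a_def by (intro test_function_mult_smooth(1) ht smooth_mult smooth_power smooth_of_real smooth_exp)
  from moment_sum_finite[OF u f, of lam k] obtain N0 where N0: "\<forall>N\<ge>N0. moment_sum u lam k f =
      (\<Sum>m\<in>{- int N..int N}. exp (lam * of_int m) * u (\<lambda>x. of_real x ^ k * f (x + of_int m)))" ..
  obtain K where K: "\<And>x. \<bar>x\<bar> \<ge> real K \<Longrightarrow> a x = 0" using test_function_bounded_support[OF a] by blast
  obtain M where M: "\<And>x. \<bar>x\<bar> \<ge> real M \<Longrightarrow> F x = 0" using test_function_bounded_support[OF F] by blast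
  \<comment> \<open>Large enough for the moment sum, and for the translates of \<open>F\<close> to be exhausted on the support of \<open>a\<close>.\<close>
  define N where "N = N0 + K + M"
  define B where "B x = (\<Sum>m\<in>{- int N..int N}. F (x + of_int m))" for x
  have Bt: "smooth B"
    unfolding B_def[abs_def] by (intro smooth_sum smooth_translate test_function_smooth F)
  have subK: "fun_support a \<subseteq> {- real K..real K}" by (rule fun_support_minimal) (use K in auto)
  have subM: "fun_support F \<subseteq> {- real M..real M}" by (rule fun_support_minimal) (use M in auto)
  have per: "(\<Sum>\<^sub>\<infinity>m. nth_deriv j F (x + of_int m)) = nth_deriv j B x" if x: "x \<in> fun_support a" for j x
  proof -
    have "(\<Sum>\<^sub>\<infinity>m. nth_deriv j F (x + of_int m)) = (\<Sum>m\<in>{- int N..int N}. nth_deriv j F (x + of_int m))"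
    proof (rule infsum_int_finite)
      fix m :: int assume "\<bar>m\<bar> > int N"
      then have "\<bar>real_of_int m\<bar> > real K + real M" unfolding N_def by linarith
      moreover have "\<bar>x\<bar> \<le> real K" using subsetD[OF subK x] by auto
      ultimately have "x + of_int m \<notin> {- real M..real M}" by auto
      then show "nth_deriv j F (x + of_int m) = 0"
        by (intro test_function_nth_deriv(2)[OF F] contra_subsetD[OF subM])
    qed
    also have "\<dots> = nth_deriv j B x"
      unfolding B_def[abs_def]
      by (subst nth_deriv_sum) (simp_all add: nth_deriv_translate smooth_translate test_function_smooth[OF F])
    finally show ?thesis .
  qed
  have nd: "nth_deriv j (\<lambda>x. fcoeff F l * osc (- l) x) x = fcoeff (nth_deriv j F) l * osc (- l) x" for j l x
    unfolding nth_deriv_cmult[OF smooth_exp] nth_deriv_exp fcoeff_nth_deriv[OF F] by (simp add: mult_ac)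
  have "((\<lambda>l. u (\<lambda>x. a x * (fcoeff F l * osc (- l) x))) has_sum u (\<lambda>x. a x * B x)) UNIV"
  proof (rule distribution_has_sum[OF u(1) a Bt, where M="\<lambda>j l. cmod (fcoeff (nth_deriv j F) l)"])
    show "smooth (\<lambda>x. fcoeff F l * osc (- l) x)" for l by (intro smooth_cmult smooth_exp)
    show "(\<lambda>l. cmod (fcoeff (nth_deriv j F) l)) summable_on UNIV" for j
      by (rule fcoeff_summable[OF test_function_nth_deriv(1)[OF F]])
    show "cmod (nth_deriv j (\<lambda>x. fcoeff F l * osc (- l) x) x) \<le> cmod (fcoeff (nth_deriv j F) l)" for j l x
      unfolding nd by (simp add: norm_mult)
    show "((\<lambda>l. nth_deriv j (\<lambda>x. fcoeff F l * osc (- l) x) x) has_sum nth_deriv j B x) UNIV"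
      if "x \<in> fun_support a" for j x
      unfolding nd per[OF that, symmetric] by (rule poisson_summation[OF test_function_nth_deriv(1)[OF F]])
  qed
  moreover have "u (\<lambda>x. a x * (fcoeff F l * osc (- l) x)) = fcoeff F l *
      u (\<lambda>x. h x * (of_real x ^ k * exp ((- lam - 2 * of_real pi * \<i> * of_int l) * of_real x)))" for l
  proof -
    have e: "exp ((- lam - 2 * of_real pi * \<i> * of_int l) * of_real x) = exp (- lam * of_real x) * osc (- l) x" for x
      unfolding exp_add[symmetric] by (simp add: algebra_simps)
    have "(\<lambda>x. a x * (fcoeff F l * osc (- l) x)) = (\<lambda>x. fcoeff F l * (h x * (of_real x ^ k *
         exp ((- lam - 2 * of_real pi * \<i> * of_int l) * of_real x))))"
      unfolding a_def e by (intro ext) (simp only: mult_ac)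
    moreover have "(\<lambda>x. h x * (of_real x ^ k *
         exp ((- lam - 2 * of_real pi * \<i> * of_int l) * of_real x))) \<in> test_functions"
      by (intro test_function_mult_smooth(1) ht smooth_mult smooth_power smooth_of_real smooth_exp)
    ultimately show ?thesis by (simp only: distribution_cmult[OF u(1)])
  qed
  moreover have "u (\<lambda>x. a x * B x) = moment_sum u lam k f"
  proof -
    have tm: "(\<lambda>x. of_real x ^ k * f (x + of_int m)) \<in> test_functions" for m :: int
      by (rule test_function_moment(2)[OF f])
    have tm': "(\<lambda>x. h x * (of_real x ^ k * f (x + of_int m))) \<in> test_functions" for m :: int
      by (rule test_function_mult_smooth(2)[OF tm test_function_smooth[OF ht]])
    have "(\<lambda>x. a x * B x) = (\<lambda>x. \<Sum>m\<in>{- int N..int N}. exp (lam * of_int m) * (h x * (of_real x ^ k * f (x + of_int m))))"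
    proof
      fix x
      have "exp (- lam * of_real x) * F (x + of_int m) = exp (lam * of_int m) * f (x + of_int m)" for m
        unfolding F_def mult.assoc[symmetric] exp_add[symmetric] by (simp add: algebra_simps)
      then have "a x * F (x + of_int m) = exp (lam * of_int m) * (h x * (of_real x ^ k * f (x + of_int m)))" for m
        unfolding a_def by (metis (no_types, lifting) mult.assoc mult.left_commute)
      then show "a x * B x = (\<Sum>m\<in>{- int N..int N}. exp (lam * of_int m) * (h x * (of_real x ^ k * f (x + of_int m))))"
        unfolding B_def sum_distrib_left by (intro sum.cong refl)
    qed
    then have "u (\<lambda>x. a x * B x) = (\<Sum>m\<in>{- int N..int N}. u (\<lambda>x. exp (lam * of_int m) * (h x * (of_real x ^ k * f (x + of_int m)))))"
      by (simp only:) (rule distribution_sum[OF u(1) test_function_cmult[OF tm']])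
    also have "\<dots> = (\<Sum>m\<in>{- int N..int N}. exp (lam * of_int m) * u (\<lambda>x. of_real x ^ k * f (x + of_int m)))"
      unfolding distribution_cmult[OF u(1) tm'] cutoff_mult_test[OF u(1) h tm] ..
    also have "\<dots> = moment_sum u lam k f"
      using N0[rule_format, of N] by (simp add: N_def)
    finally show ?thesis .
  qed
  ultimately show ?thesis by (simp add: F_def[abs_def])
qed

text \<open>The factor \<open>(- 1 / (2 \<pi> \<i>))^k\<close> in \<open>omega\<close> cancels the one that arises when the Fourier transform
  is differentiated \<open>k\<close> times, which leaves the Fourier coefficients of the moment sum.\<close>

lemma omega_eq:
  assumes u: "distribution u" "compactly_supported u" and h: "is_cutoff u h"
    and dec: "exp_decay (fourier_deriv_seq u lam k)"
  defines "C \<equiv> \<lambda>l. u (\<lambda>x. h x * (of_real x ^ k * exp ((- lam - 2 * of_real pi * \<i> * of_int l) * of_real x)))"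
  shows "((\<lambda>l. C l * osc l t) has_sum omega u lam k t) UNIV" "(\<lambda>l. cmod (C l)) summable_on UNIV"
    "real_analytic (omega u lam k)"
proof -
  let ?a = "- 1 / (2 * of_real pi * \<i>) :: complex"
  have "?a * (- 2 * of_real pi * \<i>) = 1" by (simp add: field_simps)
  then have C: "C l = ?a ^ k * fourier_deriv_seq u lam k l" for l
    unfolding C_def fourier_deriv_seq_eq[OF u h] by (simp flip: mult.assoc power_mult_distrib)
  note fs = exp_decay_fourier_series[OF dec]
  show "((\<lambda>l. C l * osc l t) has_sum omega u lam k t) UNIV"
    using has_sum_cmult_right[OF has_sum_infsum[OF fs(1)], of "?a ^ k"]
    unfolding C omega_def by (simp only: mult.assoc)
  show "(\<lambda>l. cmod (C l)) summable_on UNIV"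
    unfolding C norm_mult by (intro summable_on_cmult_right fs(3))
  show "real_analytic (omega u lam k)"
    unfolding omega_def[abs_def] by (intro real_analytic_mult real_analytic_const fs(2))
qed

text \<open>Under decay the Fourier series of the moment sum converges absolutely and uniformly, so it
  may be integrated against the test function term by term.\<close>

lemma moment_sum_eq_integral:
  assumes u: "distribution u" "compactly_supported u" and dec: "exp_decay (fourier_deriv_seq u lam k)"
    and f: "f \<in> test_functions"
  shows "moment_sum u lam k f = (LINT t|lborel. exp (lam * of_real t) * omega u lam k t * f t)"
proof -
  note h = is_cutoff_cutoff[OF u(2)]
  define C where "C l = u (\<lambda>x. cutoff u x * (of_real x ^ k * exp ((- lam - 2 * of_real pi * \<i> * of_int l) * of_real x)))" for l
  note om = omega_eq[OF u h dec, folded C_def]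
  define F where "F t = exp (lam * of_real t) * f t" for t
  have F: "F \<in> test_functions"
    unfolding F_def by (intro test_function_mult_smooth(2) f smooth_exp)
  have oc: "continuous_on UNIV (omega u lam k)"
    by (intro smooth_imp_continuous_on real_analytic_smooth om(3))
  have "((\<lambda>l. fcoeff F l * C l) has_sum (LINT t|lborel. omega u lam k t * F t)) UNIV"
  proof (rule has_sum_if_dominated[OF om(2)])
    show "0 \<le> (LINT t|lborel. cmod (F t))" by simp
    fix A :: "int set" assume A: "finite A"
    have pc: "continuous_on UNIV (\<lambda>t. \<Sum>l\<in>A. C l * osc l t)" by (intro continuous_intros)
    note i1 = integrable_regular[OF oc F] and i2 = integrable_regular[OF pc F]
    have i: "integrable lborel (\<lambda>t. C l * osc l t * F t)" for l
      by (intro integrable_regular F continuous_intros)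
    have "(\<Sum>l\<in>A. fcoeff F l * C l) = (\<Sum>l\<in>A. LINT t|lborel. C l * osc l t * F t)"
      unfolding fcoeff_def mult.commute[of _ "C _"] integral_mult_right_zero[symmetric]
      by (simp add: mult_ac)
    also have "\<dots> = (LINT t|lborel. (\<Sum>l\<in>A. C l * osc l t) * F t)"
      unfolding sum_distrib_right by (rule Bochner_Integration.integral_sum[symmetric]) (rule i)
    finally have "(LINT t|lborel. omega u lam k t * F t) - (\<Sum>l\<in>A. fcoeff F l * C l)
       = (LINT t|lborel. omega u lam k t * F t) - (LINT t|lborel. (\<Sum>l\<in>A. C l * osc l t) * F t)"
      by (rule arg_cong)
    also have "\<dots> = (LINT t|lborel. omega u lam k t * F t - (\<Sum>l\<in>A. C l * osc l t) * F t)"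
      by (rule Bochner_Integration.integral_diff[OF i1 i2, symmetric])
    finally have eq: "(LINT t|lborel. omega u lam k t * F t) - (\<Sum>l\<in>A. fcoeff F l * C l)
       = (LINT t|lborel. omega u lam k t * F t - (\<Sum>l\<in>A. C l * osc l t) * F t)" .
    define T where "T = (\<Sum>\<^sub>\<infinity>l\<in>- A. cmod (C l))"
    have pt: "cmod (omega u lam k t * F t - (\<Sum>l\<in>A. C l * osc l t) * F t) \<le> T * cmod (F t)" for t
    proof -
      have "cmod (omega u lam k t - (\<Sum>l\<in>A. C l * osc l t)) \<le> T"
        unfolding T_def by (rule norm_has_sum_remainder_le[OF om(1) om(2) _ A]) (simp add: norm_mult)
      then show ?thesis
        unfolding left_diff_distrib[symmetric] norm_mult by (rule mult_right_mono) simp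
    qed
    have "cmod ((LINT t|lborel. omega u lam k t * F t) - (\<Sum>l\<in>A. fcoeff F l * C l))
        \<le> (LINT t|lborel. cmod (omega u lam k t * F t - (\<Sum>l\<in>A. C l * osc l t) * F t))"
      unfolding eq by (rule integral_norm_bound)
    also have "\<dots> \<le> (LINT t|lborel. T * cmod (F t))"
      by (rule integral_mono[OF integrable_norm[OF Bochner_Integration.integrable_diff[OF i1 i2]]
           integrable_mult_right[OF integrable_norm[OF integrable_test_function[OF F]]] pt])
    also have "\<dots> = (LINT t|lborel. cmod (F t)) * T"
      by (simp add: mult.commute)
    finally show "cmod ((LINT t|lborel. omega u lam k t * F t) - (\<Sum>l\<in>A. fcoeff F l * C l))
      \<le> (LINT t|lborel. cmod (F t)) * (\<Sum>\<^sub>\<infinity>l\<in>- A. cmod (C l))" unfolding T_def .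
  qed
  moreover have "((\<lambda>l. fcoeff F l * C l) has_sum moment_sum u lam k f) UNIV"
    using moment_sum_has_sum[OF u h f, of lam k] by (simp only: C_def F_def[abs_def])
  ultimately have "moment_sum u lam k f = (LINT t|lborel. omega u lam k t * F t)"
    using has_sum_unique by blast
  then show ?thesis by (simp add: F_def mult_ac)
qed

lemma exponential_shift_sum_eq_regular:
  assumes u: "distribution u" "compactly_supported u"
    and dec: "\<And>j. j \<le> k \<Longrightarrow> exp_decay (fourier_deriv_seq u lam j)"
  shows "shift_sum u (\<lambda>l. exp (lam * of_int l) * of_int l ^ k) =
          regular_dist (\<lambda>t. exp (lam * of_real t) *
            (\<Sum>j\<le>k. of_nat (k choose j) * of_real t ^ (k - j) * (- 1) ^ j * omega u lam j t))"
proof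
  fix f
  show "shift_sum u (\<lambda>l. exp (lam * of_int l) * of_int l ^ k) f =
          regular_dist (\<lambda>t. exp (lam * of_real t) *
            (\<Sum>j\<le>k. of_nat (k choose j) * of_real t ^ (k - j) * (- 1) ^ j * omega u lam j t)) f"
  proof (cases "f \<in> test_functions")
    case f: True
    note h = is_cutoff_cutoff[OF u(2)]
    have oc: "continuous_on UNIV (omega u lam j)" if "j \<le> k" for j
      by (intro smooth_imp_continuous_on real_analytic_smooth omega_eq(3)[OF u h dec[OF that]])
    have fi: "(\<lambda>t. of_real t ^ i * f t) \<in> test_functions" for i by (rule test_function_moment(1)[OF f])
    have "shift_sum u (\<lambda>l. exp (lam * of_int l) * of_int l ^ k) f
       = (\<Sum>j\<le>k. LINT t|lborel. of_nat (k choose j) * (- 1) ^ j * (exp (lam * of_real t) * omega u lam j t * (of_real t ^ (k - j) * f t)))"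
      unfolding shift_sum_eq_moment_sums[OF u f]
      by (intro sum.cong refl) (simp add: moment_sum_eq_integral[OF u dec fi])
    also have "\<dots> = (LINT t|lborel. (\<Sum>j\<le>k. of_nat (k choose j) * (- 1) ^ j * (exp (lam * of_real t) * omega u lam j t * (of_real t ^ (k - j) * f t))))"
      by (intro Bochner_Integration.integral_sum[symmetric] integrable_mult_right integrable_regular fi continuous_intros oc) simp
    also have "\<dots> = (LINT t|lborel. exp (lam * of_real t) *
            (\<Sum>j\<le>k. of_nat (k choose j) * of_real t ^ (k - j) * (- 1) ^ j * omega u lam j t) * f t)"
      unfolding sum_distrib_left sum_distrib_right by (simp add: mult_ac)
    finally show ?thesis using f by (simp add: regular_dist_def)
  qed (simp add: shift_sum_outside[OF u(1)] regular_dist_def)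
qed

section \<open>Linear structure of the shift-invariant space\<close>

lemma shift_sum_lincomb:
  assumes u: "distribution u" "compactly_supported u"
  shows "shift_sum u (\<lambda>l. \<Sum>i\<in>A. a i * c i l) = (\<lambda>f. \<Sum>i\<in>A. a i * shift_sum u (c i) f)"
proof
  fix f
  show "shift_sum u (\<lambda>l. \<Sum>i\<in>A. a i * c i l) f = (\<Sum>i\<in>A. a i * shift_sum u (c i) f)"
  proof (cases "f \<in> test_functions")
    case True
    obtain N where N: "\<And>c. shift_sum u c f = (\<Sum>l\<in>{- int N..int N}. c l * u (\<lambda>x. f (x + of_int l)))"
      by (rule shift_sum_finite[OF u True]) (meson order_refl)
    have "(\<Sum>l\<in>{- int N..int N}. (\<Sum>i\<in>A. a i * c i l) * u (\<lambda>x. f (x + of_int l)))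
        = (\<Sum>i\<in>A. \<Sum>l\<in>{- int N..int N}. a i * (c i l * u (\<lambda>x. f (x + of_int l))))"
      unfolding sum_distrib_right by (subst sum.swap) (simp only: mult.assoc)
    then show ?thesis unfolding N by (simp only: sum_distrib_left)
  qed (simp add: shift_sum_outside[OF u(1)])
qed

lemma shift_sum_add:
  assumes u: "distribution u" "compactly_supported u"
  shows "shift_sum u (\<lambda>l. c l + c' l) = (\<lambda>f. shift_sum u c f + shift_sum u c' f)"
  using shift_sum_lincomb[OF u, where A=UNIV and a="\<lambda>b::bool. 1" and c="\<lambda>b. if b then c else c'"]
  by (simp add: UNIV_bool add.commute)

lemma shift_sum_cmult:
  assumes u: "distribution u" "compactly_supported u"
  shows "shift_sum u (\<lambda>l. a * c l) = (\<lambda>f. a * shift_sum u c f)"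
  using shift_sum_lincomb[OF u, where A="{()}" and a="\<lambda>_. a" and c="\<lambda>_. c"] by simp

lemma shifts_independentD: "shifts_independent u \<Longrightarrow> shift_sum u c = (\<lambda>f. 0) \<Longrightarrow> c l = 0"
  by (simp add: shifts_independent_def)

lemma shift_sum_inject:
  assumes u: "distribution u" "compactly_supported u" "shifts_independent u"
    and eq: "shift_sum u c = shift_sum u c'"
  shows "c l = c' l"
proof -
  have "shift_sum u (\<lambda>l. c l + (- 1) * c' l) = (\<lambda>f. 0)"
    unfolding shift_sum_add[OF u(1,2)] shift_sum_cmult[OF u(1,2)] eq by simp
  from shifts_independentD[OF u(3) this, of l] show ?thesis by simp
qed

lemma regular_dist_lincomb:
  assumes "\<And>i. i \<in> A \<Longrightarrow> continuous_on UNIV (g i)"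
  shows "regular_dist (\<lambda>t. \<Sum>i\<in>A. a i * g i t) = (\<lambda>f. \<Sum>i\<in>A. a i * regular_dist (g i) f)"
proof
  fix f
  show "regular_dist (\<lambda>t. \<Sum>i\<in>A. a i * g i t) f = (\<Sum>i\<in>A. a i * regular_dist (g i) f)"
  proof (cases "f \<in> test_functions")
    case True
    have "(LINT t|lborel. (\<Sum>i\<in>A. a i * g i t) * f t) = (LINT t|lborel. (\<Sum>i\<in>A. a i * (g i t * f t)))"
      by (simp add: sum_distrib_right mult.assoc)
    also have "\<dots> = (\<Sum>i\<in>A. LINT t|lborel. a i * (g i t * f t))"
      by (intro Bochner_Integration.integral_sum integrable_mult_right integrable_regular assms True)
    finally show ?thesis using True by (simp add: regular_dist_def)
  qed (simp add: regular_dist_def)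
qed

lemma sum_scale_functional:
  "(\<Sum>i\<in>A. scale_functional (a i) (g i)) = (\<lambda>f. \<Sum>i\<in>A. a i * g i f)"
  by (induction A rule: infinite_finite_induct)
     (simp_all add: scale_functional_def plus_fun_def zero_fun_def fun_eq_iff)

section \<open>Exponential polynomials in the shift-invariant space\<close>

lemma poly_eq_sum_atMost:
  fixes p :: "'a::comm_semiring_1 poly"
  assumes "degree p \<le> d" shows "poly p x = (\<Sum>k\<le>d. coeff p k * x ^ k)"
  unfolding poly_altdef
  by (rule sum.mono_neutral_left) (use assms in \<open>auto simp: coeff_eq_0\<close>)

lemma poly_with_coeffs:
  fixes a :: "nat \<Rightarrow> complex"
  obtains p where "degree p \<le> d" "\<And>k. k \<le> d \<Longrightarrow> coeff p k = a k"
proof (rule that[of "\<Sum>k\<le>d. monom (a k) k"])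
  show "degree (\<Sum>k\<le>d. monom (a k) k) \<le> d"
    by (rule degree_sum_le) (auto intro: order_trans[OF degree_monom_le])
  show "coeff (\<Sum>k\<le>d. monom (a k) k) j = a j" if "j \<le> d" for j
    using that by (simp add: coeff_sum)
qed

lemma poly_eq_0_if_vanishes_on_ints:
  fixes p :: "complex poly"
  assumes "\<And>l::int. poly p (of_int l) = 0" shows "p = 0"
proof (rule ccontr)
  assume "p \<noteq> 0"
  then have "finite {z. poly p z = 0}" by (rule poly_roots_finite)
  then have "finite (range (of_int :: int \<Rightarrow> complex))"
    by (rule finite_subset[rotated]) (use assms in auto)
  then show False by (simp add: finite_image_iff inj_on_def infinite_UNIV_int)
qed

abbreviation exp_moment :: "functional \<Rightarrow> complex \<Rightarrow> nat \<Rightarrow> functional" where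
  "exp_moment u lam k \<equiv> shift_sum u (\<lambda>l. exp (lam * of_int l) * of_int l ^ k)"

text \<open>Coefficients of a polynomial of degree at most \<open>d\<close> and coefficients of a linear combination of
  the spanning functionals are the same thing.\<close>

lemma H_space_eq_lincomb:
  assumes u: "distribution u" "compactly_supported u"
  shows "H_space u lam d = range (\<lambda>a. \<Sum>k\<le>d. scale_functional (a k) (exp_moment u lam k))"
proof -
  have eq: "shift_sum u (\<lambda>l. exp (lam * of_int l) * poly p (of_int l)) =
      (\<Sum>k\<le>d. scale_functional (coeff p k) (exp_moment u lam k))" if "degree p \<le> d" for p
  proof -
    have "(\<lambda>l. exp (lam * of_int l) * poly p (of_int l)) =
        (\<lambda>l. \<Sum>k\<le>d. coeff p k * (exp (lam * of_int l) * of_int l ^ k))"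
      unfolding poly_eq_sum_atMost[OF that] sum_distrib_left by (simp only: mult_ac)
    then show ?thesis by (simp only: shift_sum_lincomb[OF u] sum_scale_functional)
  qed
  show ?thesis
  proof (intro equalityI subsetI)
    fix v assume "v \<in> H_space u lam d"
    then obtain p where "degree p \<le> d" "v = shift_sum u (\<lambda>l. exp (lam * of_int l) * poly p (of_int l))"
      unfolding H_space_def by blast
    then show "v \<in> range (\<lambda>a. \<Sum>k\<le>d. scale_functional (a k) (exp_moment u lam k))"
      by (auto simp only: eq)
  next
    fix v assume "v \<in> range (\<lambda>a. \<Sum>k\<le>d. scale_functional (a k) (exp_moment u lam k))"
    then obtain a where v: "v = (\<Sum>k\<le>d. scale_functional (a k) (exp_moment u lam k))" ..
    obtain p where p: "degree p \<le> d" "\<And>k. k \<le> d \<Longrightarrow> coeff p k = a k" using poly_with_coeffs by blast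
    have "v = shift_sum u (\<lambda>l. exp (lam * of_int l) * poly p (of_int l))"
      unfolding eq[OF p(1)] v by (intro sum.cong refl) (simp add: p(2))
    with p(1) show "v \<in> H_space u lam d" unfolding H_space_def by blast
  qed
qed

text \<open>Independence of the shifts turns a linear relation into a polynomial that vanishes at all
  integers.\<close>

lemma exp_moments_lincomb_eq_0:
  assumes u: "distribution u" "compactly_supported u" "shifts_independent u"
    and z: "(\<Sum>k\<le>d. scale_functional (a k) (exp_moment u lam k)) = 0" and k: "k \<le> d"
  shows "a k = 0"
proof -
  obtain p where p: "degree p \<le> d" "\<And>k. k \<le> d \<Longrightarrow> coeff p k = a k" using poly_with_coeffs by blast
  have "shift_sum u (\<lambda>l. \<Sum>k\<le>d. a k * (exp (lam * of_int l) * of_int l ^ k)) = (\<lambda>f. 0)"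
    using z unfolding shift_sum_lincomb[OF u(1,2)] sum_scale_functional zero_fun_def .
  then have "(\<Sum>k\<le>d. a k * (exp (lam * of_int l) * of_int l ^ k)) = 0" for l
    by (rule shifts_independentD[OF u(3)])
  moreover have "(\<Sum>k\<le>d. a k * (exp (lam * of_int l) * of_int l ^ k)) = exp (lam * of_int l) * poly p (of_int l)" for l
    unfolding poly_eq_sum_atMost[OF p(1)] sum_distrib_left by (intro sum.cong refl) (simp add: p(2) mult_ac)
  ultimately have "poly p (of_int l) = 0" for l :: int by simp
  then have "p = 0" by (rule poly_eq_0_if_vanishes_on_ints)
  then show ?thesis using p(2)[OF k] by simp
qed

lemma inj_exp_moment:
  assumes u: "distribution u" "compactly_supported u" "shifts_independent u"
  shows "inj_on (exp_moment u lam) A"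
proof (rule inj_onI)
  fix j k assume "exp_moment u lam j = exp_moment u lam k"
  from shift_sum_inject[OF u this, of 2] have "(2::complex) ^ j = 2 ^ k" by simp
  then have "of_nat (2 ^ j) = (of_nat (2 ^ k) :: complex)" by simp
  then show "j = k" unfolding of_nat_eq_iff by simp
qed

lemma subspace_H_space:
  assumes u: "distribution u" "compactly_supported u"
  shows "functional.subspace (H_space u lam d)"
  unfolding functional.subspace_def
proof (intro conjI ballI allI)
  show "0 \<in> H_space u lam d"
    unfolding H_space_eq_lincomb[OF u] by (rule range_eqI[of _ _ "\<lambda>_. 0"]) simp
  fix v w assume "v \<in> H_space u lam d" "w \<in> H_space u lam d"
  then obtain a b where "v = (\<Sum>k\<le>d. scale_functional (a k) (exp_moment u lam k))"
    "w = (\<Sum>k\<le>d. scale_functional (b k) (exp_moment u lam k))"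
    unfolding H_space_eq_lincomb[OF u] by blast
  then show "v + w \<in> H_space u lam d"
    unfolding H_space_eq_lincomb[OF u]
    by (intro range_eqI[of _ _ "\<lambda>k. a k + b k"]) (simp add: functional.scale_left_distrib sum.distrib)
next
  fix c v assume "v \<in> H_space u lam d"
  then obtain a where "v = (\<Sum>k\<le>d. scale_functional (a k) (exp_moment u lam k))"
    unfolding H_space_eq_lincomb[OF u] by blast
  then show "scale_functional c v \<in> H_space u lam d"
    unfolding H_space_eq_lincomb[OF u]
    by (intro range_eqI[of _ _ "\<lambda>k. c * a k"]) (simp add: functional.scale_sum_right)
qed

lemma H_space_eq_span:
  assumes u: "distribution u" "compactly_supported u"
  shows "H_space u lam d = functional.span (exp_moment u lam ` {..d})"
proof (intro equalityI)
  show "H_space u lam d \<subseteq> functional.span (exp_moment u lam ` {..d})"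
    unfolding H_space_eq_lincomb[OF u]
    by (rule image_subsetI, intro functional.span_sum functional.span_scale functional.span_base imageI)
  have "exp_moment u lam k \<in> H_space u lam d" if "k \<le> d" for k
  proof -
    have "exp_moment u lam k = (\<Sum>j\<le>d. scale_functional (if j = k then 1 else 0) (exp_moment u lam j))"
      using that unfolding sum_scale_functional by (simp add: if_distrib[of "\<lambda>x. x * _"] cong: if_cong)
    then show ?thesis unfolding H_space_eq_lincomb[OF u] by (rule range_eqI[of _ _ "\<lambda>j. if j = k then 1 else 0"])
  qed
  then show "functional.span (exp_moment u lam ` {..d}) \<subseteq> H_space u lam d"
    by (intro functional.span_minimal subspace_H_space[OF u]) auto
qed

lemma dim_H_space:
  assumes u: "distribution u" "compactly_supported u" "shifts_independent u"
  shows "functional.dim (H_space u lam d) = d + 1"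
proof -
  note inj = inj_exp_moment[OF u, of lam "{..d}"]
  have "functional.independent (exp_moment u lam ` {..d})"
  proof
    assume "functional.dependent (exp_moment u lam ` {..d})"
    then obtain w where w: "\<exists>v\<in>exp_moment u lam ` {..d}. w v \<noteq> 0"
      "(\<Sum>v\<in>exp_moment u lam ` {..d}. scale_functional (w v) v) = 0"
      using functional.dependent_finite[of "exp_moment u lam ` {..d}"] by auto
    have "(\<Sum>k\<le>d. scale_functional (w (exp_moment u lam k)) (exp_moment u lam k)) = 0"
      using w(2) by (simp add: sum.reindex[OF inj])
    from exp_moments_lincomb_eq_0[OF u this] w(1) show False by auto
  qed
  then show ?thesis
    unfolding H_space_eq_span[OF u(1,2)]
    by (simp add: functional.dim_eq_card_independent card_image[OF inj])
qed

text \<open>The implication from decay to analyticity: the spanning functionals are the analytic functions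
  computed above, and linear algebra carries this over to their span.\<close>

lemma analytic_shift_sums_if_decay:
  assumes u: "distribution u" "compactly_supported u" "shifts_independent u"
    and dec: "\<forall>k\<le>d. exp_decay (fourier_deriv_seq u lam k)"
  shows "H_space u lam d \<subseteq> shift_invariant_space u \<and>
        functional.subspace (H_space u lam d) \<and>
        functional.dim (H_space u lam d) = d + 1 \<and>
        (\<forall>v\<in>H_space u lam d. \<exists>g. real_analytic g \<and> v = regular_dist g) \<and>
        H_space u lam d =
          functional.span ((\<lambda>k. shift_sum u (\<lambda>l. exp (lam * of_int l) * of_int l ^ k)) ` {..d}) \<and>
        (\<forall>k\<le>d. shift_sum u (\<lambda>l. exp (lam * of_int l) * of_int l ^ k) =
          regular_dist (\<lambda>t. exp (lam * of_real t) *
            (\<Sum>j\<le>k. of_nat (k choose j) * of_real t ^ (k - j) * (- 1) ^ j * omega u lam j t))) \<and>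
        (\<forall>k\<le>d. (\<forall>t::real. (\<lambda>l. fourier_deriv_seq u lam k l *
              exp (2 * of_real pi * \<i> * of_int l * of_real t)) summable_on UNIV) \<and>
            (\<forall>t. omega u lam k (t + 1) = omega u lam k t) \<and>
            real_analytic (omega u lam k))"
proof -
  note h = is_cutoff_cutoff[OF u(2)]
  define g where "g k t = exp (lam * of_real t) *
            (\<Sum>j\<le>k. of_nat (k choose j) * of_real t ^ (k - j) * (- 1) ^ j * omega u lam j t)" for k and t :: real
  have reg: "exp_moment u lam k = regular_dist (g k)" if "k \<le> d" for k
    unfolding g_def[abs_def] by (rule exponential_shift_sum_eq_regular[OF u(1,2)]) (use dec that in auto)
  have om: "real_analytic (omega u lam k)" if "k \<le> d" for k
    using omega_eq(3)[OF u(1,2) h] dec that by blast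
  have ga: "real_analytic (g k)" if "k \<le> d" for k
    unfolding g_def[abs_def]
    by (intro real_analytic_mult real_analytic_sum om real_analytic_const
          real_analytic_holomorphic[of "\<lambda>z. exp (lam * z)"] real_analytic_holomorphic[of "\<lambda>z. z ^ _"] holomorphic_intros)
       (use that in auto)
  have "\<exists>G. real_analytic G \<and> v = regular_dist G" if v: "v \<in> H_space u lam d" for v
  proof -
    obtain a where a: "v = (\<Sum>k\<le>d. scale_functional (a k) (exp_moment u lam k))"
      using v unfolding H_space_eq_lincomb[OF u(1,2)] by blast
    have "v = regular_dist (\<lambda>t. \<Sum>k\<le>d. a k * g k t)"
      unfolding a sum_scale_functional
      by (subst regular_dist_lincomb) (auto intro: smooth_imp_continuous_on real_analytic_smooth ga simp: reg)
    moreover have "real_analytic (\<lambda>t. \<Sum>k\<le>d. a k * g k t)"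
      by (intro real_analytic_sum real_analytic_mult real_analytic_const ga) auto
    ultimately show ?thesis by blast
  qed
  moreover have "H_space u lam d \<subseteq> shift_invariant_space u"
    unfolding H_space_def shift_invariant_space_def by auto
  moreover have "omega u lam k (t + 1) = omega u lam k t" for k t
    using osc_periodic[of _ t 1] unfolding omega_def by simp
  ultimately show ?thesis
    using subspace_H_space[OF u(1,2), of lam d] dim_H_space[OF u, of lam d] H_space_eq_span[OF u(1,2), of lam d]
      reg om exp_decay_fourier_series(1)[of "fourier_deriv_seq u lam _"] dec
    unfolding g_def by (intro conjI allI impI ballI) blast+
qed

section \<open>Forward differences and Newton series\<close>

definition fdiff :: "('a::{plus,one} \<Rightarrow> complex) \<Rightarrow> 'a \<Rightarrow> complex" where
  "fdiff f x = f (x + 1) - f x"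

text \<open>A sequence on the integers is determined by its differences and one value.\<close>

lemma eq_if_fdiff_eq:
  fixes a b :: "int \<Rightarrow> complex"
  assumes "\<And>l. fdiff a l = fdiff b l" "a 0 = b 0"
  shows "a l = b l"
proof (induction l rule: int_induct[where k=0])
  case (step1 i)
  then show ?case using assms(1)[of i] by (simp add: fdiff_def)
next
  case (step2 i)
  then show ?case using assms(1)[of "i - 1"] by (simp add: fdiff_def)
qed (rule assms)

lemma newton_series:
  fixes a :: "int \<Rightarrow> complex"
  assumes "(fdiff ^^ n) a = (\<lambda>l. 0)"
  shows "a l = (\<Sum>i<n. (fdiff ^^ i) a 0 * (of_int l gchoose i))"
  using assms
proof (induction n arbitrary: a l)
  case (Suc n)
  let ?b = "\<lambda>l. \<Sum>i<Suc n. (fdiff ^^ i) a 0 * (of_int l gchoose i)"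
  have eq: "(fdiff ^^ i) (fdiff a) = (fdiff ^^ Suc i) a" for i
    unfolding funpow_Suc_right o_apply ..
  have "(fdiff ^^ n) (fdiff a) = (\<lambda>l. 0)" unfolding eq by (rule Suc.prems)
  from Suc.IH[OF this] have IH: "fdiff a l = (\<Sum>i<n. (fdiff ^^ Suc i) a 0 * (of_int l gchoose i))" for l
    unfolding eq .
  show ?case
  proof (rule eq_if_fdiff_eq[where b="?b"])
    show "a 0 = ?b 0" by (subst sum.lessThan_Suc_shift) simp
    fix l
    have "fdiff ?b l = (\<Sum>i<Suc n. (fdiff ^^ i) a 0 * ((of_int l + 1 gchoose i) - (of_int l gchoose i)))"
      by (simp add: fdiff_def sum_subtractf right_diff_distrib)
    also have "\<dots> = (\<Sum>i<n. (fdiff ^^ Suc i) a 0 * (of_int l gchoose i))"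
      by (subst sum.lessThan_Suc_shift) (simp add: gbinomial_Suc_Suc)
    finally show "fdiff a l = fdiff ?b l" unfolding IH ..
  qed
qed simp

text \<open>Newton's basis of the polynomials.\<close>

lemma gbinomial_poly: "\<exists>q :: complex poly. degree q \<le> i \<and> (\<forall>x. poly q x = x gchoose i)"
proof (induction i)
    case 0
    show ?case by (rule exI[of _ 1]) simp
  next
    case (Suc i)
    then obtain q :: "complex poly" where q: "degree q \<le> i" "\<And>x. poly q x = x gchoose i" by blast
    let ?q = "smult (1 / of_nat (Suc i)) ([:- of_nat i, 1:] * q)"
    have "degree ?q \<le> degree ([:- of_nat i, 1:] * q)" by (rule degree_smult_le)
    also have "\<dots> \<le> 1 + i" using degree_mult_le[of "[:- of_nat i, 1:]" q] q(1) by simp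
    finally have "degree ?q \<le> Suc i" by simp
    moreover have "poly ?q x = x gchoose Suc i" for x
    proof -
      have "of_nat (Suc i) * (x gchoose Suc i) = (x - of_nat i) * (x gchoose i)"
        using gbinomial_mult_1[of x i] by (simp add: algebra_simps)
      then show ?thesis by (simp add: q(2) field_simps del: of_nat_Suc)
    qed
    ultimately show ?case by (intro exI[of _ ?q] conjI allI)
qed

text \<open>The forward difference on the level of polynomials, where degrees can be tracked.\<close>

definition pdiff :: "complex poly \<Rightarrow> complex poly" where
  "pdiff p = pcompose p [:1, 1:] - p"

lemma poly_pdiff: "poly (pdiff p) x = poly p (x + 1) - poly p x"
  by (simp add: pdiff_def poly_pcompose add.commute)

lemma degree_pdiff: "degree (pdiff p) \<le> degree p - 1"
proof (cases "degree p = 0")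
  case True
  then show ?thesis by (auto simp: pdiff_def elim!: degree_eq_zeroE)
next
  case False
  have d: "degree (pcompose p [:1, 1:]) = degree p" by (simp add: degree_pcompose)
  have "lead_coeff (pcompose p [:1, 1:]) = lead_coeff p" by (subst lead_coeff_comp) auto
  then have "coeff (pdiff p) (degree p) = 0" unfolding pdiff_def using d by simp
  moreover have "degree (pdiff p) \<le> degree p" unfolding pdiff_def using d by (intro degree_diff_le) auto
  ultimately have "degree (pdiff p) < degree p"
    using False by (metis coeff_eq_0 eq_zero_or_degree_less le_neq_implies_less leading_coeff_0_iff degree_0 neq0_conv)
  then show ?thesis by simp
qed

lemma pdiff_0: "pdiff 0 = 0"
  by (simp add: pdiff_def)

lemma degree_pdiff_iter: "degree ((pdiff ^^ n) p) \<le> degree p - n"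
proof (induction n)
  case (Suc n)
  then show ?case using degree_pdiff[of "(pdiff ^^ n) p"] by simp
qed simp

lemma pdiff_iter_eq_0: "n > degree p \<Longrightarrow> (pdiff ^^ n) p = 0"
proof (induction n)
  case (Suc n)
  show ?case
  proof (cases "n > degree p")
    case True
    then show ?thesis using Suc.IH by (simp add: pdiff_0)
  next
    case False
    then have "degree ((pdiff ^^ n) p) = 0" using degree_pdiff_iter[of n p] Suc.prems by simp
    then obtain c where c: "(pdiff ^^ n) p = [:c:]" by (rule degree_eq_zeroE)
    have "(pdiff ^^ Suc n) p = pdiff [:c:]" using c by simp
    also have "\<dots> = 0" by (simp add: pdiff_def)
    finally show ?thesis .
  qed
qed simp

lemma fdiff_iter_poly: "(fdiff ^^ n) (\<lambda>l::int. poly p (of_int l)) = (\<lambda>l. poly ((pdiff ^^ n) p) (of_int l))"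
  by (induction n) (auto simp: fdiff_def poly_pdiff fun_eq_iff)

text \<open>If the \<open>n\<close>-th difference vanishes, the Newton series of \<open>p\<close> on the integers stops before
  degree \<open>n\<close>, and a polynomial is determined by its values on the integers.\<close>

lemma degree_less_if_pdiff_iter_eq_0:
  assumes "(pdiff ^^ n) p = 0" "p \<noteq> 0"
  shows "degree p < n"
proof -
  have "n \<noteq> 0" using assms by (intro notI) simp
  obtain q :: "nat \<Rightarrow> complex poly" where "\<forall>i. degree (q i) \<le> i \<and> (\<forall>x. poly (q i) x = x gchoose i)"
    using choice[OF allI[OF gbinomial_poly]] ..
  then have q: "\<And>i. degree (q i) \<le> i" "\<And>i x. poly (q i) x = x gchoose i" by simp_all
  let ?a = "\<lambda>l::int. poly p (of_int l)"
  let ?r = "\<Sum>i<n. smult ((fdiff ^^ i) ?a 0) (q i)"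
  have "(fdiff ^^ n) ?a = (\<lambda>l. 0)" unfolding fdiff_iter_poly assms(1) by simp
  note nw = newton_series[OF this]
  have "poly (p - ?r) (of_int l) = 0" for l :: int
  proof -
    have "poly (p - ?r) (of_int l) = poly p (of_int l) - (\<Sum>i<n. (fdiff ^^ i) ?a 0 * (of_int l gchoose i))"
      by (simp add: poly_sum q(2))
    also have "\<dots> = 0" unfolding right_minus_eq by (rule nw)
    finally show ?thesis .
  qed
  then have "p - ?r = 0" by (rule poly_eq_0_if_vanishes_on_ints)
  then have p: "p = ?r" by simp
  have "degree ?r \<le> n - 1"
  proof (rule degree_sum_le)
    fix i assume "i \<in> {..<n}"
    then show "degree (smult ((fdiff ^^ i) ?a 0) (q i)) \<le> n - 1"
      using degree_smult_le[of "(fdiff ^^ i) ?a 0" "q i"] q(1)[of i] by auto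
  qed simp
  with p \<open>n \<noteq> 0\<close> show ?thesis by (metis Suc_pred' less_Suc_eq_le neq0_conv)
qed

text \<open>Differences with step one treat functions of period one as constants.\<close>

lemma fdiff_iter_poly_periodic:
  assumes "\<And>k t. k \<le> d \<Longrightarrow> \<omega> k (t + 1) = \<omega> k t"
  shows "(fdiff ^^ n) (\<lambda>t::real. \<Sum>k\<le>d. poly (p k) (of_real t) * \<omega> k t)
       = (\<lambda>t. \<Sum>k\<le>d. poly ((pdiff ^^ n) (p k)) (of_real t) * \<omega> k t)"
proof (induction n)
  case (Suc n)
  show ?case
  proof
    fix t :: real
    have "(fdiff ^^ Suc n) (\<lambda>t::real. \<Sum>k\<le>d. poly (p k) (of_real t) * \<omega> k t) t
      = (\<Sum>k\<le>d. poly ((pdiff ^^ n) (p k)) (of_real (t + 1)) * \<omega> k (t + 1))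
      - (\<Sum>k\<le>d. poly ((pdiff ^^ n) (p k)) (of_real t) * \<omega> k t)"
      unfolding funpow.simps(2) o_apply Suc by (simp only: fdiff_def)
    also have "\<dots> = (\<Sum>k\<le>d. poly ((pdiff ^^ n) (p k)) (of_real (t + 1)) * \<omega> k t
       - poly ((pdiff ^^ n) (p k)) (of_real t) * \<omega> k t)"
      unfolding sum_subtractf by (intro arg_cong2[of _ _ _ _ "(-)"] sum.cong refl) (simp add: assms)
    also have "\<dots> = (\<Sum>k\<le>d. poly ((pdiff ^^ Suc n) (p k)) (of_real t) * \<omega> k t)"
      by (simp add: poly_pdiff left_diff_distrib)
    finally show "(fdiff ^^ Suc n) (\<lambda>t::real. \<Sum>k\<le>d. poly (p k) (of_real t) * \<omega> k t) t
      = (\<Sum>k\<le>d. poly ((pdiff ^^ Suc n) (p k)) (of_real t) * \<omega> k t)" .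
  qed
qed simp

section \<open>Analytic functions represented by weighted shift sums\<close>

text \<open>After division by the exponential on both sides, forward differences act in the same way on
  the coefficient sequence \<open>a\<close> and on the function \<open>G\<close>.\<close>

definition represents :: "functional \<Rightarrow> complex \<Rightarrow> (int \<Rightarrow> complex) \<Rightarrow> (real \<Rightarrow> complex) \<Rightarrow> bool" where
  "represents u lam a G \<longleftrightarrow> real_analytic G \<and>
     shift_sum u (\<lambda>l. exp (lam * of_int l) * a l) = regular_dist (\<lambda>t. exp (lam * of_real t) * G t)"

lemma continuous_on_exp_times:
  "real_analytic G \<Longrightarrow> continuous_on UNIV (\<lambda>t. exp (lam * of_real t) * G t)"
  by (intro continuous_intros smooth_imp_continuous_on real_analytic_smooth)

lemma represents_sum:
  assumes u: "distribution u" "compactly_supported u"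
    and r: "\<And>i. i \<in> A \<Longrightarrow> represents u lam (a i) (G i)"
  shows "represents u lam (\<lambda>l. \<Sum>i\<in>A. c i * a i l) (\<lambda>t. \<Sum>i\<in>A. c i * G i t)"
  unfolding represents_def
proof
  show "real_analytic (\<lambda>t. \<Sum>i\<in>A. c i * G i t)"
    using r unfolding represents_def by (intro real_analytic_sum real_analytic_mult real_analytic_const) blast
  have "shift_sum u (\<lambda>l. \<Sum>i\<in>A. c i * (exp (lam * of_int l) * a i l))
      = regular_dist (\<lambda>t. \<Sum>i\<in>A. c i * (exp (lam * of_real t) * G i t))"
    using r unfolding represents_def
    by (subst shift_sum_lincomb[OF u], subst regular_dist_lincomb) (auto intro: continuous_on_exp_times)
  then show "shift_sum u (\<lambda>l. exp (lam * of_int l) * (\<Sum>i\<in>A. c i * a i l)) =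
    regular_dist (\<lambda>t. exp (lam * of_real t) * (\<Sum>i\<in>A. c i * G i t))"
    unfolding sum_distrib_left by (simp only: mult.left_commute)
qed

lemma represents_add:
  assumes "distribution u" "compactly_supported u" "represents u lam a G" "represents u lam b H"
  shows "represents u lam (\<lambda>l. c * a l + c' * b l) (\<lambda>t. c * G t + c' * H t)"
  using represents_sum[OF assms(1,2), of UNIV lam "\<lambda>i::bool. if i then a else b" "\<lambda>i. if i then G else H"
      "\<lambda>i. if i then c else c'"] assms(3,4)
  by (simp add: UNIV_bool add.commute)

text \<open>Translating the argument of \<open>G\<close> shifts the index of \<open>a\<close>. On the test function it is a
  translation in the opposite direction, and the factor \<open>exp (- lam)\<close> appears on both sides.\<close>

lemma represents_translate:
  assumes u: "distribution u" "compactly_supported u" and r: "represents u lam a G"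
  shows "represents u lam (\<lambda>l. a (l + 1)) (\<lambda>t. G (t + 1))"
  unfolding represents_def
proof
  have G: "real_analytic G" using r by (simp add: represents_def)
  show "real_analytic (\<lambda>t. G (t + 1))" by (rule real_analytic_translate[OF G])
  show "shift_sum u (\<lambda>l. exp (lam * of_int l) * a (l + 1)) = regular_dist (\<lambda>t. exp (lam * of_real t) * G (t + 1))"
  proof
    fix f
    show "shift_sum u (\<lambda>l. exp (lam * of_int l) * a (l + 1)) f = regular_dist (\<lambda>t. exp (lam * of_real t) * G (t + 1)) f"
    proof (cases "f \<in> test_functions")
      case f: True
      define g where "g x = f (x + (- 1))" for x
      have g: "g \<in> test_functions" unfolding g_def by (rule test_function_translate[OF f])
      have "shift_sum u (\<lambda>l. exp (lam * of_int l) * a (l + 1)) f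
          = (\<Sum>\<^sub>\<infinity>l. exp (lam * of_int (l - 1)) * a l * u (\<lambda>x. f (x + of_int (l - 1))))"
        unfolding shift_sum_def translate_def
        using infsum_reindex_bij_betw[of "\<lambda>l. l + 1" UNIV UNIV
            "\<lambda>l. exp (lam * of_int (l - 1)) * a l * u (\<lambda>x. f (x + of_int (l - 1)))"]
          bij_betwI[of "\<lambda>l::int. l + 1" UNIV UNIV "\<lambda>l. l - 1"] by simp
      also have "\<dots> = (\<Sum>\<^sub>\<infinity>l. exp (- lam) * (exp (lam * of_int l) * a l * u (\<lambda>x. g (x + of_int l))))"
      proof (rule infsum_cong)
        fix l :: int
        have "exp (lam * of_int (l - 1)) = exp (- lam) * exp (lam * of_int l)"
          unfolding exp_add[symmetric] by (simp add: algebra_simps)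
        moreover have "(\<lambda>x. f (x + of_int (l - 1))) = (\<lambda>x. g (x + of_int l))"
          by (simp add: g_def algebra_simps)
        ultimately show "exp (lam * of_int (l - 1)) * a l * u (\<lambda>x. f (x + of_int (l - 1)))
          = exp (- lam) * (exp (lam * of_int l) * a l * u (\<lambda>x. g (x + of_int l)))"
          by (simp only: mult.assoc)
      qed
      also have "\<dots> = exp (- lam) * shift_sum u (\<lambda>l. exp (lam * of_int l) * a l) g"
        unfolding shift_sum_def translate_def by (rule infsum_cmult_right')
      also have "\<dots> = exp (- lam) * (LINT t|lborel. exp (lam * of_real t) * G t * g t)"
        using r g unfolding represents_def by (simp add: regular_dist_def)
      also have "(LINT t|lborel. exp (lam * of_real t) * G t * g t)
          = (LINT t|lborel. exp (lam * of_real (1 + t)) * G (1 + t) * g (1 + t))"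
        using lborel_integral_real_affine[of 1 "\<lambda>t. exp (lam * of_real t) * G t * g t" 1] by simp
      also have "exp (- lam) * \<dots> = (LINT t|lborel. exp (- lam) * (exp (lam * of_real (1 + t)) * G (1 + t) * g (1 + t)))"
        by simp
      also have "\<dots> = (LINT t|lborel. exp (lam * of_real t) * G (t + 1) * f t)"
      proof (rule Bochner_Integration.integral_cong[OF refl])
        fix t :: real
        have "exp (lam * of_real t) = exp (- lam) * exp (lam * of_real (1 + t))"
          unfolding exp_add[symmetric] by (simp add: algebra_simps)
        then show "exp (- lam) * (exp (lam * of_real (1 + t)) * G (1 + t) * g (1 + t)) = exp (lam * of_real t) * G (t + 1) * f t"
          by (simp add: g_def add.commute mult.assoc)
      qed
      finally show ?thesis using f by (simp add: regular_dist_def)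
    qed (simp add: shift_sum_outside[OF u(1)] regular_dist_def)
  qed
qed

lemma represents_fdiff_iter:
  assumes u: "distribution u" "compactly_supported u" and r: "represents u lam a G"
  shows "represents u lam ((fdiff ^^ n) a) ((fdiff ^^ n) G)"
proof (induction n)
  case (Suc n)
  have eq: "(fdiff ^^ Suc n) a = (\<lambda>l. 1 * (fdiff ^^ n) a (l + 1) + (- 1) * (fdiff ^^ n) a l)"
    "(fdiff ^^ Suc n) G = (\<lambda>t. 1 * (fdiff ^^ n) G (t + 1) + (- 1) * (fdiff ^^ n) G t)"
    by (simp_all add: fun_eq_iff fdiff_def)
  show ?case unfolding eq by (rule represents_add[OF u represents_translate[OF u Suc] Suc])
qed (simp add: r)

text \<open>Here linear independence of the shifts enters.\<close>

lemma represents_zero_function: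
  assumes u: "distribution u" "compactly_supported u" "shifts_independent u" and r: "represents u lam a (\<lambda>t. 0)"
  shows "a = (\<lambda>l. 0)"
proof
  fix l
  have "shift_sum u (\<lambda>l. exp (lam * of_int l) * a l) = (\<lambda>f. 0)"
    using r unfolding represents_def by (auto simp: regular_dist_def fun_eq_iff)
  from shifts_independentD[OF u(3) this, of l] show "a l = 0" by simp
qed

lemma represents_zero_sequence:
  assumes r: "represents u lam (\<lambda>l. 0) G"
  shows "G t = 0"
proof -
  have G: "real_analytic G" using r by (simp add: represents_def)
  have "regular_dist (\<lambda>t. exp (lam * of_real t) * G t) f = 0" for f
  proof -
    have "shift_sum u (\<lambda>l. exp (lam * of_int l) * 0) f = 0" by (simp add: shift_sum_def)
    then show ?thesis using r by (simp add: represents_def)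
  qed
  then have "exp (lam * of_real t) * G t = 0"
    by (intro regular_dist_eq_0_imp[OF continuous_on_exp_times[OF G]]) (metis regular_dist_def)
  then show ?thesis by simp
qed

text \<open>The lower differences of \<open>a\<close> are represented too, and the difference of order \<open>d - i\<close> is a Newton
  polynomial of exact degree \<open>i\<close>. By induction on \<open>i\<close> the elements of Newton's basis up to degree \<open>d\<close>
  are represented, and then so are the monomials.\<close>

lemma represents_powers:
  assumes u: "distribution u" "compactly_supported u" and r: "represents u lam a G"
    and a: "(fdiff ^^ Suc d) a = (\<lambda>l. 0)" "(fdiff ^^ d) a 0 \<noteq> 0" and j: "j \<le> d"
  shows "\<exists>H. represents u lam (\<lambda>l. of_int l ^ j) H"
proof -
  have gb: "\<exists>H. represents u lam (\<lambda>l. of_int l gchoose i) H" if "i \<le> d" for i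
    using that
  proof (induction i rule: less_induct)
    case (less i)
    define b where "b = (fdiff ^^ (d - i)) a"
    define \<kappa> where "\<kappa> = (fdiff ^^ d) a 0"
    have it: "(fdiff ^^ n) b = (fdiff ^^ (n + (d - i))) a" for n
      by (simp add: b_def funpow_add)
    have "(fdiff ^^ Suc i) b = (\<lambda>l. 0)" using it[of "Suc i"] less.prems a(1) by simp
    from newton_series[OF this] have "b l = (\<Sum>k<i. (fdiff ^^ k) b 0 * (of_int l gchoose k)) + \<kappa> * (of_int l gchoose i)" for l
      using it[of i] less.prems by (simp add: \<kappa>_def)
    then have eq: "(of_int l gchoose i) = (1 / \<kappa>) * b l + (- 1 / \<kappa>) * (\<Sum>k<i. (fdiff ^^ k) b 0 * (of_int l gchoose k))" for l
      using a(2) by (simp add: \<kappa>_def field_simps)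
    have "\<forall>k\<in>{..<i}. \<exists>H. represents u lam (\<lambda>l. of_int l gchoose k) H" using less by auto
    from bchoice[OF this] obtain H where H: "\<forall>k\<in>{..<i}. represents u lam (\<lambda>l. of_int l gchoose k) (H k)" ..
    have rb: "represents u lam b ((fdiff ^^ (d - i)) G)"
      unfolding b_def by (rule represents_fdiff_iter[OF u r])
    define S where "S l = (\<Sum>k<i. (fdiff ^^ k) b 0 * (of_int l gchoose k))" for l :: int
    have rS: "represents u lam S (\<lambda>t. \<Sum>k<i. (fdiff ^^ k) b 0 * H k t)"
      unfolding S_def[abs_def]
      by (rule represents_sum[OF u, of "{..<i}" lam "\<lambda>k l. of_int l gchoose k" H]) (rule H[rule_format])
    have "(\<lambda>l. of_int l gchoose i) = (\<lambda>l. (1 / \<kappa>) * b l + (- 1 / \<kappa>) * S l)"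
      unfolding S_def using eq by (rule ext)
    with represents_add[OF u rb rS, of "1 / \<kappa>" "- 1 / \<kappa>"] show ?case by (intro exI) simp
  qed
  \<comment> \<open>Each factor \<open>l\<close> moves Newton's basis up by at most one step.\<close>
  have "\<exists>H. represents u lam (\<lambda>l. of_int l ^ j * (of_int l gchoose i)) H" if "i + j \<le> d" for i
    using that
  proof (induction j arbitrary: i)
    case 0
    then show ?case using gb[of i] by simp
  next
    case (Suc j)
    obtain H1 where H1: "represents u lam (\<lambda>l. of_int l ^ j * (of_int l gchoose i)) H1" using Suc.IH[of i] Suc.prems by auto
    obtain H2 where H2: "represents u lam (\<lambda>l. of_int l ^ j * (of_int l gchoose Suc i)) H2" using Suc.IH[of "Suc i"] Suc.prems by auto
    have eq: "of_int l ^ Suc j * (of_int l gchoose i :: complex) = of_nat i * (of_int l ^ j * (of_int l gchoose i))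
        + of_nat (Suc i) * (of_int l ^ j * (of_int l gchoose Suc i))" for l :: int
    proof -
      have "of_int l ^ Suc j * (of_int l gchoose i :: complex) = of_int l ^ j * (of_int l * (of_int l gchoose i))"
        by simp
      then show ?thesis unfolding gbinomial_mult_1 by (simp add: algebra_simps del: of_nat_Suc)
    qed
    show ?case
      unfolding eq using represents_add[OF u H1 H2, of "of_nat i" "of_nat (Suc i)"] by (intro exI)
  qed
  from this[of 0] j show ?thesis by simp
qed

section \<open>Fourier decay from analyticity\<close>

text \<open>In this form the sum is visibly unchanged when the test function is translated by an
  integer.\<close>

lemma moment_sum_exp_twist:
  assumes u: "distribution u" and \<psi>: "\<psi> \<in> test_functions"
  shows "moment_sum u lam k (\<lambda>t. exp (- lam * of_real t) * \<psi> t)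
    = (\<Sum>\<^sub>\<infinity>m. u (\<lambda>x. of_real x ^ k * exp (- lam * of_real x) * \<psi> (x + of_int m)))"
  unfolding moment_sum_def
proof (rule infsum_cong)
  fix m :: int
  let ?g = "\<lambda>x. of_real x ^ k * exp (- lam * of_real x) * \<psi> (x + of_int m)"
  have t: "?g \<in> test_functions"
    by (intro test_function_mult_smooth(2) test_function_translate \<psi> smooth_mult smooth_power smooth_of_real smooth_exp)
  have "(\<lambda>x. of_real x ^ k * (exp (- lam * of_real (x + of_int m)) * \<psi> (x + of_int m))) = (\<lambda>x. exp (- lam * of_int m) * ?g x)"
  proof
    fix x
    have "exp (- lam * of_real (x + of_int m)) = exp (- lam * of_int m) * exp (- lam * of_real x)"
      unfolding exp_add[symmetric] by (simp add: algebra_simps)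
    then show "of_real x ^ k * (exp (- lam * of_real (x + of_int m)) * \<psi> (x + of_int m)) = exp (- lam * of_int m) * ?g x"
      by (simp only: mult_ac)
  qed
  then have "exp (lam * of_int m) * u (\<lambda>x. of_real x ^ k * (exp (- lam * of_real (x + of_int m)) * \<psi> (x + of_int m)))
     = exp (lam * of_int m) * (exp (- lam * of_int m) * u ?g)"
    by (simp only: distribution_cmult[OF u t])
  also have "\<dots> = u ?g" unfolding mult.assoc[symmetric] exp_add[symmetric] by simp
  finally show "exp (lam * of_int m) * u (\<lambda>x. of_real x ^ k * (exp (- lam * of_real (x + of_int m)) * \<psi> (x + of_int m))) = u ?g" .
qed

text \<open>If the moment sum is \<open>exp (lam t) P t\<close> with an analytic \<open>P\<close>, its invariance under integer
  translations makes \<open>P\<close> periodic. Testing against \<open>\<eta>\<close> times a periodic exponential, where the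
  translates of \<open>\<eta>\<close> add up to \<open>1\<close>, gives a Fourier coefficient of \<open>P\<close> on one side. On the other side
  the translates of \<open>\<eta>\<close> add up to a cutoff function, which gives the derivative of the Fourier
  transform. The coefficients of an analytic periodic function decay exponentially.\<close>

lemma fourier_decay_if_moment_sum_analytic:
  assumes u: "distribution u" "compactly_supported u" and P: "real_analytic P"
    and eq: "\<And>f. f \<in> test_functions \<Longrightarrow> moment_sum u lam k f = (LINT t|lborel. exp (lam * of_real t) * P t * f t)"
  shows "exp_decay (fourier_deriv_seq u lam k)"
proof -
  have Pc: "continuous_on UNIV P" by (intro smooth_imp_continuous_on real_analytic_smooth P)
  have eq': "(LINT t|lborel. P t * \<psi> t) = (\<Sum>\<^sub>\<infinity>m. u (\<lambda>x. of_real x ^ k * exp (- lam * of_real x) * \<psi> (x + of_int m)))"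
    if \<psi>: "\<psi> \<in> test_functions" for \<psi>
  proof -
    have e: "exp (lam * of_real t) * P t * (exp (- lam * of_real t) * \<psi> t) = P t * \<psi> t" for t
    proof -
      have "exp (lam * of_real t) * exp (- lam * of_real t) = 1" unfolding exp_add[symmetric] by simp
      then show ?thesis by (metis (no_types, lifting) mult.assoc mult.commute mult_1)
    qed
    have "(\<lambda>t. exp (- lam * of_real t) * \<psi> t) \<in> test_functions"
      by (intro test_function_mult_smooth(2) \<psi> smooth_exp)
    from eq[OF this] show ?thesis unfolding e moment_sum_exp_twist[OF u(1) \<psi>] ..
  qed
  have per: "P (t + 1) = P t" for t
  proof -
    have "P (t + 1) - P t = 0"
    proof (rule regular_dist_eq_0_imp[where g="\<lambda>t. P (t + 1) - P t"])
      have Pc': "continuous_on UNIV (\<lambda>t. P (t + 1))"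
        by (intro continuous_on_compose2[OF Pc] continuous_intros) auto
      then show "continuous_on UNIV (\<lambda>t. P (t + 1) - P t)" by (intro continuous_intros Pc)
      fix \<psi> :: "real \<Rightarrow> complex" assume \<psi>: "\<psi> \<in> test_functions"
      define \<theta> where "\<theta> x = \<psi> (x + (- 1))" for x
      have \<theta>: "\<theta> \<in> test_functions" unfolding \<theta>_def by (rule test_function_translate[OF \<psi>])
      have "(LINT t|lborel. P (t + 1) * \<psi> t) = (LINT t|lborel. P t * \<theta> t)"
        using lborel_integral_real_affine[of 1 "\<lambda>t. P t * \<theta> t" 1] by (simp add: \<theta>_def add.commute)
      also have "\<dots> = (\<Sum>\<^sub>\<infinity>m. u (\<lambda>x. of_real x ^ k * exp (- lam * of_real x) * \<psi> (x + of_int (m + (- 1)))))"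
        unfolding eq'[OF \<theta>] by (simp add: \<theta>_def algebra_simps)
      also have "\<dots> = (\<Sum>\<^sub>\<infinity>m. u (\<lambda>x. of_real x ^ k * exp (- lam * of_real x) * \<psi> (x + of_int m)))"
        by (rule infsum_reindex_bij_betw[where g="\<lambda>m. m + (- 1)"
             and f="\<lambda>m. u (\<lambda>x. of_real x ^ k * exp (- lam * of_real x) * \<psi> (x + of_int m))"])
           (rule bij_betwI[where g="\<lambda>m. m + 1"], auto)
      also have "\<dots> = (LINT t|lborel. P t * \<psi> t)" by (rule eq'[OF \<psi>, symmetric])
      finally show "(LINT t|lborel. (P (t + 1) - P t) * \<psi> t) = 0"
        unfolding left_diff_distrib
        by (subst Bochner_Integration.integral_diff[OF integrable_regular[OF Pc' \<psi>] integrable_regular[OF Pc \<psi>]]) simp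
    qed
    then show ?thesis by simp
  qed
  obtain \<eta> where \<eta>: "\<eta> \<in> test_functions" "\<And>x. x \<notin> {0..2} \<Longrightarrow> \<eta> x = 0"
    "\<And>N x. \<bar>x\<bar> + 1 \<le> real N \<Longrightarrow> (\<Sum>l\<in>{- int N..int N}. \<eta> (x + of_int l)) = 1"
    using partition_of_unity_exists by blast
  obtain R where R: "dist_support u \<subseteq> {- real R<..<real R}"
    using dist_support_bounded[OF u(2)] by blast
  have "fourier_deriv_seq u lam k l =
      (- 2 * of_real pi * \<i>) ^ k * integral {0..1} (\<lambda>t. P t * exp (- (2 * of_real pi * \<i> * of_int l) * of_real t))" for l
  proof -
    define \<psi> where "\<psi> t = \<eta> t * osc (- l) t" for t
    have \<psi>: "\<psi> \<in> test_functions" unfolding \<psi>_def by (rule test_function_osc[OF \<eta>(1)])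
    obtain N0 :: nat where
      N0: "\<And>(m::int) g. \<bar>m\<bar> > int N0 \<Longrightarrow> smooth g \<Longrightarrow> u (\<lambda>x. g x * \<psi> (x + of_int m)) = 0"
      using shifts_eventually_off_support[OF u \<psi>] by blast
    \<comment> \<open>\<open>N0\<close> exhausts the translates of \<open>\<psi>\<close>, and \<open>R + 1\<close> translates of \<open>\<eta>\<close> to each side make a cutoff function.\<close>
    define N where "N = N0 + R + 2"
    define h where "h x = (\<Sum>m\<in>{- int N..int N}. \<eta> (x + of_int m))" for x
    have h: "is_cutoff u h"
      unfolding h_def[abs_def] by (rule is_cutoff_partition_sum[OF R \<eta>(1,3)]) (auto simp: N_def)
    let ?e = "\<lambda>x. of_real x ^ k * exp ((- lam - 2 * of_real pi * \<i> * of_int l) * of_real x)"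
    have sm: "smooth (\<lambda>x. of_real x ^ k * exp (- lam * of_real x))"
      by (intro smooth_mult smooth_power smooth_of_real smooth_exp)
    have "(LINT t|lborel. P t * \<psi> t) = (\<Sum>m\<in>{- int N..int N}. u (\<lambda>x. of_real x ^ k * exp (- lam * of_real x) * \<psi> (x + of_int m)))"
      unfolding eq'[OF \<psi>] by (rule infsum_int_finite) (rule N0[OF _ sm], simp add: N_def)
    also have "\<dots> = u (\<lambda>x. \<Sum>m\<in>{- int N..int N}. of_real x ^ k * exp (- lam * of_real x) * \<psi> (x + of_int m))"
      by (rule distribution_sum[OF u(1), symmetric])
         (rule test_function_mult_smooth(2)[OF test_function_translate[OF \<psi>] sm])
    also have "(\<lambda>x. \<Sum>m\<in>{- int N..int N}. of_real x ^ k * exp (- lam * of_real x) * \<psi> (x + of_int m)) = (\<lambda>x. h x * ?e x)"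
    proof
      fix x
      have e: "exp ((- lam - 2 * of_real pi * \<i> * of_int l) * of_real x) = exp (- lam * of_real x) * osc (- l) x"
        unfolding exp_add[symmetric] by (simp add: algebra_simps)
      show "(\<Sum>m\<in>{- int N..int N}. of_real x ^ k * exp (- lam * of_real x) * \<psi> (x + of_int m)) = h x * ?e x"
        unfolding h_def \<psi>_def osc_periodic e sum_distrib_right by (simp only: mult_ac)
    qed
    finally have 1: "(LINT t|lborel. P t * \<psi> t) = u (\<lambda>x. h x * ?e x)" .
    have \<psi>c: "continuous_on UNIV (\<lambda>t. P t * \<psi> t)"
      by (intro continuous_on_mult Pc smooth_imp_continuous_on test_function_smooth \<psi>)
    \<comment> \<open>The number \<open>2\<close> covers the support of \<open>\<eta>\<close> and suffices for the partition of unity on the unit interval.\<close>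
    have "(LINT t|lborel. P t * \<psi> t) = integral {- real 2..real 2 + 1} (\<lambda>t. P t * \<psi> t)"
      by (rule lint_eq_integral[OF \<psi>c]) (auto simp: \<psi>_def intro!: \<eta>(2))
    also have "\<dots> = integral {0..1} (\<lambda>t. \<Sum>m\<in>{- int 2..int 2}. P (t + of_int m) * \<psi> (t + of_int m))"
      by (rule integral_fold_unit_interval[OF \<psi>c])
    also have "\<dots> = integral {0..1} (\<lambda>t. P t * osc (- l) t)"
    proof (rule integral_cong)
      fix t :: real assume t: "t \<in> {0..1}"
      have "P (t + of_int m) = P t" for m :: int
      proof (induction m rule: int_induct[where k=0])
        case (step1 i)
        then show ?case using per[of "t + of_int i"] by (simp add: add.assoc)
      next
        case (step2 i)
        then show ?case using per[of "t + of_int (i - 1)"] by (simp add: algebra_simps)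
      qed simp
      then have "(\<Sum>m\<in>{- int 2..int 2}. P (t + of_int m) * \<psi> (t + of_int m))
         = P t * osc (- l) t * (\<Sum>m\<in>{- int 2..int 2}. \<eta> (t + of_int m))"
        unfolding \<psi>_def osc_periodic sum_distrib_left by (simp only: mult_ac)
      also have "(\<Sum>m\<in>{- int 2..int 2}. \<eta> (t + of_int m)) = 1" by (rule \<eta>(3)) (use t in auto)
      finally show "(\<Sum>m\<in>{- int 2..int 2}. P (t + of_int m) * \<psi> (t + of_int m)) = P t * osc (- l) t" by simp
    qed
    finally have "u (\<lambda>x. h x * ?e x) = integral {0..1} (\<lambda>t. P t * osc (- l) t)" unfolding 1 .
    then show ?thesis unfolding fourier_deriv_seq_eq[OF u h] by simp
  qed
  moreover obtain C q where Cq: "C > 0" "0 < q" "q < 1"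
    "\<And>l. cmod (integral {0..1} (\<lambda>t. P t * exp (- (2 * of_real pi * \<i> * of_int l) * of_real t))) \<le> C * q ^ nat \<bar>l\<bar>"
    using analytic_periodic_fourier_decay[OF P per] unfolding exp_decay_def by blast
  ultimately have "cmod (fourier_deriv_seq u lam k l) \<le> ((2 * pi) ^ k * C) * q ^ nat \<bar>l\<bar>" for l
    by (simp add: norm_mult norm_power mult.assoc)
  then show ?thesis
    unfolding exp_decay_def using Cq by (intro exI[of _ "(2 * pi) ^ k * C"] exI[of _ q]) auto
qed

text \<open>The moment sum of order \<open>k\<close> is a combination, with polynomial coefficients, of the weighted
  shift sums up to order \<open>k\<close>. If these are analytic, so is the moment sum.\<close>

lemma decay_if_represents:
  assumes u: "distribution u" "compactly_supported u"
    and r: "\<And>j. j \<le> k \<Longrightarrow> represents u lam (\<lambda>l. of_int l ^ j) (G j)"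
  shows "exp_decay (fourier_deriv_seq u lam k)"
proof (rule fourier_decay_if_moment_sum_analytic[OF u])
  let ?P = "\<lambda>t. \<Sum>j\<le>k. of_nat (k choose j) * (- 1) ^ j * (of_real t ^ (k - j) * G j t)"
  have G: "real_analytic (G j)" if "j \<le> k" for j using r[OF that] by (simp add: represents_def)
  show "real_analytic ?P"
    by (intro real_analytic_sum real_analytic_mult real_analytic_const G
         real_analytic_holomorphic[of "\<lambda>z. z ^ _"] holomorphic_intros) auto
  fix f assume f: "f \<in> test_functions"
  have fi: "(\<lambda>t. of_real t ^ i * f t) \<in> test_functions" for i by (rule test_function_moment(1)[OF f])
  have c: "continuous_on UNIV (\<lambda>t. exp (lam * of_real t) * G j t)" if "j \<le> k" for j
    by (rule continuous_on_exp_times[OF G[OF that]])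
  have "moment_sum u lam k f = (\<Sum>j\<le>k. of_nat (k choose j) * (- 1) ^ j *
      (LINT t|lborel. exp (lam * of_real t) * G j t * (of_real t ^ (k - j) * f t)))"
    unfolding moment_sum_eq_shift_sums[OF u f]
  proof (intro sum.cong refl)
    fix j assume "j \<in> {..k}"
    then have "shift_sum u (\<lambda>l. exp (lam * of_int l) * of_int l ^ j) = regular_dist (\<lambda>t. exp (lam * of_real t) * G j t)"
      using r unfolding represents_def by simp
    then show "of_nat (k choose j) * (- 1) ^ j *
      shift_sum u (\<lambda>l. exp (lam * of_int l) * of_int l ^ j) (\<lambda>t. of_real t ^ (k - j) * f t) =
      of_nat (k choose j) * (- 1) ^ j * (LINT t|lborel. exp (lam * of_real t) * G j t * (of_real t ^ (k - j) * f t))"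
      using fi by (simp add: regular_dist_def)
  qed
  also have "\<dots> = (\<Sum>j\<le>k. LINT t|lborel. of_nat (k choose j) * (- 1) ^ j *
      (exp (lam * of_real t) * G j t * (of_real t ^ (k - j) * f t)))"
    by simp
  also have "\<dots> = (LINT t|lborel. (\<Sum>j\<le>k. of_nat (k choose j) * (- 1) ^ j *
      (exp (lam * of_real t) * G j t * (of_real t ^ (k - j) * f t))))"
    by (intro Bochner_Integration.integral_sum[symmetric] integrable_mult_right integrable_regular[OF c fi]) simp
  also have "\<dots> = (LINT t|lborel. exp (lam * of_real t) * ?P t * f t)"
    unfolding sum_distrib_left sum_distrib_right by (simp only: mult_ac)
  finally show "moment_sum u lam k f = (LINT t|lborel. exp (lam * of_real t) * ?P t * f t)" .
qed

text \<open>Let \<open>a\<close> be the coefficients of \<open>g\<close>, divided by the exponential. The difference of order \<open>d + 1\<close>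
  annihilates \<open>G = \<Sum> p k \<omega> k\<close>, hence \<open>a\<close> as well. The difference of order \<open>d\<close> of \<open>G\<close> is a
  nonzero multiple of \<open>\<omega> d\<close>, since only the summand with the polynomial of degree \<open>d\<close> survives, and
  therefore the constant difference of order \<open>d\<close> of \<open>a\<close> is not zero.\<close>

lemma decay_if_analytic_in_shift_space:
  assumes u: "distribution u" "compactly_supported u" "shifts_independent u"
    and \<omega>: "\<And>k. k \<le> d \<Longrightarrow> real_analytic (\<omega> k)" "\<And>k t. k \<le> d \<Longrightarrow> \<omega> k (t + 1) = \<omega> k t"
    and nz: "\<omega> d t0 \<noteq> 0" and p: "\<And>k. k \<le> d \<Longrightarrow> p k \<noteq> 0 \<and> degree (p k) = k"
    and mem: "regular_dist (\<lambda>t. exp (lam * of_real t) * (\<Sum>k\<le>d. poly (p k) (of_real t) * \<omega> k t))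
          \<in> shift_invariant_space u"
    and k: "k \<le> d"
  shows "exp_decay (fourier_deriv_seq u lam k)"
proof -
  define G where "G t = (\<Sum>k\<le>d. poly (p k) (of_real t) * \<omega> k t)" for t
  obtain c where c: "regular_dist (\<lambda>t. exp (lam * of_real t) * G t) = shift_sum u c"
    using mem unfolding shift_invariant_space_def G_def by blast
  define a where "a l = exp (- lam * of_int l) * c l" for l
  have "exp (lam * of_int l) * a l = c l" for l
    unfolding a_def mult.assoc[symmetric] exp_add[symmetric] by simp
  moreover have "real_analytic G"
    unfolding G_def[abs_def]
    by (intro real_analytic_sum real_analytic_mult \<omega>(1) real_analytic_holomorphic holomorphic_intros) auto
  ultimately have r: "represents u lam a G" unfolding represents_def using c by simp
  have Gn: "(fdiff ^^ n) G = (\<lambda>t. \<Sum>k\<le>d. poly ((pdiff ^^ n) (p k)) (of_real t) * \<omega> k t)" for n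
    unfolding G_def[abs_def] by (rule fdiff_iter_poly_periodic) (rule \<omega>(2))
  have "(fdiff ^^ Suc d) G = (\<lambda>t. 0)"
  proof -
    have "(pdiff ^^ Suc d) (p k) = 0" if "k \<le> d" for k
      using p[OF that] that by (intro pdiff_iter_eq_0) auto
    then show ?thesis unfolding Gn by (simp del: funpow.simps)
  qed
  then have "represents u lam ((fdiff ^^ Suc d) a) (\<lambda>t. 0)" using represents_fdiff_iter[OF u(1,2) r, of "Suc d"] by simp
  then have a1: "(fdiff ^^ Suc d) a = (\<lambda>l. 0)" by (rule represents_zero_function[OF u])
  have nzG: "(fdiff ^^ d) G t0 \<noteq> 0"
  proof -
    let ?r = "(pdiff ^^ d) (p d)"
    have "?r \<noteq> 0"
      using degree_less_if_pdiff_iter_eq_0[of d "p d"] p[of d] by auto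
    moreover have "degree ?r = 0" using degree_pdiff_iter[of d "p d"] p[of d] by simp
    ultimately have "poly ?r (of_real t0) \<noteq> 0" by (auto elim!: degree_eq_zeroE)
    moreover have "(fdiff ^^ d) G t0 = (\<Sum>k\<in>{d}. poly ((pdiff ^^ d) (p k)) (of_real t0) * \<omega> k t0)"
      unfolding Gn
    proof (rule sum.mono_neutral_right)
      show "\<forall>k\<in>{..d} - {d}. poly ((pdiff ^^ d) (p k)) (of_real t0) * \<omega> k t0 = 0"
      proof
        fix k assume "k \<in> {..d} - {d}"
        then have "(pdiff ^^ d) (p k) = 0" using p[of k] by (intro pdiff_iter_eq_0) auto
        then show "poly ((pdiff ^^ d) (p k)) (of_real t0) * \<omega> k t0 = 0" by simp
      qed
    qed auto
    ultimately show ?thesis using nz by simp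
  qed
  have const: "(fdiff ^^ d) a l = (fdiff ^^ d) a 0" for l
  proof (rule eq_if_fdiff_eq[where b="\<lambda>_. (fdiff ^^ d) a 0"])
    fix l
    have "fdiff ((fdiff ^^ d) a) l = 0" using fun_cong[OF a1, of l] by simp
    then show "fdiff ((fdiff ^^ d) a) l = fdiff (\<lambda>_. (fdiff ^^ d) a 0) l" by (simp only: fdiff_def diff_self)
  qed simp
  have "(fdiff ^^ d) a 0 \<noteq> 0"
  proof
    assume "(fdiff ^^ d) a 0 = 0"
    then have "(fdiff ^^ d) a = (\<lambda>l. 0)" using const by (intro ext) simp
    then have "represents u lam (\<lambda>l. 0) ((fdiff ^^ d) G)" using represents_fdiff_iter[OF u(1,2) r, of d] by simp
    from represents_zero_sequence[OF this] nzG show False by simp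
  qed
  then have "\<forall>j\<in>{..d}. \<exists>H. represents u lam (\<lambda>l. of_int l ^ j) H"
    using represents_powers[OF u(1,2) r a1] by blast
  from bchoice[OF this] obtain H where H: "\<forall>j\<in>{..d}. represents u lam (\<lambda>l. of_int l ^ j) (H j)" ..
  show ?thesis
    by (rule decay_if_represents[OF u(1,2)], rule H[rule_format]) (use k in simp)
qed

theorem theorem3p1:
  fixes \<phi> :: functional
  assumes "distribution \<phi>"
    and "compactly_supported \<phi>"
    and "shifts_independent \<phi>"
  shows
    "(\<forall>(lam :: complex) (d :: nat) (p :: nat \<Rightarrow> complex poly) (\<omega> :: nat \<Rightarrow> real \<Rightarrow> complex).
        (\<forall>k\<le>d. real_analytic (\<omega> k) \<and> (\<forall>t. \<omega> k (t + 1) = \<omega> k t)) \<and>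
        (\<exists>t. \<omega> d t \<noteq> 0) \<and>
        (\<forall>k\<le>d. p k \<noteq> 0 \<and> degree (p k) = k) \<and>
        regular_dist (\<lambda>t. exp (lam * of_real t) * (\<Sum>k\<le>d. poly (p k) (of_real t) * \<omega> k t))
          \<in> shift_invariant_space \<phi>
        \<longrightarrow> (\<forall>k\<le>d. exp_decay (fourier_deriv_seq \<phi> lam k)))
     \<and>
     (\<forall>(lam :: complex) (d :: nat).
        (\<forall>k\<le>d. exp_decay (fourier_deriv_seq \<phi> lam k))
        \<longrightarrow>
        H_space \<phi> lam d \<subseteq> shift_invariant_space \<phi> \<and>
        functional.subspace (H_space \<phi> lam d) \<and>
        functional.dim (H_space \<phi> lam d) = d + 1 \<and>
        (\<forall>u\<in>H_space \<phi> lam d. \<exists>g. real_analytic g \<and> u = regular_dist g) \<and>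
        H_space \<phi> lam d =
          functional.span ((\<lambda>k. shift_sum \<phi> (\<lambda>l. exp (lam * of_int l) * of_int l ^ k)) ` {..d}) \<and>
        (\<forall>k\<le>d. shift_sum \<phi> (\<lambda>l. exp (lam * of_int l) * of_int l ^ k) =
          regular_dist (\<lambda>t. exp (lam * of_real t) *
            (\<Sum>j\<le>k. of_nat (k choose j) * of_real t ^ (k - j) * (- 1) ^ j * omega \<phi> lam j t))) \<and>
        (\<forall>k\<le>d. (\<forall>t::real. (\<lambda>l. fourier_deriv_seq \<phi> lam k l *
              exp (2 * of_real pi * \<i> * of_int l * of_real t)) summable_on UNIV) \<and>
            (\<forall>t. omega \<phi> lam k (t + 1) = omega \<phi> lam k t) \<and>
            real_analytic (omega \<phi> lam k)))"
\<comment> \<open>The instantiation splits only the outermost conjunction.\<close>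
proof (intro conjI[where P="\<forall>lam d p \<omega>. _ lam d p \<omega>"] allI impI)
  fix lam :: complex and d :: nat and p :: "nat \<Rightarrow> complex poly" and \<omega> :: "nat \<Rightarrow> real \<Rightarrow> complex" and k :: nat
  assume A: "(\<forall>k\<le>d. real_analytic (\<omega> k) \<and> (\<forall>t. \<omega> k (t + 1) = \<omega> k t)) \<and>
        (\<exists>t. \<omega> d t \<noteq> 0) \<and>
        (\<forall>k\<le>d. p k \<noteq> 0 \<and> degree (p k) = k) \<and>
        regular_dist (\<lambda>t. exp (lam * of_real t) * (\<Sum>k\<le>d. poly (p k) (of_real t) * \<omega> k t))
          \<in> shift_invariant_space \<phi>" and k: "k \<le> d"
  then obtain t0 where "\<omega> d t0 \<noteq> 0" by blast
  then show "exp_decay (fourier_deriv_seq \<phi> lam k)"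
    using A k by (intro decay_if_analytic_in_shift_space[OF assms, of d \<omega> t0 p]) auto
qed (rule analytic_shift_sums_if_decay[OF assms])

end
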